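(* Let $G$ be a countable group and let $\mathbf{X}=(X,\mathcal{B},\mu,\mathbf{T})$, with $\mathbf{T}=\{T_g\}_{g\in G}$, be an element of $\mathbb{A}(G)$. Let $\mu=\int_{\bar X}\mu_{\bar x}\,d\bar\mu(\bar x)$ be its ergodic decomposition, let $\mathbf{T}_{\bar x}$ denote the ergodic component (the ergodic $G$-system given by $\mathbf{T}$ with the invariant measure $\mu_{\bar x}$) corresponding to $\bar x\in\bar X$, and let $$D=\{(\bar x_1,\bar x_2)\in\bar X\times\bar X:\ \mathbf{T}_{\bar x_1}\perp\mathbf{T}_{\bar x_2}\}.$$ (1) If $\mathbf{T}$ is disjoint from every ergodic $\mathbf{S}\in\mathcal{E}(G)$, then the set $D$ has $\bar\mu\times\bar\mu$ measure $1$. (2) Conversely, if $(\bar\mu\times\bar\mu)(D)=1$, then $\mathbf{X}$ is disjoint from all ergodic systems $\mathbf{Y}=(Y,\mathcal{C},\eta,\mathbf{S})\in\mathbb{A}(G)$.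
   Context: $\mathbb{A}(G)$ is the Polish space of probability measure preserving actions of $G$ (on $[0,1]$ with Lebesgue measure, up to isomorphism of the underlying space), and $\mathcal{E}(G)\subset\mathbb{A}(G)$ is the set of ergodic actions. A joining of two $G$-systems $(X,\mathcal B,\mu,\{T_g\})$ and $(Y,\mathcal C,\eta,\{S_g\})$ is a probability measure on $X\times Y$ with marginals $\mu$ and $\eta$ that is invariant under $T_g\times S_g$ for every $g\in G$. The systems are disjoint, written $\perp$, if $\mu\times\eta$ is their only joining. In the ergodic decomposition $\mu=\int_{\bar X}\mu_{\bar x}\,d\bar\mu(\bar x)$, $(\bar X,\bar\mu)$ is the probability space of ergodic components of $\mathbf{X}$ and the measures $\mu_{\bar x}$ are $G$-invariant and ergodic.
   Formalization: In part (1) the group G is assumed countably infinite: for finite G the set E(G) is empty, and (1) fails, e.g. for Z/2 acting on [0,1) by x ↦ x+1/2, where D is empty. Part (2) covers every countable G. *)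

theory Defs
  imports "HOL-Probability.Probability" "HOL-Algebra.Group_Action"
begin

definition isomorphic_mod0 :: "'a measure \<Rightarrow> 'b measure \<Rightarrow> bool" where
  "isomorphic_mod0 M L \<longleftrightarrow>
     (\<exists>f f'. f \<in> M \<rightarrow>\<^sub>M L \<and> f' \<in> L \<rightarrow>\<^sub>M M \<and> distr M L f = L \<and>
        (AE x in M. f' (f x) = x) \<and> (AE y in L. f (f' y) = y))"

definition unit_lebesgue :: "real measure" where
  "unit_lebesgue = restrict_space lborel {0..1}"

text \<open>No condition is put on the space underlying a system, since the
  ergodic components of a system on the unit interval may have atoms.
  The locale \<^const>\<open>group_action\<close> takes the maps \<open>T g\<close> to be bijections of
  \<open>space M\<close>, extended by \<open>undefined\<close> outside \<open>space M\<close>.\<close>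

definition pmp_system :: "('g, 'k) monoid_scheme \<Rightarrow> 'a measure \<Rightarrow> ('g \<Rightarrow> 'a \<Rightarrow> 'a) \<Rightarrow> bool" where
  "pmp_system G M T \<longleftrightarrow> prob_space M \<and> group_action G (space M) T \<and>
     (\<forall>g\<in>carrier G. T g \<in> M \<rightarrow>\<^sub>M M \<and> distr M M (T g) = M)"

definition ergodic_system :: "('g, 'k) monoid_scheme \<Rightarrow> 'a measure \<Rightarrow> ('g \<Rightarrow> 'a \<Rightarrow> 'a) \<Rightarrow> bool" where
  "ergodic_system G M T \<longleftrightarrow> pmp_system G M T \<and>
     (\<forall>A\<in>sets M. (\<forall>g\<in>carrier G. T g -` A \<inter> space M = A) \<longrightarrow>
        measure M A = 0 \<or> measure M A = 1)"

text \<open>The classes \<open>\<bbbA>(G)\<close> and \<open>\<E>(G)\<close>. The underlying space is only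
  determined up to isomorphism, so it may have any carrier type.
  An ergodic action of a finite group lives on finitely many points up to a null
  set, so \<open>\<E>(G)\<close> is empty for finite \<open>G\<close>.\<close>

definition pmp_actions :: "('g, 'k) monoid_scheme \<Rightarrow> ('a measure \<times> ('g \<Rightarrow> 'a \<Rightarrow> 'a)) set" where
  "pmp_actions G = {(M, T). isomorphic_mod0 M unit_lebesgue \<and> pmp_system G M T}"

definition ergodic_actions :: "('g, 'k) monoid_scheme \<Rightarrow> ('a measure \<times> ('g \<Rightarrow> 'a \<Rightarrow> 'a)) set" where
  "ergodic_actions G = {(M, T) \<in> pmp_actions G. ergodic_system G M T}"

definition joinings :: "('g, 'k) monoid_scheme \<Rightarrow> 'a measure \<Rightarrow> ('g \<Rightarrow> 'a \<Rightarrow> 'a)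
    \<Rightarrow> 'b measure \<Rightarrow> ('g \<Rightarrow> 'b \<Rightarrow> 'b) \<Rightarrow> ('a \<times> 'b) measure set" where
  "joinings G M T N S =
     {J. prob_space J \<and> sets J = sets (M \<Otimes>\<^sub>M N) \<and> distr J M fst = M \<and> distr J N snd = N \<and>
        (\<forall>g\<in>carrier G. distr J J (map_prod (T g) (S g)) = J)}"

definition disjoint_systems :: "('g, 'k) monoid_scheme \<Rightarrow> 'a measure \<Rightarrow> ('g \<Rightarrow> 'a \<Rightarrow> 'a)
    \<Rightarrow> 'b measure \<Rightarrow> ('g \<Rightarrow> 'b \<Rightarrow> 'b) \<Rightarrow> bool" where
  "disjoint_systems G M T N S \<longleftrightarrow> joinings G M T N S = {M \<Otimes>\<^sub>M N}"

text \<open>\<open>C\<close> is the space of ergodic components and \<open>\<kappa> c\<close> the invariant measure of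
  the component \<open>c\<close>; the equation \<open>M = C \<bind> \<kappa>\<close> is the integral formula for the
  invariant measure \<open>M\<close>. The factor map \<open>\<pi>\<close> sends a point to the component it lies
  in. It makes different points of \<open>C\<close> stand for different components; that
  \<open>\<pi>\<close> maps \<open>M\<close> to \<open>C\<close> and is invariant almost everywhere follows.\<close>

definition ergodic_decomposition :: "('g, 'k) monoid_scheme \<Rightarrow> 'a measure \<Rightarrow> ('g \<Rightarrow> 'a \<Rightarrow> 'a)
    \<Rightarrow> 'c measure \<Rightarrow> ('c \<Rightarrow> 'a measure) \<Rightarrow> bool" where
  "ergodic_decomposition G M T C \<kappa> \<longleftrightarrow>
     prob_space C \<and> \<kappa> \<in> C \<rightarrow>\<^sub>M prob_algebra M \<and> M = C \<bind> \<kappa> \<and>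
     (\<forall>c\<in>space C. ergodic_system G (\<kappa> c) T) \<and>
     (\<exists>\<pi>. \<pi> \<in> M \<rightarrow>\<^sub>M C \<and> (AE c in C. AE x in \<kappa> c. \<pi> x = c))"

definition disjoint_component_pairs :: "('g, 'k) monoid_scheme \<Rightarrow> ('g \<Rightarrow> 'a \<Rightarrow> 'a)
    \<Rightarrow> 'c measure \<Rightarrow> ('c \<Rightarrow> 'a measure) \<Rightarrow> ('c \<times> 'c) set" where
  "disjoint_component_pairs G T C \<kappa> =
     {(c, d) \<in> space C \<times> space C. disjoint_systems G (\<kappa> c) T (\<kappa> d) T}"

end

theory Submission
  imports Defs
begin

text \<open>
Write \<open>C\<close> for the space of ergodic components.

If \<open>M\<close> is disjoint from every ergodic system, take a component \<open>d\<close>. Were a positive measure of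
components \<open>c\<close> not disjoint from \<open>d\<close>, one could integrate nontrivial joinings of \<open>\<kappa> c\<close> and \<open>\<kappa> d\<close>
over \<open>c\<close> and obtain a nontrivial joining of \<open>M\<close> with \<open>\<kappa> d\<close>. To stay inside nonatomic systems, \<open>\<kappa> d\<close> is
replaced by its product with a Bernoulli shift, which is again ergodic because the shift is mixing.
Fubini's theorem then applies, because disjointness of a pair of components is a measurable condition.
Both the measurability and the integration of joinings rest on compactness of the set of joinings,
so that no measurable selection theorem is needed.

Conversely, let \<open>J\<close> be a joining of \<open>M\<close> with an ergodic \<open>Y\<close>. By ergodicity, the component of \<open>x\<close> is
independent of \<open>y\<close> under \<open>J\<close>, so \<open>J\<close> disintegrates over \<open>C \<Otimes> Y\<close> into measures \<open>K (c, y)\<close> on \<open>M\<close>.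
Gluing over \<open>Y\<close> gives joinings \<open>\<integral> K (c, y) \<Otimes> K (d, y) dy\<close> of \<open>\<kappa> c\<close> and \<open>\<kappa> d\<close>, which are
products for almost all \<open>(c, d)\<close>. Hence \<open>p y = \<integral> K (c, y) A dc\<close> has variance zero for every \<open>A\<close>,
which says that \<open>J\<close> is the product measure.
\<close>

section \<open>Cantor codes and convergence of bit probabilities\<close>

text \<open>Part (1) assumes an infinite group: for finite \<open>G\<close> its hypothesis is
  vacuous, while two free orbits of a two-element group are not disjoint. That hypothesis speaks
  only of nonatomic systems, here carried by \<open>real\<close>, but a component may be purely
  atomic. The Bernoulli extension is therefore realised as an honest action on a Borel set of real
  numbers. The obstacle throughout is that \<open>M\<close> is standard only up to a null set and
  that \<open>C\<close> is an arbitrary probability space. Identities of measures on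
  \<open>M\<close> are reduced to countably many sets and to measures carried by \<open>X0\<close>;
  statements about \<open>\<pi>\<close> are tested on one measurable set of components at a time;
  the set of disjoint pairs is treated in the completion of the product. The variance enters because
  a condition on almost all pairs of components says nothing about a single \<open>K (c, y)\<close>.
  The square of \<open>p y\<close>, however, is an integral over pairs, so its mean is determined by
  such a condition.\<close>

definition clamp_digit :: "real \<Rightarrow> real" where
  "clamp_digit t = max 0 (min 1 (3 * t - 1))"

text \<open>On codes this is the ternary shift; away from the Cantor set it is merely a continuous
  extension, so that all digits become continuous functions on the line.\<close>

definition cantor_shift :: "real \<Rightarrow> real" where
  "cantor_shift t = 3 * t - 2 * clamp_digit t"

definition cantor_digit :: "nat \<Rightarrow> real \<Rightarrow> real" where
  "cantor_digit n t = clamp_digit ((cantor_shift ^^ n) t)"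

definition cantor_code :: "(nat \<Rightarrow> bool) \<Rightarrow> real" where
  "cantor_code z = (\<Sum>n. 2 * of_bool (z n) / 3 ^ Suc n)"

lemma summable_cantor_code: "summable (\<lambda>n. 2 * of_bool (z n) / 3 ^ Suc n :: real)"
proof (rule summable_comparison_test')
  have "summable (\<lambda>n. (2/3) * (1/3::real) ^ n)"
    by (intro summable_mult summable_geometric) simp
  then show "summable (\<lambda>n. 2 / 3 ^ Suc n :: real)"
    by (simp add: field_simps)
qed auto

lemma cantor_code_Suc:
  "cantor_code z = (2 * of_bool (z 0) + cantor_code (\<lambda>n. z (Suc n))) / 3"
proof -
  have "cantor_code z = 2 * of_bool (z 0) / 3 + (\<Sum>n. 2 * of_bool (z (Suc n)) / 3 ^ Suc (Suc n))"
    unfolding cantor_code_def using suminf_split_head[OF summable_cantor_code, of z] by simp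
  also have "(\<Sum>n. 2 * of_bool (z (Suc n)) / 3 ^ Suc (Suc n) :: real) =
      (\<Sum>n. (2 * of_bool (z (Suc n)) / 3 ^ Suc n) / 3)"
    by (simp add: field_simps)
  also have "\<dots> = cantor_code (\<lambda>n. z (Suc n)) / 3"
    unfolding cantor_code_def by (rule suminf_divide[OF summable_cantor_code])
  finally show ?thesis by (simp add: add_divide_distrib)
qed

lemma cantor_code_bounds: "0 \<le> cantor_code z" "cantor_code z \<le> 1"
proof -
  show "0 \<le> cantor_code z"
    unfolding cantor_code_def by (intro suminf_nonneg summable_cantor_code) simp
  have s: "(\<lambda>n. (2/3) * (1/3::real) ^ n) sums ((2/3) * (1 / (1 - 1/3)))"
    by (intro sums_mult geometric_sums) simp
  have "cantor_code z \<le> (\<Sum>n. (2/3) * (1/3::real) ^ n)"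
    unfolding cantor_code_def
    by (intro suminf_le summable_cantor_code sums_summable[OF s]) (auto simp: field_simps)
  with s show "cantor_code z \<le> 1" by (simp add: sums_iff)
qed

text \<open>A tail of a code lies in [0, 1], so a code is at most 1/3 or at least 2/3 according to
  its first bit. Binary expansions would leave no gap in which the digit can change
  continuously.\<close>

lemma clamp_digit_cantor_code: "clamp_digit (cantor_code z) = of_bool (z 0)"
  using cantor_code_bounds[of "\<lambda>n. z (Suc n)"]
  by (subst cantor_code_Suc) (auto simp: clamp_digit_def)

lemma cantor_shift_cantor_code: "cantor_shift (cantor_code z) = cantor_code (\<lambda>n. z (Suc n))"
  unfolding cantor_shift_def clamp_digit_cantor_code
  by (subst cantor_code_Suc) (auto simp: field_simps)

lemma cantor_digit_cantor_code: "cantor_digit n (cantor_code z) = of_bool (z n)"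
proof -
  have "(cantor_shift ^^ n) (cantor_code z) = cantor_code (\<lambda>k. z (k + n))"
    by (induction n) (simp_all add: cantor_shift_cantor_code)
  then show ?thesis by (simp add: cantor_digit_def clamp_digit_cantor_code)
qed

lemma cantor_digit_bounds: "0 \<le> cantor_digit n t" "cantor_digit n t \<le> 1"
  by (auto simp: cantor_digit_def clamp_digit_def)

lemma continuous_cantor_digit: "continuous_on UNIV (cantor_digit n)"
proof -
  have 1: "continuous_on UNIV clamp_digit"
    unfolding clamp_digit_def by (intro continuous_intros)
  have 2: "continuous_on UNIV cantor_shift"
    unfolding cantor_shift_def by (intro continuous_intros 1)
  have 3: "continuous_on UNIV (cantor_shift ^^ n)" for n
  proof (induction n)
    case (Suc n)
    then show ?case
      using continuous_on_compose[OF Suc continuous_on_subset[OF 2]] by simp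
  qed (simp add: id_def)
  show ?thesis
    unfolding cantor_digit_def
    by (rule continuous_on_compose2[OF 1 3]) auto
qed

lemma measurable_cantor_digit [measurable]: "cantor_digit n \<in> borel_measurable borel"
  by (rule borel_measurable_continuous_onI[OF continuous_cantor_digit])

lemma measurable_cantor_code:
  assumes "\<And>n. Measurable.pred M (\<lambda>x. z x n)"
  shows "(\<lambda>x. cantor_code (z x)) \<in> borel_measurable M"
  unfolding cantor_code_def using assms
  by (intro borel_measurable_suminf borel_measurable_divide borel_measurable_times
      measurable_const measurable_of_bool) auto

text \<open>The bits are read off the Cantor code by continuous functions, so that Helly's
  selection theorem on the line yields convergence of all cylinder probabilities.\<close>

lemma bits_convergent_subsequence:
  fixes J :: "nat \<Rightarrow> 'x measure" and b :: "'i::countable \<Rightarrow> 'x \<Rightarrow> bool"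
  assumes J: "\<And>k. prob_space (J k)" and b: "\<And>k i. Measurable.pred (J k) (b i)"
  obtains s \<rho> and D :: "'i \<Rightarrow> real \<Rightarrow> bool" where
    "strict_mono s" "prob_space \<rho>" "sets \<rho> = sets borel" "\<And>i. Measurable.pred borel (D i)"
    "\<And>I. finite I \<Longrightarrow> (\<lambda>k. measure (J (s k)) {x \<in> space (J (s k)). \<forall>i\<in>I. b i x})
        \<longlonglongrightarrow> measure \<rho> {t. \<forall>i\<in>I. D i t}"
proof -
  define e where "e x = cantor_code (\<lambda>n. b (from_nat n) x)" for x
  define h where "h i = cantor_digit (to_nat i)" for i :: 'i
  define \<mu> where "\<mu> k = distr (J k) borel e" for k
  have e[measurable]: "e \<in> borel_measurable (J k)" for k
    unfolding e_def using b by (intro measurable_cantor_code) auto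
  have [measurable]: "h i \<in> borel_measurable borel" for i
    unfolding h_def by simp
  have he: "h i (e x) = of_bool (b i x)" for i x
    by (simp add: h_def e_def cantor_digit_cantor_code)
  have \<mu>: "real_distribution (\<mu> k)" for k
    using J unfolding \<mu>_def by (auto intro!: prob_space.prob_space_distr simp: real_distribution_def real_distribution_axioms_def)
  \<comment> \<open>All codes lie in [0, 1]; the half-open interval starts at -1 so as to contain
    0.\<close>
  have "tight \<mu>"
    unfolding tight_def
  proof (intro conjI allI impI)
    fix \<epsilon> :: real assume "\<epsilon> > 0"
    have "measure (\<mu> n) {-1<..1} = 1" for n
    proof -
      interpret J: prob_space "J n" by (rule J)
      have "measure (\<mu> n) {-1<..1} = measure (J n) (space (J n))"
        unfolding \<mu>_def by (subst measure_distr)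
          (auto simp: e_def intro!: arg_cong[where f="measure (J n)"] cantor_code_bounds less_le_trans[OF _ cantor_code_bounds(1)])
      then show ?thesis by (simp add: J.prob_space)
    qed
    then show "\<exists>a b. a < b \<and> (\<forall>n. 1 - \<epsilon> < measure (\<mu> n) {a<..b})"
      using \<open>\<epsilon> > 0\<close> by (intro exI[of _ "-1"] exI[of _ 1]) simp
  qed (rule \<mu>)
  from tight_imp_convergent_subsubsequence[OF this strict_mono_id]
  obtain s \<rho> where s: "strict_mono s" and \<rho>: "real_distribution \<rho>" and w: "weak_conv_m (\<mu> \<circ> s) \<rho>"
    by (auto simp: o_def id_def)
  interpret \<rho>: real_distribution \<rho> by (rule \<rho>)
  have conv: "(\<lambda>k. integral\<^sup>L (J (s k)) (\<lambda>x. f (e x))) \<longlonglongrightarrow> integral\<^sup>L \<rho> f"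
    if f: "continuous_on UNIV f" and B: "\<And>x. \<bar>f x\<bar> \<le> B" for f :: "real \<Rightarrow> real" and B
  proof -
    have [measurable]: "f \<in> borel_measurable borel" by (rule borel_measurable_continuous_onI[OF f])
    have "(\<lambda>k. integral\<^sup>L ((\<mu> \<circ> s) k) f) \<longlonglongrightarrow> integral\<^sup>L \<rho> f"
      by (rule weak_conv_imp_integral_bdd_continuous_conv[OF _ \<rho> w, of f B])
        (use \<mu> f B in \<open>auto simp: continuous_on_eq_continuous_at\<close>)
    then show ?thesis by (simp add: \<mu>_def integral_distr)
  qed
  have hc: "continuous_on UNIV (h i)" for i
    unfolding h_def by (rule continuous_cantor_digit)
  have hb: "0 \<le> h i t" "h i t \<le> 1" for i t
    unfolding h_def by (rule cantor_digit_bounds)+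
  \<comment> \<open>The limit \<open>\<rho>\<close> might charge points that are not codes. The
    product of \<open>h i\<close> and \<open>1 - h i\<close> vanishes on codes and its integral
    passes to the limit, so the digits are still 0 or 1 for \<open>\<rho>\<close>-almost every
    point.\<close>
  have h01: "AE t in \<rho>. h i t * (1 - h i t) = 0" for i
  proof -
    let ?f = "\<lambda>t. h i t * (1 - h i t)"
    have f: "0 \<le> ?f t" "?f t \<le> 1" for t
      using hb[of i t] by (auto intro: mult_le_one)
    have "(\<lambda>k. integral\<^sup>L (J (s k)) (\<lambda>x. ?f (e x))) \<longlonglongrightarrow> integral\<^sup>L \<rho> ?f"
      by (rule conv[of _ 1]) (use f in \<open>auto intro!: continuous_intros hc\<close>)
    moreover have "?f (e x) = 0" for x
      by (simp add: he)
    ultimately have "integral\<^sup>L \<rho> ?f = 0"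
      by (simp add: LIMSEQ_const_iff)
    moreover have "integrable \<rho> ?f"
      by (rule \<rho>.integrable_const_bound[of _ 1]) (use f in \<open>auto simp: abs_of_nonneg\<close>)
    ultimately show ?thesis
      using f by (subst (asm) integral_nonneg_eq_0_iff_AE) auto
  qed
  \<comment> \<open>The product of the digits over \<open>I\<close> is continuous and coincides with
    the indicator of the cylinder, everywhere on codes and almost everywhere for
    \<open>\<rho>\<close>.\<close>
  have lim: "(\<lambda>k. measure (J (s k)) {x \<in> space (J (s k)). \<forall>i\<in>I. b i x})
      \<longlonglongrightarrow> measure \<rho> {t. \<forall>i\<in>I. h i t = 1}" if I: "finite I" for I
  proof -
    let ?f = "\<lambda>t. \<Prod>i\<in>I. h i t"
    have f: "0 \<le> ?f t" "?f t \<le> 1" for t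
      using hb by (auto intro!: prod_nonneg prod_le_1)
    have "(\<lambda>k. integral\<^sup>L (J (s k)) (\<lambda>x. ?f (e x))) \<longlonglongrightarrow> integral\<^sup>L \<rho> ?f"
      by (rule conv[of _ 1]) (use f in \<open>auto intro!: continuous_intros hc\<close>)
    moreover have "integral\<^sup>L (J (s k)) (\<lambda>x. ?f (e x)) = measure (J (s k)) {x \<in> space (J (s k)). \<forall>i\<in>I. b i x}" for k
    proof -
      interpret J: prob_space "J (s k)" by (rule J)
      have [measurable]: "Measurable.pred (J (s k)) (b i)" for i by (rule b)
      have "(\<integral>x. ?f (e x) \<partial>J (s k)) = (\<integral>x. indicator {x \<in> space (J (s k)). \<forall>i\<in>I. b i x} x \<partial>J (s k))"
        using I by (intro Bochner_Integration.integral_cong)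
          (auto simp: he indicator_def of_bool_def intro: prod.neutral)
      also have "\<dots> = measure (J (s k)) {x \<in> space (J (s k)). \<forall>i\<in>I. b i x}"
        using I by (subst Bochner_Integration.integral_indicator) (auto intro!: arg_cong[where f="measure _"])
      finally show ?thesis .
    qed
    moreover have "integral\<^sup>L \<rho> ?f = measure \<rho> {t. \<forall>i\<in>I. h i t = 1}"
    proof -
      have ae: "AE t in \<rho>. \<forall>i\<in>I. h i t * (1 - h i t) = 0"
        using h01 I by (intro AE_finite_allI) auto
      have [measurable]: "{t. \<forall>i\<in>I. h i t = 1} \<in> sets borel"
        using I by measurable
      have "integral\<^sup>L \<rho> ?f = (\<integral>t. indicator {t. \<forall>i\<in>I. h i t = 1} t \<partial>\<rho>)"
      proof (rule integral_cong_AE)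
        show "AE t in \<rho>. ?f t = indicator {t. \<forall>i\<in>I. h i t = 1} t"
          using ae by eventually_elim (use I in \<open>auto simp: indicator_def intro: prod.neutral\<close>)
      qed (use I in auto)
      then show ?thesis by simp
    qed
    ultimately show ?thesis by simp
  qed
  show thesis
  proof (rule that[OF s \<rho>.prob_space_axioms \<rho>.events_eq_borel])
    show "Measurable.pred borel (\<lambda>t. h i t = 1)" for i by measurable
  qed (rule lim)
qed

section \<open>Disintegration\<close>

text \<open>Test on the set where \<open>H < F\<close>; finiteness of the integral of
  \<open>F\<close> makes the subtraction of the two integrals legitimate in
  \<open>ennreal\<close>.\<close>

lemma AE_le_if_integral_le:
  assumes F[measurable]: "F \<in> borel_measurable W" and H[measurable]: "H \<in> borel_measurable W"
    and fin: "(\<integral>\<^sup>+w. F w \<partial>W) < (\<infinity>::ennreal)"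
    and le: "\<And>A. A \<in> sets W \<Longrightarrow> (\<integral>\<^sup>+w. indicator A w * F w \<partial>W) \<le> (\<integral>\<^sup>+w. indicator A w * H w \<partial>W)"
  shows "AE w in W. F w \<le> H w"
proof -
  let ?A = "{w \<in> space W. H w < F w}"
  have A[measurable]: "?A \<in> sets W" by measurable
  have 1: "(\<integral>\<^sup>+w. indicator ?A w * H w \<partial>W) \<le> (\<integral>\<^sup>+w. indicator ?A w * F w \<partial>W)"
    by (intro nn_integral_mono) (auto simp: indicator_def)
  have "(\<integral>\<^sup>+w. indicator ?A w * F w \<partial>W) \<le> (\<integral>\<^sup>+w. F w \<partial>W)"
    by (intro nn_integral_mono) (auto simp: indicator_def)
  then have fin: "(\<integral>\<^sup>+w. indicator ?A w * H w \<partial>W) \<noteq> \<infinity>"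
    using 1 fin by (auto simp: top_unique)
  have "(\<integral>\<^sup>+w. indicator ?A w * F w - indicator ?A w * H w \<partial>W) = (\<integral>\<^sup>+w. indicator ?A w * F w \<partial>W) - (\<integral>\<^sup>+w. indicator ?A w * H w \<partial>W)"
    using fin by (intro nn_integral_diff) (auto simp: indicator_def)
  also have "\<dots> = 0" using le[OF A] fin by (intro diff_eq_0_ennreal) (auto simp: less_top[symmetric] top_unique)
  finally have "AE w in W. indicator ?A w * F w - indicator ?A w * H w = 0"
    by (subst (asm) nn_integral_0_iff_AE) auto
  with AE_space show ?thesis
  proof eventually_elim
    case (elim w)
    then show ?case
      by (cases "H w < F w") (auto simp: diff_eq_0_iff_ennreal not_less)
  qed
qed

text \<open>The Radon-Nikodym derivative of \<open>A \<mapsto> L (A \<times> Z)\<close> with respect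
  to \<open>W\<close>. Domination by \<open>W\<close> bounds it by 1 almost everywhere; the minimum
  with 1 turns this into a bound at every point.\<close>

lemma conditional_probability_exists:
  assumes W: "prob_space W" and sets[measurable_cong]: "sets L = sets (W \<Otimes>\<^sub>M N)" and L: "prob_space L"
    and fst: "distr L W fst = W" and Z[measurable]: "Z \<in> sets N"
  obtains F where "F \<in> borel_measurable W" "\<And>w. F w \<le> (1::ennreal)"
    "\<And>A. A \<in> sets W \<Longrightarrow> emeasure L (A \<times> Z) = (\<integral>\<^sup>+w. indicator A w * F w \<partial>W)"
proof -
  interpret W: prob_space W by (rule W)
  interpret L: prob_space L by (rule L)
  have spL: "space L = space W \<times> space N"
    using sets_eq_imp_space_eq[OF sets] by (simp add: space_pair_measure)
  define \<nu> where "\<nu> = distr (density L (indicator (space W \<times> Z))) W fst"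
  have \<nu>: "emeasure \<nu> A = emeasure L (A \<times> Z)" if [measurable]: "A \<in> sets W" for A
  proof -
    have "emeasure \<nu> A = (\<integral>\<^sup>+p. indicator (space W \<times> Z) p * indicator (fst -` A \<inter> space L) p \<partial>L)"
      unfolding \<nu>_def by (subst emeasure_distr; simp) (subst emeasure_density; simp)
    also have "\<dots> = (\<integral>\<^sup>+p. indicator (A \<times> Z) p \<partial>L)"
      using sets.sets_into_space[OF that] sets.sets_into_space[OF Z]
      by (intro nn_integral_cong) (auto simp: indicator_def spL)
    finally show ?thesis by simp
  qed
  have le: "emeasure \<nu> A \<le> emeasure W A" if [measurable]: "A \<in> sets W" for A
  proof -
    have "emeasure L (A \<times> Z) \<le> emeasure L (fst -` A \<inter> space L)"
      using sets.sets_into_space[OF that] sets.sets_into_space[OF Z]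
      by (intro emeasure_mono) (auto simp: spL)
    also have "\<dots> = emeasure (distr L W fst) A" by (simp add: emeasure_distr)
    finally show ?thesis by (simp add: fst \<nu>)
  qed
  have [simp]: "sets \<nu> = sets W" by (simp add: \<nu>_def)
  have "absolutely_continuous W \<nu>"
    unfolding absolutely_continuous_def null_sets_def using le by (auto simp: null_sets_def) (metis le le_zero_eq)
  then have d: "density W (RN_deriv W \<nu>) = \<nu>"
    by (rule W.density_RN_deriv) simp
  have ae: "AE w in W. RN_deriv W \<nu> w \<le> 1"
  proof (rule AE_le_if_integral_le)
    have "(\<integral>\<^sup>+w. RN_deriv W \<nu> w \<partial>W) = emeasure (density W (RN_deriv W \<nu>)) (space W)"
      by (simp add: emeasure_density cong: nn_integral_cong)
    also have "\<dots> \<le> 1"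
      using le[of "space W"] by (simp add: d W.emeasure_space_1)
    finally show "(\<integral>\<^sup>+w. RN_deriv W \<nu> w \<partial>W) < \<infinity>"
      by (rule le_less_trans) simp
    show "(\<integral>\<^sup>+w. indicator A w * RN_deriv W \<nu> w \<partial>W) \<le> (\<integral>\<^sup>+w. indicator A w * 1 \<partial>W)"
      if [measurable]: "A \<in> sets W" for A
    proof -
      have "(\<integral>\<^sup>+w. indicator A w * RN_deriv W \<nu> w \<partial>W) = emeasure (density W (RN_deriv W \<nu>)) A"
        by (simp add: emeasure_density mult.commute)
      then show ?thesis using le[OF that] by (simp add: d)
    qed
  qed simp_all
  show thesis
  proof
    show "(\<lambda>w. min 1 (RN_deriv W \<nu> w)) \<in> borel_measurable W" by measurable
    show "min 1 (RN_deriv W \<nu> w) \<le> 1" for w by simp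
    fix A assume A[measurable]: "A \<in> sets W"
    have "emeasure L (A \<times> Z) = emeasure (density W (RN_deriv W \<nu>)) A" by (simp add: d \<nu>)
    also have "\<dots> = (\<integral>\<^sup>+w. indicator A w * min 1 (RN_deriv W \<nu> w) \<partial>W)"
      using ae by (subst emeasure_density) (auto intro!: nn_integral_cong_AE simp: mult.commute min_def elim!: eventually_mono)
    finally show "emeasure L (A \<times> Z) = (\<integral>\<^sup>+w. indicator A w * min 1 (RN_deriv W \<nu> w) \<partial>W)" .
  qed
qed

lemma sets_unit_lebesgue: "sets unit_lebesgue = sets (restrict_space borel {0..1})"
  unfolding unit_lebesgue_def by (intro sets_restrict_space_cong) simp

lemma space_unit_lebesgue: "space unit_lebesgue = {0..1}"
  by (simp add: unit_lebesgue_def space_restrict_space)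

lemma prob_space_unit_lebesgue: "prob_space unit_lebesgue"
  by (rule prob_spaceI) (simp add: unit_lebesgue_def space_restrict_space emeasure_restrict_space)

lemma emeasure_unit_lebesgue_less: 
  assumes "a \<le> (1::ennreal)"
  shows "emeasure unit_lebesgue {u\<in>space unit_lebesgue. ennreal u \<le> a} = a"
proof -
  obtain r where r: "a = ennreal r" "0 \<le> r" "r \<le> 1"
    using assms by (cases a) (auto simp: top_unique)
  have "{u\<in>space unit_lebesgue. ennreal u \<le> a} = {0..r}"
    using r by (auto simp: space_unit_lebesgue)
  then show ?thesis
    using r by (simp add: unit_lebesgue_def emeasure_restrict_space)
qed

text \<open>The kernel is the law of the conditional quantile function \<open>Q w u\<close> at a uniform \<open>u\<close>, so its
  measurability in \<open>w\<close> is that of \<open>Q\<close>.\<close>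
lemma disintegration_unit_interval:
  fixes L :: "('w \<times> real) measure"
  assumes W: "prob_space W" and sets[measurable_cong]: "sets L = sets (W \<Otimes>\<^sub>M borel)" and L: "prob_space L"
    and fst: "distr L W fst = W" and unit: "AE p in L. snd p \<in> {0..1}"
  obtains K where "K \<in> W \<rightarrow>\<^sub>M prob_algebra borel"
    "\<And>A B. A \<in> sets W \<Longrightarrow> B \<in> sets borel \<Longrightarrow>
      emeasure L (A \<times> B) = (\<integral>\<^sup>+w. indicator A w * emeasure (K w) B \<partial>W)"
proof -
  interpret W: prob_space W by (rule W)
  interpret L: prob_space L by (rule L)
  have spL: "space L = space W \<times> UNIV"
    using sets_eq_imp_space_eq[OF sets] by (simp add: space_pair_measure)
  \<comment> \<open>\<open>F q w\<close> plays the role of the probability that the second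
    coordinate exceeds \<open>q\<close>, given \<open>w\<close>; each \<open>q\<close> gets its own
    version.\<close>
  have "\<exists>F. F \<in> borel_measurable W \<and> (\<forall>w. F w \<le> (1::ennreal)) \<and>
    (\<forall>A\<in>sets W. emeasure L (A \<times> {q<..}) = (\<integral>\<^sup>+w. indicator A w * F w \<partial>W))" for q :: real
    by (rule conditional_probability_exists[OF W sets L fst, of "{q<..}"]) auto
  then obtain F where F[measurable]: "\<And>q. F q \<in> borel_measurable W" and F1: "\<And>q w. F q w \<le> 1"
    and FL: "\<And>q A. A \<in> sets W \<Longrightarrow> emeasure L (A \<times> {q<..}) = (\<integral>\<^sup>+w. indicator A w * F q w \<partial>W)"
    by metis
  define I where "I = \<rat> \<inter> {0..1::real}"
  have I[simp]: "countable I" unfolding I_def using countable_rat by blast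
  have I0: "0 \<in> I" "I \<noteq> {}" by (auto simp: I_def)
  \<comment> \<open>The value 0 for a failing level keeps the supremum over \<open>I\<close>
    nonnegative, and it never exceeds a threshold \<open>t \<ge> 0\<close>.\<close>
  define g where "g w u q = (if ennreal u \<le> F q w then q else 0)" for w u q
  have g: "0 \<le> g w u q" "g w u q \<le> 1" if "q \<in> I" for w u q
    using that by (auto simp: g_def I_def)
  define Q where "Q w u = (SUP q\<in>I. g w u q)" for w u
  have bdd: "bdd_above (g w u ` I)" for w u
    using g by (intro bdd_aboveI[of _ 1]) auto
  have [measurable]: "(\<lambda>p. g (fst p) (snd p) q) \<in> borel_measurable (W \<Otimes>\<^sub>M borel)" for q
    unfolding g_def by measurable
  have Q[measurable]: "(\<lambda>(w, u). Q w u) \<in> borel_measurable (W \<Otimes>\<^sub>M borel)"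
    unfolding Q_def split_beta' by (intro borel_measurable_cSUP) (auto simp: bdd)
  have Q01: "0 \<le> Q w u" "Q w u \<le> 1" for w u
  proof -
    have "0 \<le> g w u 0" by (simp add: g_def)
    also have "\<dots> \<le> Q w u" unfolding Q_def by (rule cSUP_upper[OF I0(1) bdd])
    finally show "0 \<le> Q w u" .
    show "Q w u \<le> 1" unfolding Q_def using I0 g by (intro cSUP_least) auto
  qed
  have Qless: "t < Q w u \<longleftrightarrow> (\<exists>q\<in>I. t < q \<and> ennreal u \<le> F q w)" if "0 \<le> t" for t w u
    unfolding Q_def using that I0 bdd by (subst less_cSUP_iff) (auto simp: g_def split: if_splits)
  define K where "K w = distr unit_lebesgue borel (Q w)" for w
  have unit_meas: "(\<lambda>u. u) \<in> unit_lebesgue \<rightarrow>\<^sub>M borel"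
    by (simp add: measurable_restrict_space1 cong: measurable_cong_sets[OF sets_unit_lebesgue refl])
  have Q'[measurable]: "(\<lambda>(w, u). Q w u) \<in> borel_measurable (W \<Otimes>\<^sub>M unit_lebesgue)"
    using measurable_compose[OF measurable_Pair[OF measurable_fst measurable_compose[OF measurable_snd unit_meas]] Q]
    by (simp add: split_beta')
  have Qw[measurable]: "Q w \<in> borel_measurable unit_lebesgue" if "w \<in> space W" for w
    using measurable_compose[OF measurable_Pair1'[OF that] Q'] by simp
  have K: "K \<in> W \<rightarrow>\<^sub>M prob_algebra borel"
    unfolding K_def
    by (rule measurable_distr_prob_space2[OF _ Q'])
       (simp add: space_prob_algebra prob_space_unit_lebesgue measurable_const)
  have ray: "emeasure L (A \<times> {t<..}) = (\<integral>\<^sup>+w. indicator A w * emeasure (K w) {t<..} \<partial>W)"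
    if A[measurable]: "A \<in> sets W" for A t
  proof -
    have Asp: "A \<subseteq> space W" by (rule sets.sets_into_space[OF A])
    \<comment> \<open>Outside [0, 1) a ray has full or zero mass on both sides, because
      \<open>Q\<close> and almost surely the second coordinate of \<open>L\<close> have values in
      the unit interval.\<close>
    consider "t < 0" | "1 \<le> t" | "0 \<le> t" "t < 1" by linarith
    then show ?thesis
    proof cases
      case 1
      have "emeasure L (A \<times> {t<..}) = emeasure L (fst -` A \<inter> space L)"
        using assms(5) 1 Asp by (intro emeasure_eq_AE) (auto simp: spL elim!: eventually_mono)
      also have "\<dots> = emeasure (distr L W fst) A" by (simp add: emeasure_distr)
      also have "\<dots> = (\<integral>\<^sup>+w. indicator A w \<partial>W)" by (simp add: fst)
      also have "\<dots> = (\<integral>\<^sup>+w. indicator A w * emeasure (K w) {t<..} \<partial>W)"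
      proof (intro nn_integral_cong)
        fix w assume w: "w \<in> space W"
        have "Q w -` {t<..} \<inter> space unit_lebesgue = space unit_lebesgue"
          using 1 Q01(1)[of w] by (auto intro: less_le_trans)
        then have "emeasure (K w) {t<..} = 1"
          using w by (simp add: K_def emeasure_distr prob_space.emeasure_space_1[OF prob_space_unit_lebesgue])
        then show "indicator A w = indicator A w * emeasure (K w) {t<..}" by simp
      qed
      finally show ?thesis .
    next
      case 2
      have "emeasure L (A \<times> {t<..}) = emeasure L {}"
      proof (rule emeasure_eq_AE)
        show "AE p in L. p \<in> A \<times> {t<..} \<longleftrightarrow> p \<in> {}"
          using assms(5) by eventually_elim (use 2 in auto)
      qed auto
      also have "\<dots> = (\<integral>\<^sup>+w. 0 \<partial>W)" by simp
      also have "\<dots> = (\<integral>\<^sup>+w. indicator A w * emeasure (K w) {t<..} \<partial>W)"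
      proof (intro nn_integral_cong)
        fix w assume w: "w \<in> space W"
        have "Q w -` {t<..} \<inter> space unit_lebesgue = {}"
          using 2 order_trans[OF Q01(2)[of w] 2] by (auto simp: not_le[symmetric])
        then show "0 = indicator A w * emeasure (K w) {t<..}"
          using w by (simp add: K_def emeasure_distr)
      qed
      finally show ?thesis .
    next
      case 3
      \<comment> \<open>Only countably many versions \<open>F q\<close> can be compared outside one
        null set, so the ray at \<open>t\<close> is exhausted by rays at rational levels
        \<open>q n\<close> decreasing to \<open>t\<close>.\<close>
      obtain q where q: "\<And>n. q n \<in> I" "\<And>n. t < q n" "decseq q" "q \<longlonglongrightarrow> t"
      proof -
        have step: "\<exists>r\<in>I. t < r \<and> r < y" if y: "t < y" for y
        proof -
          obtain r where "r \<in> \<rat>" "t < r" "r < min 1 y"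
            using Rats_dense_in_real[of t "min 1 y"] y 3 by auto
          with 3 show ?thesis by (intro bexI[of _ r]) (auto simp: I_def)
        qed
        have "\<exists>q. \<forall>n. (q n \<in> I \<and> t < q n) \<and> (q (Suc n) < q n \<and> q (Suc n) < t + 1 / real (Suc n))"
        proof (rule dependent_nat_choice)
          show "\<exists>x. x \<in> I \<and> t < x" using step[of 1] 3 by auto
          fix x n assume x: "x \<in> I \<and> t < x"
          show "\<exists>y. (y \<in> I \<and> t < y) \<and> y < x \<and> y < t + 1 / real (Suc n)"
            using step[of "min x (t + 1 / real (Suc n))"] x by auto
        qed
        then obtain q where q: "\<And>n. q n \<in> I" "\<And>n. t < q n" "\<And>n. q (Suc n) < q n" 
          "\<And>n. q (Suc n) < t + 1 / real (Suc n)"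
          by blast
        have "(\<lambda>n. q (Suc n)) \<longlonglongrightarrow> t"
        proof (rule tendsto_sandwich[of "\<lambda>_. t" _ _ "\<lambda>n. t + 1 / real (Suc n)"])
          show "(\<lambda>n. t + 1 / real (Suc n)) \<longlonglongrightarrow> t"
            using tendsto_add[OF tendsto_const[of t] LIMSEQ_inverse_real_of_nat] by (simp add: inverse_eq_divide)
        qed (use q in \<open>auto intro!: always_eventually less_imp_le\<close>)
        then have "q \<longlonglongrightarrow> t" by (simp add: filterlim_sequentially_Suc)
        with q show thesis by (intro that[of q]) (auto simp: decseq_Suc_iff less_imp_le)
      qed
      have Un: "(\<Union>n. {q n<..}) = {t<..}"
      proof safe
        fix x assume "t < x"
        then have "\<forall>\<^sub>F n in sequentially. q n < x" by (rule order_tendstoD(2)[OF q(4)])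
        then show "x \<in> (\<Union>n. {q n<..})" by (auto dest: eventually_happens)
      qed (use q(2) in \<open>auto intro: less_trans\<close>)
      have mono: "AE w in W. \<forall>r\<in>I. \<forall>r'\<in>I. r \<le> r' \<longrightarrow> F r' w \<le> F r w"
      proof (intro AE_ball_countable'[OF _ I])
        fix r r' :: real
        show "AE w in W. r \<le> r' \<longrightarrow> F r' w \<le> F r w"
        proof (cases "r \<le> r'")
          case True
          have "AE w in W. F r' w \<le> F r w"
          proof (rule AE_le_if_integral_le)
            show "(\<integral>\<^sup>+w. F r' w \<partial>W) < \<infinity>"
              using nn_integral_mono[of W "F r'" "\<lambda>_. 1"] F1 by (auto simp: W.emeasure_space_1 intro: le_less_trans)
            show "(\<integral>\<^sup>+w. indicator A w * F r' w \<partial>W) \<le> (\<integral>\<^sup>+w. indicator A w * F r w \<partial>W)"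
              if "A \<in> sets W" for A
              using True that by (auto simp: FL[symmetric] intro!: emeasure_mono)
          qed auto
          then show ?thesis by eventually_elim simp
        qed simp
      qed
      have "emeasure L (A \<times> {t<..}) = emeasure L (\<Union>n. A \<times> {q n<..})"
        unfolding Un[symmetric] by (rule arg_cong[where f="emeasure L"]) auto
      also have "\<dots> = (SUP n. emeasure L (A \<times> {q n<..}))"
        using q(3) by (intro SUP_emeasure_incseq[symmetric]) (auto simp: incseq_def decseq_def intro: le_less_trans)
      also have "\<dots> = (SUP n. \<integral>\<^sup>+w. indicator A w * F (q n) w \<partial>W)" by (simp add: FL)
      also have "\<dots> = (\<integral>\<^sup>+w. (SUP n. indicator A w * F (q n) w) \<partial>W)"
      proof (rule nn_integral_monotone_convergence_SUP_AE[symmetric])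
        show "AE w in W. indicator A w * F (q n) w \<le> indicator A w * F (q (Suc n)) w" for n
          using mono q(1,3) by (auto elim!: eventually_mono intro!: mult_left_mono simp: decseq_Suc_iff)
      qed simp
      also have "\<dots> = (\<integral>\<^sup>+w. indicator A w * emeasure (K w) {t<..} \<partial>W)"
      proof (rule nn_integral_cong_AE)
        show "AE w in W. (SUP n. indicator A w * F (q n) w) = indicator A w * emeasure (K w) {t<..}"
          using mono AE_space
        proof eventually_elim
          fix w assume w: "\<forall>r\<in>I. \<forall>r'\<in>I. r \<le> r' \<longrightarrow> F r' w \<le> F r w" and [measurable]: "w \<in> space W"
          have id[measurable]: "(\<lambda>u. u) \<in> borel_measurable unit_lebesgue" by (rule unit_meas)
          \<comment> \<open>Every level above \<open>t\<close> is eventually undercut by some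
            \<open>q n\<close>, where \<open>F\<close> is at least as large; so the existential over
            \<open>I\<close> in \<open>Qless\<close> may be replaced by one over the
            sequence.\<close>
          have *: "ennreal u \<le> F r w \<longrightarrow> (\<exists>n. ennreal u \<le> F (q n) w)" if r: "r \<in> I" "t < r" for r u
          proof -
            have "\<forall>\<^sub>F n in sequentially. q n < r" by (rule order_tendstoD(2)[OF q(4) r(2)])
            then obtain n where "q n < r" by (auto dest: eventually_happens)
            then have "F r w \<le> F (q n) w" using w q(1) r by auto
            then show ?thesis by (auto intro: order_trans)
          qed
          have "emeasure (K w) {t<..} = emeasure unit_lebesgue (Q w -` {t<..} \<inter> space unit_lebesgue)"
            unfolding K_def by (subst emeasure_distr) auto
          also have "Q w -` {t<..} \<inter> space unit_lebesgue = (\<Union>n. {u\<in>space unit_lebesgue. ennreal u \<le> F (q n) w})"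
            using * q(1,2) 3 by (fastforce simp: Qless)
          also have "emeasure unit_lebesgue \<dots> = (SUP n. emeasure unit_lebesgue {u\<in>space unit_lebesgue. ennreal u \<le> F (q n) w})"
            using w q(1,3) by (intro SUP_emeasure_incseq[symmetric])
              (auto simp: incseq_Suc_iff decseq_Suc_iff intro: order_trans)
          also have "\<dots> = (SUP n. F (q n) w)"
            using F1 by (simp add: emeasure_unit_lebesgue_less)
          finally show "(SUP n. indicator A w * F (q n) w) = indicator A w * emeasure (K w) {t<..}"
            by (simp add: SUP_mult_left_ennreal)
        qed
      qed
      finally show ?thesis .
    qed
  qed
  show thesis
  proof (rule that[OF K])
    fix A and B :: "real set" assume A[measurable]: "A \<in> sets W" and B[measurable]: "B \<in> sets borel"
    have Asp: "A \<subseteq> space W" by (rule sets.sets_into_space[OF A])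
    have K'[measurable]: "K \<in> W \<rightarrow>\<^sub>M subprob_algebra borel" by (rule measurable_prob_algebraD[OF K])
    \<comment> \<open>For fixed \<open>A\<close> both sides are finite Borel measures in
      \<open>B\<close>, so agreement on rays is enough.\<close>
    define \<mu> where "\<mu> = distr (density L (indicator (A \<times> UNIV))) borel snd"
    have Kd: "K \<in> density W (indicator A) \<rightarrow>\<^sub>M subprob_algebra borel" by simp
    have ne: "space W \<noteq> {}" by (rule W.not_empty)
    define \<nu> where "\<nu> = density W (indicator A) \<bind> K"
    have \<mu>: "emeasure \<mu> B = emeasure L (A \<times> B)" if [measurable]: "B \<in> sets borel" for B
    proof -
      have "emeasure \<mu> B = (\<integral>\<^sup>+p. indicator (A \<times> UNIV) p * indicator (snd -` B \<inter> space L) p \<partial>L)"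
        unfolding \<mu>_def by (subst emeasure_distr; simp) (subst emeasure_density; simp)
      also have "\<dots> = (\<integral>\<^sup>+p. indicator (A \<times> B) p \<partial>L)"
        using Asp by (intro nn_integral_cong) (auto simp: indicator_def spL)
      finally show ?thesis by simp
    qed
    have \<nu>: "emeasure \<nu> B = (\<integral>\<^sup>+w. indicator A w * emeasure (K w) B \<partial>W)" if [measurable]: "B \<in> sets borel" for B
      unfolding \<nu>_def using ne that by (subst emeasure_bind[OF _ Kd]) (auto simp: nn_integral_density)
    have "\<mu> = \<nu>"
    proof (rule measure_eqI_lessThan)
      show "sets \<nu> = sets borel"
        unfolding \<nu>_def using ne sets_kernel[OF K'] by (intro sets_bind) auto
      show "emeasure \<mu> {x<..} < \<infinity>" for x by (simp add: \<mu> L.emeasure_finite less_top[symmetric])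
    qed (auto simp: \<mu>_def[THEN arg_cong[where f=sets]] \<mu> \<nu> ray)
    with \<mu> \<nu> B show "emeasure L (A \<times> B) = (\<integral>\<^sup>+w. indicator A w * emeasure (K w) B \<partial>W)" by metis
  qed
qed

section \<open>Systems with a standard model\<close>

text \<open>A closed half-line is the intersection of those with larger rational endpoints. This
  leaves a countable family of tests for equality of laws on the line.\<close>

lemma sets_borel_rat_atMost: "sets (borel :: real measure) = sigma_sets UNIV (range (\<lambda>q::rat. {..of_rat q}))"
proof
  show "sigma_sets UNIV (range (\<lambda>q::rat. {..of_rat q})) \<subseteq> sets (borel :: real measure)"
    by (rule sets.sigma_sets_subset') auto
  interpret sigma_algebra UNIV "sigma_sets UNIV (range (\<lambda>q::rat. {..of_rat q :: real}))"
    by (rule sigma_algebra_sigma_sets) simp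
  have "{..a} \<in> sigma_sets UNIV (range (\<lambda>q::rat. {..of_rat q}))" for a :: real
  proof -
    have "{..a} = (\<Inter>q\<in>{q. a < of_rat q}. {..of_rat q})"
    proof safe
      fix x :: real assume *: "x \<in> (\<Inter>q\<in>{q::rat. a < of_rat q}. {..of_rat q})"
      show "x \<le> a"
      proof (rule ccontr)
        assume "\<not> x \<le> a"
        then obtain q where "a < of_rat q" "of_rat q < x" by (meson of_rat_dense not_le)
        with * show False by auto
      qed
    qed auto
    also have "\<dots> \<in> sigma_sets UNIV (range (\<lambda>q::rat. {..of_rat q}))"
    proof (rule countable_INT'')
      show "UNIV \<in> sigma_sets UNIV (range (\<lambda>q::rat. {..of_rat q :: real}))" by (rule top)
    qed (auto intro: sigma_sets.Basic)
    finally show ?thesis .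
  qed
  then show "sets (borel :: real measure) \<subseteq> sigma_sets UNIV (range (\<lambda>q::rat. {..of_rat q}))"
    unfolding borel_eq_atMost by (auto intro!: sigma_sets_mono simp: sets_measure_of_conv)
qed

lemma measure_eqI_rat_atMost:
  fixes \<mu> \<nu> :: "real measure"
  assumes "finite_measure \<mu>" and [simp]: "sets \<mu> = sets borel" "sets \<nu> = sets borel"
    and "emeasure \<mu> UNIV = emeasure \<nu> UNIV"
    and "\<And>q::rat. emeasure \<mu> {..of_rat q} = emeasure \<nu> {..of_rat q}"
  shows "\<mu> = \<nu>"
proof -
  interpret finite_measure \<mu> by fact
  show ?thesis
  proof (rule measure_eqI_generator_eq[where \<Omega>=UNIV and E="insert UNIV (range (\<lambda>q::rat. {..of_rat q}))" and A="\<lambda>_. UNIV"])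
    show "Int_stable (insert UNIV (range (\<lambda>q::rat. {..of_rat q :: real})))"
    proof (rule Int_stableI)
      fix a b :: "real set"
      assume "a \<in> insert UNIV (range (\<lambda>q::rat. {..of_rat q}))" "b \<in> insert UNIV (range (\<lambda>q::rat. {..of_rat q}))"
      moreover have "{..of_rat q :: real} \<inter> {..of_rat r} = {..of_rat (min q r)}" for q r
        by (auto simp: min_def of_rat_less_eq)
      ultimately show "a \<inter> b \<in> insert UNIV (range (\<lambda>q::rat. {..of_rat q}))"
        by auto
    qed
    have "sigma_sets UNIV (insert UNIV (range (\<lambda>q::rat. {..of_rat q :: real}))) = sets borel"
      unfolding sets_borel_rat_atMost
      by (intro sigma_sets_eqI) (auto intro: sigma_sets.Basic sigma_sets_top)
    then show "sets \<mu> = sigma_sets UNIV (insert UNIV (range (\<lambda>q::rat. {..of_rat q})))"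
      "sets \<nu> = sigma_sets UNIV (insert UNIV (range (\<lambda>q::rat. {..of_rat q})))" by simp_all
  qed (use assms(4,5) in auto)
qed

text \<open>The measures considered below give \<open>X0\<close> full measure; outside \<open>X0\<close> nothing is assumed about the
  sets of \<open>M\<close>, which need not be countably generated.\<close>
locale standard_model =
  fixes M :: "'a measure" and f :: "'a \<Rightarrow> real" and f' :: "real \<Rightarrow> 'a" and X0 :: "'a set"
  assumes f[measurable]: "f \<in> borel_measurable M" and f01: "\<And>x. x \<in> space M \<Longrightarrow> f x \<in> {0..1}"
    and f'[measurable]: "f' \<in> borel \<rightarrow>\<^sub>M M" and X0[measurable]: "X0 \<in> sets M"
    and f'f: "\<And>x. x \<in> X0 \<Longrightarrow> f' (f x) = x"
begin

text \<open>A measure carried by \<open>X0\<close> is the image under \<open>f'\<close> of its law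
  under \<open>f\<close>, and a law on the line is determined by rational half-lines. Having
  countably many tests is what later upgrades equality almost everywhere on each set to almost
  everywhere equality of kernels.\<close>

lemma measure_eqI_model:
  assumes \<mu>: "finite_measure \<mu>" and sets: "sets \<mu> = sets M" "sets \<nu> = sets M"
    and X0: "AE x in \<mu>. x \<in> X0" "AE x in \<nu>. x \<in> X0"
    and sp: "emeasure \<mu> (space M) = emeasure \<nu> (space M)"
    and eq: "\<And>q::rat. emeasure \<mu> {x\<in>space M. f x \<le> of_rat q} = emeasure \<nu> {x\<in>space M. f x \<le> of_rat q}"
  shows "\<mu> = \<nu>"
proof -
  have [simp]: "space \<mu> = space M" "space \<nu> = space M" using sets by (auto dest: sets_eq_imp_space_eq)
  note [measurable_cong] = sets
  have recover: "distr (distr \<xi> borel f) M f' = \<xi>" if "sets \<xi> = sets M" "AE x in \<xi>. x \<in> X0" for \<xi>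
  proof -
    note [measurable_cong] = that(1)
    have "distr (distr \<xi> borel f) M f' = distr \<xi> M (\<lambda>x. f' (f x))"
      by (subst distr_distr) (auto simp: comp_def)
    also have "\<dots> = distr \<xi> M (\<lambda>x. x)"
      using that(2) by (intro distr_cong_AE) (auto elim!: eventually_mono simp: f'f)
    finally show ?thesis using that(1) by (simp add: distr_id2)
  qed
  have "distr \<mu> borel f = distr \<nu> borel f"
  proof (rule measure_eqI_rat_atMost)
    show "finite_measure (distr \<mu> borel f)" by (rule finite_measure.finite_measure_distr[OF \<mu>]) simp
    show "emeasure (distr \<mu> borel f) {..of_rat q} = emeasure (distr \<nu> borel f) {..of_rat q}" for q
    proof -
      have "f -` {..of_rat q} \<inter> space M = {x\<in>space M. f x \<le> of_rat q}" by auto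
      with eq[of q] show ?thesis by (simp add: emeasure_distr)
    qed
    show "emeasure (distr \<mu> borel f) UNIV = emeasure (distr \<nu> borel f) UNIV"
      using sp by (simp add: emeasure_distr)
  qed simp_all
  then show ?thesis
    using recover[OF sets(1) X0(1)] recover[OF sets(2) X0(2)] by metis
qed

text \<open>The second coordinate is moved to the unit interval by \<open>f\<close>, disintegrated
  there, and the kernel is pushed back by \<open>f'\<close>; as \<open>L\<close> is carried by
  \<open>X0\<close> in that coordinate, nothing is lost on the way.\<close>

lemma disintegration:
  assumes W: "prob_space W" and sets[measurable_cong]: "sets L = sets (W \<Otimes>\<^sub>M M)" and L: "prob_space L"
    and fst: "distr L W fst = W" and X0': "AE p in L. snd p \<in> X0"
  obtains K where "K \<in> W \<rightarrow>\<^sub>M prob_algebra M"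
    "\<And>A B. A \<in> sets W \<Longrightarrow> B \<in> sets M \<Longrightarrow>
      emeasure L (A \<times> B) = (\<integral>\<^sup>+w. indicator A w * emeasure (K w) B \<partial>W)"
proof -
  interpret L: prob_space L by (rule L)
  have spL: "space L = space W \<times> space M"
    using sets_eq_imp_space_eq[OF sets] by (simp add: space_pair_measure)
  define h where "h p = (fst p, f (snd p))" for p :: "'b \<times> 'a"
  have h[measurable]: "h \<in> L \<rightarrow>\<^sub>M W \<Otimes>\<^sub>M borel" unfolding h_def by measurable
  have 1: "distr (distr L (W \<Otimes>\<^sub>M borel) h) W fst = W"
    using fst by (subst distr_distr) (auto simp: comp_def h_def)
  have 2: "AE p in distr L (W \<Otimes>\<^sub>M borel) h. snd p \<in> {0..1}"
    using f01 by (subst AE_distr_iff) (auto simp: h_def spL intro!: AE_I2)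
  obtain K where K[measurable]: "K \<in> W \<rightarrow>\<^sub>M prob_algebra borel"
    and KL: "\<And>A B. A \<in> sets W \<Longrightarrow> B \<in> sets borel \<Longrightarrow>
      emeasure (distr L (W \<Otimes>\<^sub>M borel) h) (A \<times> B) = (\<integral>\<^sup>+w. indicator A w * emeasure (K w) B \<partial>W)"
    by (rule disintegration_unit_interval[OF W sets_distr L.prob_space_distr[OF h] 1 2]) blast
  show thesis
  proof (rule that[of "\<lambda>w. distr (K w) M f'"])
    show "(\<lambda>w. distr (K w) M f') \<in> W \<rightarrow>\<^sub>M prob_algebra M"
      by (rule measurable_compose[OF K measurable_distr_prob_space[OF f']])
    fix A B assume A[measurable]: "A \<in> sets W" and B[measurable]: "B \<in> sets M"
    have B': "f' -` B \<in> sets borel" using measurable_sets[OF f' B] by simp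
    have "emeasure L (A \<times> B) = emeasure L (h -` (A \<times> f' -` B) \<inter> space L)"
    proof (rule emeasure_eq_AE)
      show "AE p in L. p \<in> A \<times> B \<longleftrightarrow> p \<in> h -` (A \<times> f' -` B) \<inter> space L"
        using X0' AE_space by eventually_elim (auto simp: h_def f'f)
      have "A \<times> f' -` B \<in> sets (W \<Otimes>\<^sub>M borel)" using B' by simp
      then show "h -` (A \<times> f' -` B) \<inter> space L \<in> sets L"
        by (rule measurable_sets[OF h])
    qed simp
    also have "\<dots> = emeasure (distr L (W \<Otimes>\<^sub>M borel) h) (A \<times> f' -` B)"
      using B' by (simp add: emeasure_distr)
    also have "\<dots> = (\<integral>\<^sup>+w. indicator A w * emeasure (K w) (f' -` B) \<partial>W)"
      by (rule KL[OF A B'])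
    also have "\<dots> = (\<integral>\<^sup>+w. indicator A w * emeasure (distr (K w) M f') B \<partial>W)"
    proof (rule nn_integral_cong)
      fix w assume "w \<in> space W"
      then have Kw: "sets (K w) = sets borel"
        using measurable_space[OF K] by (auto simp: space_prob_algebra)
      have "f' \<in> K w \<rightarrow>\<^sub>M M" "space (K w) = UNIV"
        using measurable_cong_sets[OF Kw refl[of "sets M"]] sets_eq_imp_space_eq[OF Kw] by (simp_all add: f')
      then show "indicator A w * emeasure (K w) (f' -` B) = indicator A w * emeasure (distr (K w) M f') B"
        using B by (simp add: emeasure_distr)
    qed
    finally show "emeasure L (A \<times> B) = (\<integral>\<^sup>+w. indicator A w * emeasure (distr (K w) M f') B \<partial>W)" .
  qed
qed

text \<open>Uniqueness of disintegrations. Each test set costs one null set, and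
  \<open>measure_eqI_model\<close> asks for countably many test sets.\<close>

lemma kernel_eq_AE:
  assumes W: "prob_space W" and K1[measurable]: "K1 \<in> W \<rightarrow>\<^sub>M prob_algebra M" and K2[measurable]: "K2 \<in> W \<rightarrow>\<^sub>M prob_algebra M"
    and X0: "AE w in W. AE x in K1 w. x \<in> X0" "AE w in W. AE x in K2 w. x \<in> X0"
    and eq: "\<And>A B. A \<in> sets W \<Longrightarrow> B \<in> sets M \<Longrightarrow>
      (\<integral>\<^sup>+w. indicator A w * emeasure (K1 w) B \<partial>W) = (\<integral>\<^sup>+w. indicator A w * emeasure (K2 w) B \<partial>W)"
  shows "AE w in W. K1 w = K2 w"
proof -
  interpret W: prob_space W by (rule W)
  have [measurable]: "K1 \<in> W \<rightarrow>\<^sub>M subprob_algebra M" "K2 \<in> W \<rightarrow>\<^sub>M subprob_algebra M"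
    by (rule measurable_prob_algebraD; fact)+
  have sp: "space (K w) = space M" "sets (K w) = sets M" "prob_space (K w)" "emeasure (K w) B \<le> 1"
    if "w \<in> space W" "K \<in> W \<rightarrow>\<^sub>M prob_algebra M" for w K B
    using measurable_space[OF that(2,1)]
    by (auto simp: space_prob_algebra prob_space_imp_subprob_space intro: subprob_space.subprob_emeasure_le_1 dest: sets_eq_imp_space_eq)
  have fin: "(\<integral>\<^sup>+w. emeasure (K w) B \<partial>W) < \<infinity>" if "K \<in> W \<rightarrow>\<^sub>M prob_algebra M" for K B
  proof -
    have "(\<integral>\<^sup>+w. emeasure (K w) B \<partial>W) \<le> (\<integral>\<^sup>+w. 1 \<partial>W)"
      using sp(4) that by (intro nn_integral_mono) auto
    then show ?thesis by (auto simp: W.emeasure_space_1 intro: le_less_trans)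
  qed
  have "AE w in W. emeasure (K1 w) B = emeasure (K2 w) B" if [measurable]: "B \<in> sets M" for B
  proof -
    have "AE w in W. emeasure (K1 w) B \<le> emeasure (K2 w) B" "AE w in W. emeasure (K2 w) B \<le> emeasure (K1 w) B"
      by (rule AE_le_if_integral_le; (simp add: fin[OF K1, simplified] fin[OF K2, simplified] eq)?)+
    then show ?thesis by eventually_elim (rule antisym)
  qed
  then have "AE w in W. \<forall>q::rat. emeasure (K1 w) {x\<in>space M. f x \<le> of_rat q} = emeasure (K2 w) {x\<in>space M. f x \<le> of_rat q}"
    by (subst AE_all_countable) auto
  with X0 AE_space show ?thesis
  proof eventually_elim
    case (elim w)
    note s1 = sp[OF elim(3) K1] and s2 = sp[OF elim(3) K2]
    have e: "emeasure (K1 w) (space M) = 1" "emeasure (K2 w) (space M) = 1"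
      using prob_space.emeasure_space_1[OF s1(3)] prob_space.emeasure_space_1[OF s2(3)] s1(1) s2(1) by auto
    show ?case
      using elim s1 s2 e by (intro measure_eqI_model) (auto intro: prob_space.finite_measure)
  qed
qed

end

lemma standard_model_exists:
  assumes "isomorphic_mod0 M unit_lebesgue"
  obtains f f' X0 where "standard_model M f f' X0" "AE x in M. x \<in> X0"
proof -
  obtain f f' where f: "f \<in> M \<rightarrow>\<^sub>M unit_lebesgue" and f': "f' \<in> unit_lebesgue \<rightarrow>\<^sub>M M"
    and ff: "AE x in M. f' (f x) = x"
    using assms unfolding isomorphic_mod0_def by (elim exE conjE) (rule that)
  \<comment> \<open>\<open>f'\<close> is only given on [0, 1]; clipping extends it to the line
    without changing it on the range of \<open>f\<close>.\<close>
  define clip where "clip t = max 0 (min 1 t)" for t :: real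
  have clip: "clip \<in> borel \<rightarrow>\<^sub>M unit_lebesgue"
    unfolding clip_def measurable_cong_sets[OF refl sets_unit_lebesgue]
    by (rule measurable_restrict_space2) (auto simp: le_max_iff_disj)
  have id: "(\<lambda>u. u) \<in> unit_lebesgue \<rightarrow>\<^sub>M borel"
    by (simp add: measurable_restrict_space1 cong: measurable_cong_sets[OF sets_unit_lebesgue refl])
  have f01: "f x \<in> {0..1}" if "x \<in> space M" for x
    using measurable_space[OF f that] by (simp add: space_unit_lebesgue)
  \<comment> \<open>The set where \<open>f' (f x) \<noteq> x\<close> need not be measurable, hence
    the measurable null set \<open>N\<close> containing it.\<close>
  obtain N where N: "{x\<in>space M. f' (f x) \<noteq> x} \<subseteq> N" "N \<in> sets M" "emeasure M N = 0"
    using AE_E[OF ff] by (metis (mono_tags, lifting))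
  show thesis
  proof
    show "standard_model M f (f' \<circ> clip) (space M - N)"
    proof
      show "f \<in> borel_measurable M" using measurable_compose[OF f id] by simp
      show "f' \<circ> clip \<in> borel \<rightarrow>\<^sub>M M" by (rule measurable_comp[OF clip f'])
      show "space M - N \<in> sets M" using N by auto
      show "(f' \<circ> clip) (f x) = x" if "x \<in> space M - N" for x
        using that N f01[of x] by (auto simp: clip_def)
    qed (use f01 in auto)
    show "AE x in M. x \<in> space M - N"
      by (rule AE_I[of _ _ N]) (use N in auto)
  qed
qed

section \<open>Group actions, almost invariant sets and almost invariant functions\<close>

lemma pmp_systemD:
  assumes "pmp_system G M T" "group G"
  shows "prob_space M"
    and "\<And>g. g \<in> carrier G \<Longrightarrow> T g \<in> M \<rightarrow>\<^sub>M M"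
    and "\<And>g. g \<in> carrier G \<Longrightarrow> distr M M (T g) = M"
    and "\<And>g h x. \<lbrakk>g \<in> carrier G; h \<in> carrier G; x \<in> space M\<rbrakk> \<Longrightarrow> T (g \<otimes>\<^bsub>G\<^esub> h) x = T g (T h x)"
    and "\<And>x. x \<in> space M \<Longrightarrow> T \<one>\<^bsub>G\<^esub> x = x"
    and "\<And>g x. \<lbrakk>g \<in> carrier G; x \<in> space M\<rbrakk> \<Longrightarrow> T (inv\<^bsub>G\<^esub> g) (T g x) = x"
    and "\<And>g x. \<lbrakk>g \<in> carrier G; x \<in> space M\<rbrakk> \<Longrightarrow> T g (T (inv\<^bsub>G\<^esub> g) x) = x"
proof -
  interpret group G by fact
  have act: "group_action G (space M) T" using assms unfolding pmp_system_def by auto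
  show "prob_space M" "\<And>g. g \<in> carrier G \<Longrightarrow> T g \<in> M \<rightarrow>\<^sub>M M" "\<And>g. g \<in> carrier G \<Longrightarrow> distr M M (T g) = M"
    using assms unfolding pmp_system_def by auto
  show c: "\<And>g h x. \<lbrakk>g \<in> carrier G; h \<in> carrier G; x \<in> space M\<rbrakk> \<Longrightarrow> T (g \<otimes>\<^bsub>G\<^esub> h) x = T g (T h x)"
    using group_action.composition_rule[OF act] by auto
  show i: "\<And>x. x \<in> space M \<Longrightarrow> T \<one>\<^bsub>G\<^esub> x = x"
    using group_action.id_eq_one[OF act] by (metis restrict_apply)
  show "\<And>g x. \<lbrakk>g \<in> carrier G; x \<in> space M\<rbrakk> \<Longrightarrow> T (inv\<^bsub>G\<^esub> g) (T g x) = x"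
    "\<And>g x. \<lbrakk>g \<in> carrier G; x \<in> space M\<rbrakk> \<Longrightarrow> T g (T (inv\<^bsub>G\<^esub> g) x) = x"
    by (simp_all add: c[symmetric] i)
qed

text \<open>Ergodicity is defined with strictly invariant sets. The points whose whole orbit lies in
  \<open>B\<close> form such a set; it is measurable and almost equal to \<open>B\<close> because
  the group is countable.\<close>

lemma ergodic_ae_invariant_set:
  assumes erg: "ergodic_system G N S" and G: "group G" "countable (carrier G)"
    and B[measurable]: "B \<in> sets N" and inv: "\<And>g. g \<in> carrier G \<Longrightarrow> AE x in N. S g x \<in> B \<longleftrightarrow> x \<in> B"
  shows "measure N B = 0 \<or> measure N B = 1"
proof -
  interpret group G by fact
  have pmp: "pmp_system G N S" using erg by (simp add: ergodic_system_def)
  note D = pmp_systemD[OF pmp G(1)]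
  note [measurable] = D(2)
  define B' where "B' = {x\<in>space N. \<forall>g\<in>carrier G. S g x \<in> B}"
  have [measurable]: "B' \<in> sets N" unfolding B'_def using G(2) by measurable
  have "S g -` B' \<inter> space N = B'" if g: "g \<in> carrier G" for g
  proof (intro equalityI subsetI)
    fix x assume "x \<in> S g -` B' \<inter> space N"
    then have x: "x \<in> space N" and "S g x \<in> B'" by auto
    then have *: "S h (S g x) \<in> B" if "h \<in> carrier G" for h using that by (auto simp: B'_def)
    show "x \<in> B'"
      unfolding B'_def
    proof (safe intro!: x)
      fix h assume h: "h \<in> carrier G"
      \<comment> \<open>The element h is written as (h g^-1) g, so that the orbit of
        \<open>S g x\<close> can be used.\<close>
      have "S (h \<otimes>\<^bsub>G\<^esub> inv\<^bsub>G\<^esub> g) (S g x) \<in> B" using * h g by simp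
      then show "S h x \<in> B"
        using h g x measurable_space[OF D(2)[OF g] x] by (simp add: D(4,6))
    qed
  next
    fix x assume x: "x \<in> B'"
    then have sp: "x \<in> space N" by (simp add: B'_def)
    have "S g x \<in> B'"
      unfolding B'_def
    proof (intro CollectI conjI ballI)
      show "S g x \<in> space N" using measurable_space[OF D(2)[OF g] sp] .
      fix h assume h: "h \<in> carrier G"
      then have "S (h \<otimes>\<^bsub>G\<^esub> g) x \<in> B" using x g by (simp add: B'_def)
      then show "S h (S g x) \<in> B" using D(4)[OF h g sp] by simp
    qed
    then show "x \<in> S g -` B' \<inter> space N" using sp by simp
  qed
  then have "measure N B' = 0 \<or> measure N B' = 1"
    using erg unfolding ergodic_system_def by auto
  moreover have "measure N B' = measure N B"
  proof (rule measure_eq_AE)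
    have "AE x in N. \<forall>g\<in>carrier G. S g x \<in> B \<longleftrightarrow> x \<in> B"
      using inv G(2) by (intro AE_ball_countable') auto
    with AE_space show "AE x in N. x \<in> B' \<longleftrightarrow> x \<in> B"
    proof eventually_elim
      case (elim x)
      then show ?case using D(5)[of x] one_closed by (auto simp: B'_def)
    qed
  qed auto
  ultimately show ?thesis by simp
qed

text \<open>The sets where \<open>F\<close> lies strictly below or strictly above its mean are
  almost invariant, hence null or full; neither can be full, since that would move the mean.\<close>

lemma ergodic_ae_invariant_function:
  fixes F :: "'a \<Rightarrow> real"
  assumes erg: "ergodic_system G N S" and G: "group G" "countable (carrier G)"
    and F[measurable]: "F \<in> borel_measurable N" and F01: "\<And>x. x \<in> space N \<Longrightarrow> 0 \<le> F x \<and> F x \<le> 1"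
    and inv: "\<And>g. g \<in> carrier G \<Longrightarrow> AE x in N. F (S g x) = F x"
  shows "AE x in N. F x = (\<integral>y. F y \<partial>N)"
proof -
  have pmp: "pmp_system G N S" using erg by (simp add: ergodic_system_def)
  note D = pmp_systemD[OF pmp G(1)]
  interpret prob_space N by (rule D(1))
  have int: "integrable N F"
    using F01 by (intro integrable_const_bound[of _ 1]) (auto simp: abs_of_nonneg)
  define c where "c = (\<integral>y. F y \<partial>N)"
  have 1: "\<not> (AE x in N. F x < c)"
  proof
    assume "AE x in N. F x < c"
    then have "expectation F < expectation (\<lambda>_. c)"
      using int by (intro integral_less_AE_space) (auto simp: emeasure_space_1)
    then show False by (simp add: c_def prob_space)
  qed
  have 2: "\<not> (AE x in N. c < F x)"
  proof
    assume "AE x in N. c < F x"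
    then have "expectation (\<lambda>_. c) < expectation F"
      using int by (intro integral_less_AE_space) (auto simp: emeasure_space_1)
    then show False by (simp add: c_def prob_space)
  qed
  have level: "AE x in N. S g x \<in> {x\<in>space N. P (F x)} \<longleftrightarrow> x \<in> {x\<in>space N. P (F x)}"
    if "g \<in> carrier G" for g and P
    using inv[OF that] AE_space
    by eventually_elim (use measurable_space[OF D(2)[OF that]] in auto)
  have "prob {x\<in>space N. F x < c} = 0 \<or> prob {x\<in>space N. F x < c} = 1"
    by (rule ergodic_ae_invariant_set[OF erg G]) (simp, rule level, assumption)
  then have a: "AE x in N. \<not> F x < c"
    using 1 prob_eq_0[of "{x\<in>space N. F x < c}"] prob_eq_1[of "{x\<in>space N. F x < c}"] AE_space
    by (auto elim!: eventually_elim2)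
  have "prob {x\<in>space N. c < F x} = 0 \<or> prob {x\<in>space N. c < F x} = 1"
    by (rule ergodic_ae_invariant_set[OF erg G]) (simp, rule level, assumption)
  then have b: "AE x in N. \<not> c < F x"
    using 2 prob_eq_0[of "{x\<in>space N. c < F x}"] prob_eq_1[of "{x\<in>space N. c < F x}"] AE_space
    by (auto elim!: eventually_elim2)
  from a b show ?thesis by eventually_elim (auto simp: c_def)
qed

text \<open>\<open>F\<close> is the density of a measure whose invariance, together with that of
  \<open>N\<close>, makes \<open>F\<close> almost invariant and therefore almost constant.\<close>

lemma ergodic_dominated_invariant:
  assumes erg: "ergodic_system G N S" and G: "group G" "countable (carrier G)"
    and F[measurable]: "F \<in> borel_measurable N" and F1: "\<And>w. F w \<le> (1::ennreal)"
    and inv: "\<And>g A. g \<in> carrier G \<Longrightarrow> A \<in> sets N \<Longrightarrow>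
      (\<integral>\<^sup>+y. indicator A (S g y) * F y \<partial>N) = (\<integral>\<^sup>+y. indicator A y * F y \<partial>N)"
    and A[measurable]: "A \<in> sets N"
  shows "(\<integral>\<^sup>+y. indicator A y * F y \<partial>N) = emeasure N A * (\<integral>\<^sup>+y. F y \<partial>N)"
proof -
  interpret group G by fact
  have pmp: "pmp_system G N S" using erg by (simp add: ergodic_system_def)
  note D = pmp_systemD[OF pmp G(1)]
  note [measurable] = D(2)
  interpret N: prob_space N by (rule D(1))
  have ae: "AE y in N. F (S g y) = F y" if g[measurable]: "g \<in> carrier G" for g
  proof -
    \<comment> \<open>The substitution \<open>S g\<close> moves the translation from
      \<open>F\<close> to the indicator, where it appears with the inverse of \<open>g\<close>;
      there the invariance hypothesis applies.\<close>
    have eq: "(\<integral>\<^sup>+y. indicator A y * F (S g y) \<partial>N) = (\<integral>\<^sup>+y. indicator A y * F y \<partial>N)" if A[measurable]: "A \<in> sets N" for A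
    proof -
      have g'[measurable]: "inv\<^bsub>G\<^esub> g \<in> carrier G" using g by simp
      have m[measurable]: "S (inv\<^bsub>G\<^esub> g) \<in> N \<rightarrow>\<^sub>M N" "S g \<in> N \<rightarrow>\<^sub>M N" using D(2) g g' by auto
      have "(\<integral>\<^sup>+y. indicator A y * F (S g y) \<partial>N) = (\<integral>\<^sup>+y. indicator A (S (inv\<^bsub>G\<^esub> g) (S g y)) * F (S g y) \<partial>N)"
        using D(6)[OF g] by (intro nn_integral_cong) auto
      also have "\<dots> = (\<integral>\<^sup>+y. indicator A (S (inv\<^bsub>G\<^esub> g) y) * F y \<partial>distr N N (S g))"
        by (subst nn_integral_distr) auto
      also have "\<dots> = (\<integral>\<^sup>+y. indicator A y * F y \<partial>N)"
        unfolding D(3)[OF g] by (rule inv[OF g' A])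
      finally show ?thesis .
    qed
    have fin: "(\<integral>\<^sup>+y. F y \<partial>N) < \<infinity>" "(\<integral>\<^sup>+y. F (S g y) \<partial>N) < \<infinity>"
      using nn_integral_mono[of N F "\<lambda>_. 1"] nn_integral_mono[of N "\<lambda>y. F (S g y)" "\<lambda>_. 1"] F1
      by (auto simp: N.emeasure_space_1 intro: le_less_trans)
    have [measurable]: "S g \<in> N \<rightarrow>\<^sub>M N" using D(2) g by auto
    have "AE y in N. F (S g y) \<le> F y" "AE y in N. F y \<le> F (S g y)"
      by (rule AE_le_if_integral_le; (simp add: fin[simplified] eq)?)+
    then show ?thesis by eventually_elim (rule antisym)
  qed
  have ftop: "F y \<noteq> \<top>" for y using F1[of y] by (auto simp: top_unique)
  define R where "R y = enn2real (F y)" for y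
  have R: "F y = ennreal (R y)" for y using ennreal_enn2real[of "F y"] ftop[of y] by (simp add: R_def less_top[symmetric])
  have "AE y in N. R y = (\<integral>y. R y \<partial>N)"
  proof (rule ergodic_ae_invariant_function[OF erg G])
    show "R \<in> borel_measurable N" unfolding R_def by measurable
    show "0 \<le> R x \<and> R x \<le> 1" for x using F1[of x] ftop[of x] by (auto simp: R_def enn2real_le_iff enn2real_nonneg intro: enn2real_leI)
    show "AE x in N. R (S g x) = R x" if "g \<in> carrier G" for g
      using ae[OF that] by eventually_elim (simp add: R_def)
  qed
  define c where "c = (\<integral>y. R y \<partial>N)"
  have c: "AE y in N. F y = ennreal c"
    using \<open>AE y in N. R y = (\<integral>y. R y \<partial>N)\<close> by eventually_elim (simp add: R c_def)
  have "(\<integral>\<^sup>+y. indicator A y * F y \<partial>N) = (\<integral>\<^sup>+y. indicator A y * ennreal c \<partial>N)"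
    using c by (intro nn_integral_cong_AE) (auto elim!: eventually_mono)
  also have "\<dots> = emeasure N A * ennreal c" by (subst nn_integral_multc) auto
  also have "ennreal c = (\<integral>\<^sup>+y. ennreal c \<partial>N)" by (simp add: N.emeasure_space_1)
  also have "\<dots> = (\<integral>\<^sup>+y. F y \<partial>N)"
    using c by (intro nn_integral_cong_AE) (auto elim!: eventually_mono)
  finally show ?thesis .
qed

section \<open>Joinings with an ergodic system\<close>

lemma distr_pair_measure_map_prod:
  assumes "prob_space M" "prob_space N" "f \<in> M \<rightarrow>\<^sub>M M" "g \<in> N \<rightarrow>\<^sub>M N" "distr M M f = M" "distr N N g = N"
  shows "distr (M \<Otimes>\<^sub>M N) (M \<Otimes>\<^sub>M N) (map_prod f g) = M \<Otimes>\<^sub>M N"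
proof -
  have "sigma_finite_measure (distr N N g)"
    unfolding assms(6) by (rule prob_space_imp_sigma_finite[OF assms(2)])
  from pair_measure_distr[OF assms(3,4) this] show ?thesis
    unfolding assms(5,6) by (simp add: map_prod_def)
qed

lemma distr_pair_snd:
  assumes "prob_space M" "prob_space N"
  shows "distr (M \<Otimes>\<^sub>M N) N snd = N"
proof (rule measure_eqI)
  interpret M: prob_space M by fact
  interpret N: prob_space N by fact
  fix A assume "A \<in> sets (distr (M \<Otimes>\<^sub>M N) N snd)"
  then have A: "A \<in> sets N" by simp
  have "snd -` A \<inter> space (M \<Otimes>\<^sub>M N) = space M \<times> A"
    using sets.sets_into_space[OF A] by (auto simp: space_pair_measure)
  then show "emeasure (distr (M \<Otimes>\<^sub>M N) N snd) A = emeasure N A"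
    using A by (simp add: emeasure_distr N.emeasure_pair_measure_Times M.emeasure_space_1)
qed simp

lemma pair_measure_mem_joinings:
  assumes "pmp_system G M T" "pmp_system G N S"
  shows "M \<Otimes>\<^sub>M N \<in> joinings G M T N S"
proof -
  interpret M: prob_space M using assms by (simp add: pmp_system_def)
  interpret N: prob_space N using assms by (simp add: pmp_system_def)
  interpret pair_prob_space M N ..
  have "distr (M \<Otimes>\<^sub>M N) (M \<Otimes>\<^sub>M N) (map_prod (T g) (S g)) = M \<Otimes>\<^sub>M N" if "g \<in> carrier G" for g
    using assms that unfolding pmp_system_def by (intro distr_pair_measure_map_prod) auto
  moreover have "prob_space (M \<Otimes>\<^sub>M N)" by (rule prob_space_axioms)
  ultimately show ?thesis
    unfolding joinings_def
    by (simp add: N.distr_pair_fst distr_pair_snd M.prob_space_axioms N.prob_space_axioms)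
qed

lemma joiningsD:
  assumes J: "J \<in> joinings G M T N S"
  shows "prob_space J" "sets J = sets (M \<Otimes>\<^sub>M N)" "space J = space M \<times> space N" "distr J M fst = M" "distr J N snd = N"
    "\<And>g. g \<in> carrier G \<Longrightarrow> distr J J (map_prod (T g) (S g)) = J"
  using J unfolding joinings_def by (auto dest: sets_eq_imp_space_eq simp: space_pair_measure)

lemma disjoint_systemsI:
  assumes "pmp_system G M T" "pmp_system G N S" "\<And>J. J \<in> joinings G M T N S \<Longrightarrow> J = M \<Otimes>\<^sub>M N"
  shows "disjoint_systems G M T N S"
  using assms(3) pair_measure_mem_joinings[OF assms(1,2)] unfolding disjoint_systems_def by blast

lemma AE_distr_invariant:
  assumes "distr M M g = M" and "g \<in> M \<rightarrow>\<^sub>M M" and "AE x in M. P x"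
  shows "AE x in M. P (g x)"
  using assms by (metis AE_distrD)

section \<open>Ergodic decompositions and the projection to components\<close>

locale ergodic_decomp =
  fixes G :: "('g, 'k) monoid_scheme" and M :: "'a measure" and T :: "'g \<Rightarrow> 'a \<Rightarrow> 'a"
    and C :: "'c measure" and \<kappa> :: "'c \<Rightarrow> 'a measure" and \<pi> :: "'a \<Rightarrow> 'c"
  assumes G: "group G" "countable (carrier G)" and pmp: "pmp_system G M T"
    and C: "prob_space C" and \<kappa>[measurable]: "\<kappa> \<in> C \<rightarrow>\<^sub>M prob_algebra M" and M_eq: "M = C \<bind> \<kappa>"
    and comp: "\<And>c. c \<in> space C \<Longrightarrow> ergodic_system G (\<kappa> c) T"
    and \<pi>[measurable]: "\<pi> \<in> M \<rightarrow>\<^sub>M C" and \<pi>_eq: "AE c in C. AE x in \<kappa> c. \<pi> x = c"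
begin

sublocale C: prob_space C by (rule C)
sublocale M: prob_space M using pmp by (simp add: pmp_system_def)

lemma \<kappa>_subprob[measurable]: "\<kappa> \<in> C \<rightarrow>\<^sub>M subprob_algebra M"
  by (rule measurable_prob_algebraD[OF \<kappa>])

lemma \<kappa>D:
  assumes "c \<in> space C"
  shows "prob_space (\<kappa> c)" "sets (\<kappa> c) = sets M" "space (\<kappa> c) = space M" "pmp_system G (\<kappa> c) T"
  using measurable_space[OF \<kappa> assms] comp[OF assms]
  by (auto simp: space_prob_algebra ergodic_system_def dest: sets_eq_imp_space_eq)

lemma T[measurable]: "g \<in> carrier G \<Longrightarrow> T g \<in> M \<rightarrow>\<^sub>M M"
  using pmp by (simp add: pmp_system_def)

lemma emeasure_M: "B \<in> sets M \<Longrightarrow> emeasure M B = (\<integral>\<^sup>+c. emeasure (\<kappa> c) B \<partial>C)"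
  using emeasure_bind[OF C.not_empty \<kappa>_subprob, of B] M_eq by simp

text \<open>\<open>P\<close> need not be measurable, so the exceptional set is first enlarged to a
  measurable null set, which is null for almost every \<open>\<kappa> c\<close> because
  \<open>M\<close> is their mixture.\<close>

lemma AE_component:
  assumes "AE x in M. P x"
  shows "AE c in C. AE x in \<kappa> c. P x"
proof -
  obtain N where N: "{x\<in>space M. \<not> P x} \<subseteq> N" "N \<in> sets M" "emeasure M N = 0"
    using AE_E[OF assms] by (metis (mono_tags, lifting))
  have [measurable]: "N \<in> sets M" by fact
  have "AE x in C \<bind> \<kappa>. x \<notin> N"
    unfolding M_eq[symmetric] using N by (intro AE_not_in) (simp add: null_sets_def)
  then have "AE c in C. AE x in \<kappa> c. x \<notin> N"
    by (subst (asm) AE_bind[OF \<kappa>_subprob]) auto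
  with AE_space show ?thesis
  proof eventually_elim
    case (elim c)
    from elim(2) AE_space show ?case
      by eventually_elim (use N(1) \<kappa>D(3)[OF elim(1)] in auto)
  qed
qed

text \<open>On almost every component \<open>\<pi>\<close> is almost surely equal to
  \<open>c\<close>, so the intersection is almost all of \<open>B\<close> or almost empty, according
  to whether \<open>c \<in> A\<close>.\<close>

lemma emeasure_component_vimage:
  assumes A[measurable]: "A \<in> sets C" and B[measurable]: "B \<in> sets M"
  shows "emeasure M (\<pi> -` A \<inter> B) = (\<integral>\<^sup>+c. indicator A c * emeasure (\<kappa> c) B \<partial>C)"
proof -
  have [measurable]: "\<pi> -` A \<inter> B \<in> sets M"
  proof -
    have "\<pi> -` A \<inter> B = (\<pi> -` A \<inter> space M) \<inter> B" using sets.sets_into_space[OF B] by auto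
    then show ?thesis by simp
  qed
  have "emeasure M (\<pi> -` A \<inter> B) = (\<integral>\<^sup>+c. emeasure (\<kappa> c) (\<pi> -` A \<inter> B) \<partial>C)"
    by (rule emeasure_M) simp
  also have "\<dots> = (\<integral>\<^sup>+c. indicator A c * emeasure (\<kappa> c) B \<partial>C)"
  proof (rule nn_integral_cong_AE)
    show "AE c in C. emeasure (\<kappa> c) (\<pi> -` A \<inter> B) = indicator A c * emeasure (\<kappa> c) B"
      using \<pi>_eq AE_space
    proof eventually_elim
      case (elim c)
      have "emeasure (\<kappa> c) (\<pi> -` A \<inter> B) = emeasure (\<kappa> c) (if c \<in> A then B else {})"
        using elim(1) by (intro emeasure_eq_AE) (auto simp: \<kappa>D[OF elim(2)] elim!: eventually_mono)
      then show ?case by auto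
    qed
  qed
  finally show ?thesis .
qed

lemma distr_\<pi>: "A \<in> sets C \<Longrightarrow> emeasure M (\<pi> -` A \<inter> space M) = emeasure C A"
  using emeasure_component_vimage[of A "space M"]
  by (simp add: \<kappa>D prob_space.emeasure_space_1 cong: nn_integral_cong)
     (metis (no_types, lifting) \<kappa>D(1,3) mult.right_neutral nn_integral_cong nn_integral_indicator prob_space.emeasure_space_1)

text \<open>\<open>\<kappa> c\<close> is preserved by \<open>T g\<close>, so both
  \<open>\<pi> x\<close> and \<open>\<pi> (T g x)\<close> equal \<open>c\<close> almost surely. The
  statement is made for one set \<open>A\<close> at a time because equality of two points of
  \<open>C\<close> need not be a measurable condition.\<close>

lemma \<pi>_invariant:
  assumes g: "g \<in> carrier G" and A[measurable]: "A \<in> sets C"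
  shows "AE x in M. \<pi> (T g x) \<in> A \<longleftrightarrow> \<pi> x \<in> A"
proof -
  have [measurable]: "T g \<in> M \<rightarrow>\<^sub>M M" by (rule T[OF g])
  have "AE x in C \<bind> \<kappa>. \<pi> (T g x) \<in> A \<longleftrightarrow> \<pi> x \<in> A"
  proof (subst AE_bind[OF \<kappa>_subprob])
    show "AE c in C. AE x in \<kappa> c. \<pi> (T g x) \<in> A \<longleftrightarrow> \<pi> x \<in> A"
      using \<pi>_eq AE_space
    proof eventually_elim
      case (elim c)
      have pc: "distr (\<kappa> c) (\<kappa> c) (T g) = \<kappa> c" "T g \<in> \<kappa> c \<rightarrow>\<^sub>M \<kappa> c"
        using \<kappa>D(4)[OF elim(2)] g by (auto simp: pmp_system_def)
      show ?case
        using elim(1) AE_distr_invariant[OF pc elim(1)] by eventually_elim simp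
    qed
  qed simp
  then show ?thesis unfolding M_eq[symmetric] .
qed

end

locale ergodic_joining = ergodic_decomp G M T C \<kappa> \<pi> + std: standard_model M f f' X0
  for G :: "('g, 'k) monoid_scheme" and M :: "'a measure" and T C and \<kappa> :: "'c \<Rightarrow> 'a measure" and \<pi> f f' X0 +
  fixes Y :: "'b measure" and S :: "'g \<Rightarrow> 'b \<Rightarrow> 'b" and J :: "('a \<times> 'b) measure"
  assumes Y: "ergodic_system G Y S" and J: "J \<in> joinings G M T Y S" and X0_AE: "AE x in M. x \<in> X0"
begin

lemma pmpY: "pmp_system G Y S" using Y by (simp add: ergodic_system_def)

sublocale Y: prob_space Y using pmpY by (simp add: pmp_system_def)
sublocale J: prob_space J by (rule joiningsD(1)[OF J])

lemma J_cong[measurable_cong]: "sets J = sets (M \<Otimes>\<^sub>M Y)" by (rule joiningsD(2)[OF J])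

lemma S[measurable]: "g \<in> carrier G \<Longrightarrow> S g \<in> Y \<rightarrow>\<^sub>M Y"
  using pmpY by (simp add: pmp_system_def)

lemma map_prod_J: "g \<in> carrier G \<Longrightarrow> map_prod (T g) (S g) \<in> J \<rightarrow>\<^sub>M J"
  using T S unfolding map_prod_def measurable_cong_sets[OF J_cong J_cong] by measurable

lemma AE_J_fst:
  assumes "AE x in M. P x" shows "AE p in J. P (fst p)"
proof -
  have "AE x in distr J M fst. P x" unfolding joiningsD(4)[OF J] by (rule assms)
  then show ?thesis by (rule AE_distrD[rotated]) simp
qed

lemma emeasure_J_fst: "A \<in> sets M \<Longrightarrow> emeasure J {p\<in>space J. fst p \<in> A} = emeasure M A"
  using arg_cong[OF joiningsD(4)[OF J], of "\<lambda>m. emeasure m A"]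
  by (simp add: emeasure_distr vimage_def Int_def conj_commute)

lemma emeasure_J_invariant:
  assumes g: "g \<in> carrier G" and P[measurable]: "Measurable.pred J P"
  shows "emeasure J {p\<in>space J. P (map_prod (T g) (S g) p)} = emeasure J {p\<in>space J. P p}"
proof -
  have "emeasure J {p\<in>space J. P p} = emeasure (distr J J (map_prod (T g) (S g))) {p\<in>space J. P p}"
    by (simp add: joiningsD(6)[OF J g])
  also have "\<dots> = emeasure J (map_prod (T g) (S g) -` {p\<in>space J. P p} \<inter> space J)"
    using map_prod_J[OF g] by (rule emeasure_distr) simp
  also have "map_prod (T g) (S g) -` {p\<in>space J. P p} \<inter> space J = {p\<in>space J. P (map_prod (T g) (S g) p)}"
    using measurable_space[OF map_prod_J[OF g]] by auto
  finally show ?thesis by simp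
qed

text \<open>The measure \<open>B \<mapsto> J {p. \<pi> (fst p) \<in> A \<and> snd p \<in> B}\<close> is invariant and dominated by \<open>Y\<close>,
  hence a multiple of \<open>Y\<close>.\<close>
lemma component_independent:
  assumes A[measurable]: "A \<in> sets C" and B[measurable]: "B \<in> sets Y"
  shows "emeasure J {p\<in>space J. \<pi> (fst p) \<in> A \<and> snd p \<in> B} = emeasure C A * emeasure Y B"
proof -
  \<comment> \<open>The coordinates are exchanged so that \<open>Y\<close> becomes the base;
    \<open>F y\<close> below is the probability of \<open>\<pi> x \<in> A\<close> given
    \<open>y\<close>.\<close>
  define L where "L = distr J (Y \<Otimes>\<^sub>M M) (\<lambda>p. (snd p, fst p))"
  have spJ: "space J = space M \<times> space Y" by (rule joiningsD(3)[OF J])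
  have L: "emeasure L {q\<in>space (Y \<Otimes>\<^sub>M M). P q} = emeasure J {p\<in>space J. P (snd p, fst p)}"
    if [measurable]: "Measurable.pred (Y \<Otimes>\<^sub>M M) P" for P
    unfolding L_def by (subst emeasure_distr) (auto intro!: arg_cong[where f="emeasure J"] simp: space_pair_measure spJ)
  let ?Z = "\<pi> -` A \<inter> space M"
  have L': "emeasure L (B \<times> ?Z) = emeasure J {p\<in>space J. \<pi> (fst p) \<in> A \<and> snd p \<in> B}" if [measurable]: "B \<in> sets Y" for B
  proof -
    have "B \<times> ?Z = {q\<in>space (Y \<Otimes>\<^sub>M M). fst q \<in> B \<and> \<pi> (snd q) \<in> A}"
      using sets.sets_into_space[OF that] by (auto simp: space_pair_measure)
    then show ?thesis using L[of "\<lambda>q. fst q \<in> B \<and> \<pi> (snd q) \<in> A"] by (simp add: conj_commute)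
  qed
  have 1: "sets L = sets (Y \<Otimes>\<^sub>M M)" by (simp add: L_def)
  have 2: "prob_space L" unfolding L_def by (rule J.prob_space_distr) simp
  have 3: "distr L Y fst = Y"
    unfolding L_def by (subst distr_distr) (auto simp: comp_def joiningsD(5)[OF J])
  have 4: "?Z \<in> sets M" by simp
  obtain F where F: "F \<in> borel_measurable Y" "\<And>w. F w \<le> 1"
    and FL: "\<And>B. B \<in> sets Y \<Longrightarrow> emeasure L (B \<times> ?Z) = (\<integral>\<^sup>+w. indicator B w * F w \<partial>Y)"
    using conditional_probability_exists[OF Y.prob_space_axioms 1 2 3 4] by metis
  have "(\<integral>\<^sup>+y. indicator B y * F y \<partial>Y) = emeasure Y B * (\<integral>\<^sup>+y. F y \<partial>Y)"
  proof (rule ergodic_dominated_invariant[OF Y G F _ B])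
    fix g B assume g: "g \<in> carrier G" and B[measurable]: "B \<in> sets Y"
    have [measurable]: "S g \<in> Y \<rightarrow>\<^sub>M Y" "T g \<in> M \<rightarrow>\<^sub>M M" using S T g by auto
    have "(\<integral>\<^sup>+y. indicator B (S g y) * F y \<partial>Y) = (\<integral>\<^sup>+y. indicator (S g -` B \<inter> space Y) y * F y \<partial>Y)"
      by (intro nn_integral_cong) (auto simp: indicator_def)
    also have "\<dots> = emeasure J {p\<in>space J. \<pi> (fst p) \<in> A \<and> snd p \<in> S g -` B \<inter> space Y}"
      by (subst FL[symmetric]) (auto simp: L')
    \<comment> \<open>Invariance of \<open>\<pi>\<close> puts \<open>T g\<close> into the first
      condition as well, so that the invariance of \<open>J\<close> under the joint map can be
      used.\<close>
    also have "\<dots> = emeasure J {p\<in>space J. \<pi> (T g (fst p)) \<in> A \<and> S g (snd p) \<in> B}"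
      using AE_J_fst[OF \<pi>_invariant[OF g A]]
      by (intro emeasure_eq_AE) (auto simp: spJ elim!: eventually_mono)
    also have "\<dots> = emeasure J {p\<in>space J. \<pi> (fst p) \<in> A \<and> snd p \<in> B}"
      using emeasure_J_invariant[OF g, of "\<lambda>p. \<pi> (fst p) \<in> A \<and> snd p \<in> B"] by simp
    also have "\<dots> = (\<integral>\<^sup>+y. indicator B y * F y \<partial>Y)"
      by (subst FL[symmetric]) (auto simp: L')
    finally show "(\<integral>\<^sup>+y. indicator B (S g y) * F y \<partial>Y) = (\<integral>\<^sup>+y. indicator B y * F y \<partial>Y)" .
  qed
  also have "(\<integral>\<^sup>+y. F y \<partial>Y) = (\<integral>\<^sup>+y. indicator (space Y) y * F y \<partial>Y)"
    by (intro nn_integral_cong) simp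
  also have "\<dots> = emeasure J {p\<in>space J. fst p \<in> ?Z}"
    by (subst FL[symmetric]) (auto simp: L' spJ intro!: arg_cong[where f="emeasure J"])
  also have "\<dots> = emeasure C A" by (subst emeasure_J_fst) (auto simp: distr_\<pi>)
  finally show ?thesis using FL[OF B] L'[OF B] by (simp add: mult.commute)
qed


end

section \<open>Conditional laws given the component and the point of the second system\<close>

context ergodic_joining begin

lemma joining_kernel:
  obtains K where "K \<in> C \<Otimes>\<^sub>M Y \<rightarrow>\<^sub>M prob_algebra M"
    "\<And>A B. A \<in> sets (C \<Otimes>\<^sub>M Y) \<Longrightarrow> B \<in> sets M \<Longrightarrow>
      emeasure J {p\<in>space J. (\<pi> (fst p), snd p) \<in> A \<and> fst p \<in> B} =
      (\<integral>\<^sup>+w. indicator A w * emeasure (K w) B \<partial>(C \<Otimes>\<^sub>M Y))"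
proof -
  interpret CY: pair_prob_space C Y ..
  have spJ: "space J = space M \<times> space Y" by (rule joiningsD(3)[OF J])
  \<comment> \<open>The pair of the component and \<open>y\<close> is the base point and
    \<open>x\<close> lies in the fibre; \<open>component_independent\<close> says that the base has
    law \<open>C \<Otimes>\<^sub>M Y\<close>.\<close>
  define h where "h p = ((\<pi> (fst p), snd p), fst p)" for p :: "'a \<times> 'b"
  have h[measurable]: "h \<in> J \<rightarrow>\<^sub>M (C \<Otimes>\<^sub>M Y) \<Otimes>\<^sub>M M" unfolding h_def by measurable
  define L where "L = distr J ((C \<Otimes>\<^sub>M Y) \<Otimes>\<^sub>M M) h"
  have 1: "sets L = sets ((C \<Otimes>\<^sub>M Y) \<Otimes>\<^sub>M M)" by (simp add: L_def)
  have 2: "prob_space L" unfolding L_def by (rule J.prob_space_distr) simp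
  have 3: "distr L (C \<Otimes>\<^sub>M Y) fst = C \<Otimes>\<^sub>M Y"
  proof -
    have "C \<Otimes>\<^sub>M Y = distr J (C \<Otimes>\<^sub>M Y) (\<lambda>p. (\<pi> (fst p), snd p))"
    proof (rule pair_measure_eqI)
      fix A B assume A[measurable]: "A \<in> sets C" and B[measurable]: "B \<in> sets Y"
      have "emeasure (distr J (C \<Otimes>\<^sub>M Y) (\<lambda>p. (\<pi> (fst p), snd p))) (A \<times> B) =
          emeasure J {p\<in>space J. \<pi> (fst p) \<in> A \<and> snd p \<in> B}"
        by (subst emeasure_distr) (auto intro!: arg_cong[where f="emeasure J"])
      then show "emeasure C A * emeasure Y B = emeasure (distr J (C \<Otimes>\<^sub>M Y) (\<lambda>p. (\<pi> (fst p), snd p))) (A \<times> B)"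
        by (simp add: component_independent)
    qed (simp_all add: C.sigma_finite_measure_axioms Y.sigma_finite_measure_axioms)
    then show ?thesis
      unfolding L_def by (subst distr_distr) (auto simp: comp_def h_def)
  qed
  have 4: "AE q in L. snd q \<in> X0"
    unfolding L_def using AE_J_fst[OF X0_AE] by (subst AE_distr_iff) (auto simp: h_def)
  obtain K where K: "K \<in> C \<Otimes>\<^sub>M Y \<rightarrow>\<^sub>M prob_algebra M"
    and KL: "\<And>A B. A \<in> sets (C \<Otimes>\<^sub>M Y) \<Longrightarrow> B \<in> sets M \<Longrightarrow>
      emeasure L (A \<times> B) = (\<integral>\<^sup>+w. indicator A w * emeasure (K w) B \<partial>(C \<Otimes>\<^sub>M Y))"
    by (rule std.disintegration[OF CY.prob_space_axioms 1 2 3 4]) blast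
  show thesis
  proof (rule that[OF K])
    fix A B assume A[measurable]: "A \<in> sets (C \<Otimes>\<^sub>M Y)" and B[measurable]: "B \<in> sets M"
    have "emeasure L (A \<times> B) = emeasure J (h -` (A \<times> B) \<inter> space J)"
      unfolding L_def by (rule emeasure_distr[OF h]) simp
    also have "h -` (A \<times> B) \<inter> space J = {p\<in>space J. (\<pi> (fst p), snd p) \<in> A \<and> fst p \<in> B}"
      by (auto simp: h_def)
    finally show "emeasure J {p\<in>space J. (\<pi> (fst p), snd p) \<in> A \<and> fst p \<in> B} =
        (\<integral>\<^sup>+w. indicator A w * emeasure (K w) B \<partial>(C \<Otimes>\<^sub>M Y))"
      using KL[OF A B] by simp
  qed
qed

text \<open>For rectangles this is \<open>\<pi>_invariant\<close>; the property survives complements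
  and countable unions, so it reaches the whole product sigma-algebra without comparing points of
  \<open>C\<close>.\<close>

lemma \<pi>_pair_invariant:
  assumes g: "g \<in> carrier G" and A: "A \<in> sets (C \<Otimes>\<^sub>M Y)"
  shows "AE p in J. (\<pi> (T g (fst p)), snd p) \<in> A \<longleftrightarrow> (\<pi> (fst p), snd p) \<in> A"
proof -
  have spJ: "space J = space M \<times> space Y" by (rule joiningsD(3)[OF J])
  have sp: "(\<pi> (T g (fst p)), snd p) \<in> space C \<times> space Y" "(\<pi> (fst p), snd p) \<in> space C \<times> space Y"
    if "p \<in> space J" for p
    using that measurable_space[OF T[OF g]] measurable_space[OF \<pi>] by (auto simp: spJ)
  from A show ?thesis
    unfolding sets_pair_measure
  proof (induction rule: sigma_sets.induct)
    case (Basic A)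
    then obtain A1 A2 where A: "A = A1 \<times> A2" "A1 \<in> sets C" by auto
    show ?case
      using AE_J_fst[OF \<pi>_invariant[OF g A(2)]] by eventually_elim (simp add: A(1))
  next
    case (Compl A)
    from Compl.IH AE_space show ?case by eventually_elim (use sp in auto)
  next
    case (Union A)
    have "AE p in J. \<forall>i. (\<pi> (T g (fst p)), snd p) \<in> A i \<longleftrightarrow> (\<pi> (fst p), snd p) \<in> A i"
      using Union.IH by (subst AE_all_countable) auto
    then show ?case by eventually_elim auto
  qed simp
qed

lemma joining_eq_pair:
  assumes disj: "AE p in C \<Otimes>\<^sub>M C. disjoint_systems G (\<kappa> (fst p)) T (\<kappa> (snd p)) T"
  shows "J = M \<Otimes>\<^sub>M Y"
proof -
  interpret CY: pair_prob_space C Y ..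
  interpret CC: pair_prob_space C C ..
  have spJ: "space J = space M \<times> space Y" by (rule joiningsD(3)[OF J])
  obtain K where K[measurable]: "K \<in> C \<Otimes>\<^sub>M Y \<rightarrow>\<^sub>M prob_algebra M"
    and KJ: "\<And>A B. A \<in> sets (C \<Otimes>\<^sub>M Y) \<Longrightarrow> B \<in> sets M \<Longrightarrow>
      emeasure J {p\<in>space J. (\<pi> (fst p), snd p) \<in> A \<and> fst p \<in> B} =
      (\<integral>\<^sup>+w. indicator A w * emeasure (K w) B \<partial>(C \<Otimes>\<^sub>M Y))"
    by (rule joining_kernel) blast
  have K'[measurable]: "K \<in> C \<Otimes>\<^sub>M Y \<rightarrow>\<^sub>M subprob_algebra M" by (rule measurable_prob_algebraD[OF K])
  have KD': "prob_space (K w)" "sets (K w) = sets M" "space (K w) = space M"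
    if "w \<in> space (C \<Otimes>\<^sub>M Y)" for w
    using measurable_space[OF K that] sets_eq_imp_space_eq[of "K w" M] by (simp_all add: space_prob_algebra)
  have KD: "prob_space (K (c, y))" "sets (K (c, y)) = sets M" "space (K (c, y)) = space M"
    if "c \<in> space C" "y \<in> space Y" for c y
    using KD'[of "(c, y)"] that by (simp_all add: space_pair_measure)
  \<comment> \<open>The first marginal of \<open>J\<close> is \<open>M\<close>, so a set of full
    \<open>M\<close>-measure is full for almost every \<open>K w\<close>. This keeps the kernels on
    \<open>X0\<close>, where they can be compared.\<close>
  have K_null: "AE w in C \<Otimes>\<^sub>M Y. AE x in K w. x \<in> X" if X[measurable]: "X \<in> sets M" and "AE x in M. x \<in> X" for X
  proof -
    have "(\<integral>\<^sup>+w. emeasure (K w) (space M - X) \<partial>(C \<Otimes>\<^sub>M Y)) =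
        (\<integral>\<^sup>+w. indicator (space (C \<Otimes>\<^sub>M Y)) w * emeasure (K w) (space M - X) \<partial>(C \<Otimes>\<^sub>M Y))"
      by (intro nn_integral_cong) simp
    also have "\<dots> = emeasure J {p\<in>space J. (\<pi> (fst p), snd p) \<in> space (C \<Otimes>\<^sub>M Y) \<and> fst p \<in> space M - X}"
      by (subst KJ) auto
    also have "\<dots> = emeasure J {}"
      using AE_J_fst[OF that(2)] by (intro emeasure_eq_AE) (auto elim!: eventually_mono)
    finally have "(\<integral>\<^sup>+w. emeasure (K w) (space M - X) \<partial>(C \<Otimes>\<^sub>M Y)) = 0" by simp
    then have "AE w in C \<Otimes>\<^sub>M Y. emeasure (K w) (space M - X) = 0"
      by (subst (asm) nn_integral_0_iff_AE) auto
    with AE_space show ?thesis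
    proof eventually_elim
      case (elim w)
      show ?case
        by (rule AE_I[of _ _ "space M - X"]) (use elim(2) KD'[OF elim(1)] in auto)
    qed
  qed
  \<comment> \<open>Both sides are the law of \<open>T g x\<close> given the component and
    \<open>y\<close>: on the left by transport of \<open>K\<close>, on the right because the joint
    map preserves \<open>J\<close> and, almost surely, the component.\<close>
  have equivariant: "AE w in C \<Otimes>\<^sub>M Y. distr (K w) M (T g) = K (fst w, S g (snd w))" if g: "g \<in> carrier G" for g
  proof -
    interpret group G by (rule G)
    have [measurable]: "T g \<in> M \<rightarrow>\<^sub>M M" "S g \<in> Y \<rightarrow>\<^sub>M Y" "S (inv\<^bsub>G\<^esub> g) \<in> Y \<rightarrow>\<^sub>M Y" using T S g by auto
    have inv_S: "S g (S (inv\<^bsub>G\<^esub> g) y) = y" "S (inv\<^bsub>G\<^esub> g) (S g y) = y" if "y \<in> space Y" for y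
      using pmp_systemD(6,7)[OF pmpY G(1) g that] by auto
    let ?s = "\<lambda>w. (fst w, S g (snd w))"
    have ds: "distr (C \<Otimes>\<^sub>M Y) (C \<Otimes>\<^sub>M Y) ?s = C \<Otimes>\<^sub>M Y"
    proof -
      have "distr Y Y (S g) = Y" using pmpY g by (simp add: pmp_system_def)
      then show ?thesis
        using distr_pair_measure_map_prod[of C Y "\<lambda>x. x" "S g"]
        by (simp add: C.prob_space_axioms Y.prob_space_axioms distr_id2 map_prod_def split_beta')
    qed
    show ?thesis
    proof (rule std.kernel_eq_AE[OF CY.prob_space_axioms])
      show "(\<lambda>w. distr (K w) M (T g)) \<in> C \<Otimes>\<^sub>M Y \<rightarrow>\<^sub>M prob_algebra M"
        by (rule measurable_compose[OF K measurable_distr_prob_space]) simp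
      show "(\<lambda>w. K (fst w, S g (snd w))) \<in> C \<Otimes>\<^sub>M Y \<rightarrow>\<^sub>M prob_algebra M" by measurable
      have X0g: "T g -` X0 \<inter> space M \<in> sets M" by simp
      have "AE x in M. T g x \<in> X0"
        by (rule AE_distr_invariant[OF _ T[OF g] X0_AE]) (use pmp g in \<open>simp add: pmp_system_def\<close>)
      then have "AE x in M. x \<in> T g -` X0 \<inter> space M" using AE_space by eventually_elim simp
      from K_null[OF X0g this] AE_space
      show "AE w in C \<Otimes>\<^sub>M Y. AE x in distr (K w) M (T g). x \<in> X0"
      proof eventually_elim
        case (elim w)
        have "T g \<in> K w \<rightarrow>\<^sub>M M"
          using measurable_cong_sets[OF KD'(2)[OF elim(2)] refl[of "sets M"]] T[OF g] by simp
        then show ?case using elim(1) by (subst AE_distr_iff) (auto elim!: eventually_mono)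
      qed
      show "AE w in C \<Otimes>\<^sub>M Y. AE x in K (fst w, S g (snd w)). x \<in> X0"
        by (rule AE_distr_invariant[OF ds _ K_null[OF std.X0 X0_AE]]) simp
    next
      fix A B assume A[measurable]: "A \<in> sets (C \<Otimes>\<^sub>M Y)" and B[measurable]: "B \<in> sets M"
      have "(\<integral>\<^sup>+w. indicator A w * emeasure (distr (K w) M (T g)) B \<partial>(C \<Otimes>\<^sub>M Y)) =
        (\<integral>\<^sup>+w. indicator A w * emeasure (K w) (T g -` B \<inter> space M) \<partial>(C \<Otimes>\<^sub>M Y))"
      proof (intro nn_integral_cong)
        fix w assume w: "w \<in> space (C \<Otimes>\<^sub>M Y)"
        have "T g \<in> K w \<rightarrow>\<^sub>M M"
          using measurable_cong_sets[OF KD'(2)[OF w] refl[of "sets M"]] T[OF g] by simp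
        then show "indicator A w * emeasure (distr (K w) M (T g)) B = indicator A w * emeasure (K w) (T g -` B \<inter> space M)"
          by (simp add: emeasure_distr KD'(3)[OF w])
      qed
      also have "\<dots> = emeasure J {p\<in>space J. (\<pi> (fst p), snd p) \<in> A \<and> fst p \<in> T g -` B \<inter> space M}"
        by (subst KJ) auto
      \<comment> \<open>\<open>\<pi>_pair_invariant\<close> inserts \<open>T g\<close>, and
        \<open>y\<close> is written as its translate moved back, so that the whole condition is
        evaluated at the image point.\<close>
      also have "\<dots> = emeasure J {p\<in>space J. (\<pi> (T g (fst p)), S (inv\<^bsub>G\<^esub> g) (S g (snd p))) \<in> A \<and> T g (fst p) \<in> B}"
      proof (rule emeasure_eq_AE)
        show "AE p in J. p \<in> {p\<in>space J. (\<pi> (fst p), snd p) \<in> A \<and> fst p \<in> T g -` B \<inter> space M} \<longleftrightarrow>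
          p \<in> {p\<in>space J. (\<pi> (T g (fst p)), S (inv\<^bsub>G\<^esub> g) (S g (snd p))) \<in> A \<and> T g (fst p) \<in> B}"
          using \<pi>_pair_invariant[OF g A] AE_space by eventually_elim (auto simp: spJ inv_S)
      qed measurable
      also have "\<dots> = emeasure J {p\<in>space J. (\<pi> (fst p), S (inv\<^bsub>G\<^esub> g) (snd p)) \<in> A \<and> fst p \<in> B}"
        using emeasure_J_invariant[OF g, of "\<lambda>p. (\<pi> (fst p), S (inv\<^bsub>G\<^esub> g) (snd p)) \<in> A \<and> fst p \<in> B"] by simp
      also have "\<dots> = emeasure J {p\<in>space J. (\<pi> (fst p), snd p) \<in> {w\<in>space (C \<Otimes>\<^sub>M Y). (fst w, S (inv\<^bsub>G\<^esub> g) (snd w)) \<in> A} \<and> fst p \<in> B}"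
        using measurable_space[OF \<pi>] by (intro arg_cong[where f="emeasure J"]) (auto simp: spJ space_pair_measure)
      also have "\<dots> = (\<integral>\<^sup>+w. indicator {w\<in>space (C \<Otimes>\<^sub>M Y). (fst w, S (inv\<^bsub>G\<^esub> g) (snd w)) \<in> A} w * emeasure (K w) B \<partial>(C \<Otimes>\<^sub>M Y))"
        by (subst KJ) auto
      also have "\<dots> = (\<integral>\<^sup>+w. indicator {w\<in>space (C \<Otimes>\<^sub>M Y). (fst w, S (inv\<^bsub>G\<^esub> g) (snd w)) \<in> A} w * emeasure (K w) B \<partial>distr (C \<Otimes>\<^sub>M Y) (C \<Otimes>\<^sub>M Y) ?s)"
        unfolding ds ..
      also have "\<dots> = (\<integral>\<^sup>+w. indicator A w * emeasure (K (fst w, S g (snd w))) B \<partial>(C \<Otimes>\<^sub>M Y))"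
        by (subst nn_integral_distr)
          (auto intro!: nn_integral_cong simp: indicator_def space_pair_measure inv_S dest: measurable_space[OF S[OF g]])
      finally show "(\<integral>\<^sup>+w. indicator A w * emeasure (distr (K w) M (T g)) B \<partial>(C \<Otimes>\<^sub>M Y)) =
        (\<integral>\<^sup>+w. indicator A w * emeasure (K (fst w, S g (snd w))) B \<partial>(C \<Otimes>\<^sub>M Y))" .
    qed
  qed
  have bind_meas[measurable]: "(\<lambda>c. Y \<bind> (\<lambda>y. K (c, y))) \<in> C \<rightarrow>\<^sub>M prob_algebra M"
    by (rule measurable_bind_prob_space2[where N=Y])
      (simp_all add: space_prob_algebra Y.prob_space_axioms measurable_const)
  \<comment> \<open>Averaging over \<open>y\<close> disintegrates the first marginal
    \<open>M\<close> over \<open>C\<close>, and so does \<open>\<kappa>\<close>.\<close>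
  have marginal: "AE c in C. Y \<bind> (\<lambda>y. K (c, y)) = \<kappa> c"
  proof (rule std.kernel_eq_AE[OF C.prob_space_axioms bind_meas \<kappa>])
    have "AE c in C. AE y in Y. AE x in K (c, y). x \<in> X0"
      using CY.AE_pair[OF K_null[OF std.X0 X0_AE]] by simp
    with AE_space show "AE c in C. AE x in Y \<bind> (\<lambda>y. K (c, y)). x \<in> X0"
    proof eventually_elim
      case (elim c)
      have "(\<lambda>y. K (c, y)) \<in> Y \<rightarrow>\<^sub>M subprob_algebra M" using elim(1) by measurable
      then show ?case using elim(2) by (subst AE_bind) auto
    qed
    show "AE c in C. AE x in \<kappa> c. x \<in> X0" by (rule AE_component[OF X0_AE])
    fix A B assume A[measurable]: "A \<in> sets C" and B[measurable]: "B \<in> sets M"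
    have Bsp: "B \<subseteq> space M" by (rule sets.sets_into_space[OF B])
    have "(\<integral>\<^sup>+c. indicator A c * emeasure (Y \<bind> (\<lambda>y. K (c, y))) B \<partial>C) =
      (\<integral>\<^sup>+c. \<integral>\<^sup>+y. indicator A c * emeasure (K (c, y)) B \<partial>Y \<partial>C)"
    proof (intro nn_integral_cong)
      fix c assume c: "c \<in> space C"
      have [measurable]: "(\<lambda>y. K (c, y)) \<in> Y \<rightarrow>\<^sub>M subprob_algebra M" using c by measurable
      show "indicator A c * emeasure (Y \<bind> (\<lambda>y. K (c, y))) B = (\<integral>\<^sup>+y. indicator A c * emeasure (K (c, y)) B \<partial>Y)"
        by (subst emeasure_bind[where N=M]) (auto simp: Y.not_empty nn_integral_cmult)
    qed
    also have "\<dots> = (\<integral>\<^sup>+c. \<integral>\<^sup>+y. indicator (A \<times> space Y) (c, y) * emeasure (K (c, y)) B \<partial>Y \<partial>C)"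
      by (intro nn_integral_cong) (auto simp: indicator_def)
    also have "\<dots> = (\<integral>\<^sup>+w. indicator (A \<times> space Y) w * emeasure (K w) B \<partial>(C \<Otimes>\<^sub>M Y))"
      by (subst Y.nn_integral_fst[symmetric]) auto
    also have "\<dots> = emeasure J {p\<in>space J. (\<pi> (fst p), snd p) \<in> A \<times> space Y \<and> fst p \<in> B}"
      by (subst KJ) auto
    also have "\<dots> = emeasure J {p\<in>space J. fst p \<in> \<pi> -` A \<inter> B}"
      by (intro arg_cong[where f="emeasure J"]) (auto simp: spJ)
    also have "\<dots> = emeasure M (\<pi> -` A \<inter> B)"
    proof (rule emeasure_J_fst)
      have "\<pi> -` A \<inter> B = (\<pi> -` A \<inter> space M) \<inter> B" using Bsp by auto
      then show "\<pi> -` A \<inter> B \<in> sets M" by simp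
    qed
    also have "\<dots> = (\<integral>\<^sup>+c. indicator A c * emeasure (\<kappa> c) B \<partial>C)"
      by (rule emeasure_component_vimage[OF A B])
    finally show "(\<integral>\<^sup>+c. indicator A c * emeasure (Y \<bind> (\<lambda>y. K (c, y))) B \<partial>C) =
      (\<integral>\<^sup>+c. indicator A c * emeasure (\<kappa> c) B \<partial>C)" .
  qed
  \<comment> \<open>Countability of the group collects the equivariance under all \<open>g\<close>
    into one condition on \<open>c\<close>, which can then be imposed on each member of a pair
    separately.\<close>
  have good: "AE c in C. Y \<bind> (\<lambda>y. K (c, y)) = \<kappa> c \<and>
      (\<forall>g\<in>carrier G. AE y in Y. distr (K (c, y)) M (T g) = K (c, S g y))"
  proof -
    have "AE c in C. \<forall>g\<in>carrier G. AE y in Y. distr (K (c, y)) M (T g) = K (c, S g y)"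
    proof (rule AE_ball_countable'[OF _ G(2)])
      fix g assume "g \<in> carrier G"
      from CY.AE_pair[OF equivariant[OF this]]
      show "AE c in C. AE y in Y. distr (K (c, y)) M (T g) = K (c, S g y)" by simp
    qed
    with marginal show ?thesis by eventually_elim simp
  qed
  \<comment> \<open>Two points are drawn independently given a common \<open>y\<close>. Equivariance
    turns the diagonal action into the substitution \<open>y \<mapsto> S g y\<close>, which
    preserves \<open>Y\<close>.\<close>
  have H: "(Y \<bind> (\<lambda>y. K (c, y) \<Otimes>\<^sub>M K (d, y))) \<in> joinings G (\<kappa> c) T (\<kappa> d) T"
    if c: "c \<in> space C" "Y \<bind> (\<lambda>y. K (c, y)) = \<kappa> c" 
        "\<And>g. g \<in> carrier G \<Longrightarrow> AE y in Y. distr (K (c, y)) M (T g) = K (c, S g y)"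
      and d: "d \<in> space C" "Y \<bind> (\<lambda>y. K (d, y)) = \<kappa> d" 
        "\<And>g. g \<in> carrier G \<Longrightarrow> AE y in Y. distr (K (d, y)) M (T g) = K (d, S g y)"
    for c d
  proof -
    have kc[measurable]: "(\<lambda>y. K (c, y)) \<in> Y \<rightarrow>\<^sub>M prob_algebra M" "(\<lambda>y. K (d, y)) \<in> Y \<rightarrow>\<^sub>M prob_algebra M"
      using c(1) d(1) by measurable
    have m[measurable]: "(\<lambda>y. K (c, y) \<Otimes>\<^sub>M K (d, y)) \<in> Y \<rightarrow>\<^sub>M prob_algebra (M \<Otimes>\<^sub>M M)"
      by measurable
    note m' = measurable_prob_algebraD[OF m]
    have Ysp: "Y \<in> space (prob_algebra Y)" by (simp add: space_prob_algebra Y.prob_space_axioms)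
    let ?H = "Y \<bind> (\<lambda>y. K (c, y) \<Otimes>\<^sub>M K (d, y))"
    have setsH: "sets ?H = sets (M \<Otimes>\<^sub>M M)" by (rule sets_bind'[OF Ysp m])
    have setsk: "sets (\<kappa> c \<Otimes>\<^sub>M \<kappa> d) = sets (M \<Otimes>\<^sub>M M)"
      using \<kappa>D(2)[OF c(1)] \<kappa>D(2)[OF d(1)] by (rule sets_pair_measure_cong)
    have "distr ?H (\<kappa> c) fst = distr ?H M fst"
      using \<kappa>D(2)[OF c(1)] by (intro distr_cong) auto
    also have "\<dots> = Y \<bind> (\<lambda>y. distr (K (c, y) \<Otimes>\<^sub>M K (d, y)) M fst)"
      by (rule distr_bind[OF m' Y.not_empty]) simp
    also have "\<dots> = Y \<bind> (\<lambda>y. K (c, y))"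
    proof (rule bind_cong[OF refl])
      fix y assume y: "y \<in> space Y"
      have "distr (K (c, y) \<Otimes>\<^sub>M K (d, y)) M fst = distr (K (c, y) \<Otimes>\<^sub>M K (d, y)) (K (c, y)) fst"
        using KD(2)[OF c(1) y] by (intro distr_cong) auto
      also have "\<dots> = K (c, y)" by (rule prob_space.distr_pair_fst[OF KD(1)[OF d(1) y]])
      finally show "distr (K (c, y) \<Otimes>\<^sub>M K (d, y)) M fst = K (c, y)" .
    qed
    finally have fst: "distr ?H (\<kappa> c) fst = \<kappa> c" using c(2) by simp
    have "distr ?H (\<kappa> d) snd = distr ?H M snd"
      using \<kappa>D(2)[OF d(1)] by (intro distr_cong) auto
    also have "\<dots> = Y \<bind> (\<lambda>y. distr (K (c, y) \<Otimes>\<^sub>M K (d, y)) M snd)"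
      by (rule distr_bind[OF m' Y.not_empty]) simp
    also have "\<dots> = Y \<bind> (\<lambda>y. K (d, y))"
    proof (rule bind_cong[OF refl])
      fix y assume y: "y \<in> space Y"
      have "distr (K (c, y) \<Otimes>\<^sub>M K (d, y)) M snd = distr (K (c, y) \<Otimes>\<^sub>M K (d, y)) (K (d, y)) snd"
        using KD(2)[OF d(1) y] by (intro distr_cong) auto
      also have "\<dots> = K (d, y)" by (rule distr_pair_snd[OF KD(1)[OF c(1) y] KD(1)[OF d(1) y]])
      finally show "distr (K (c, y) \<Otimes>\<^sub>M K (d, y)) M snd = K (d, y)" .
    qed
    finally have snd: "distr ?H (\<kappa> d) snd = \<kappa> d" using d(2) by simp
    have inv: "distr ?H ?H (map_prod (T g) (T g)) = ?H" if g: "g \<in> carrier G" for g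
    proof -
      have Tg[measurable]: "T g \<in> M \<rightarrow>\<^sub>M M" and Sg[measurable]: "S g \<in> Y \<rightarrow>\<^sub>M Y" using T S g by auto
      have "distr ?H ?H (map_prod (T g) (T g)) = distr ?H (M \<Otimes>\<^sub>M M) (map_prod (T g) (T g))"
        using setsH by (intro distr_cong) auto
      also have "\<dots> = Y \<bind> (\<lambda>y. distr (K (c, y) \<Otimes>\<^sub>M K (d, y)) (M \<Otimes>\<^sub>M M) (map_prod (T g) (T g)))"
        by (rule distr_bind[OF m' Y.not_empty]) (simp add: map_prod_def)
      also have "\<dots> = Y \<bind> (\<lambda>y. K (c, S g y) \<Otimes>\<^sub>M K (d, S g y))"
      proof (rule bind_cong_AE'[OF Ysp])
        show "(\<lambda>y. distr (K (c, y) \<Otimes>\<^sub>M K (d, y)) (M \<Otimes>\<^sub>M M) (map_prod (T g) (T g))) \<in> Y \<rightarrow>\<^sub>M prob_algebra (M \<Otimes>\<^sub>M M)"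
          by (rule measurable_compose[OF m measurable_distr_prob_space]) (simp add: map_prod_def)
        show "(\<lambda>y. K (c, S g y) \<Otimes>\<^sub>M K (d, S g y)) \<in> Y \<rightarrow>\<^sub>M prob_algebra (M \<Otimes>\<^sub>M M)"
          by (rule measurable_compose[OF Sg m])
        show "AE y in Y. distr (K (c, y) \<Otimes>\<^sub>M K (d, y)) (M \<Otimes>\<^sub>M M) (map_prod (T g) (T g)) = K (c, S g y) \<Otimes>\<^sub>M K (d, S g y)"
          using c(3)[OF g] d(3)[OF g] AE_space
        proof eventually_elim
          case (elim y)
          have sK: "sets (K (c, y)) = sets M" "sets (K (d, y)) = sets M" using KD(2) c d elim(3) by auto
          have Tc: "T g \<in> K (c, y) \<rightarrow>\<^sub>M M" "T g \<in> K (d, y) \<rightarrow>\<^sub>M M"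
            using Tg measurable_cong_sets[OF sK(1) refl[of "sets M"]] measurable_cong_sets[OF sK(2) refl[of "sets M"]] by auto
          have "sigma_finite_measure (distr (K (d, y)) M (T g))"
            using prob_space.prob_space_distr[OF KD(1)[OF d(1) elim(3)] Tc(2)] by (rule prob_space_imp_sigma_finite)
          from pair_measure_distr[OF Tc this]
          show ?case by (simp add: elim(1,2) map_prod_def)
        qed
      qed
      also have "\<dots> = distr Y Y (S g) \<bind> (\<lambda>y. K (c, y) \<Otimes>\<^sub>M K (d, y))"
        by (rule bind_distr[symmetric, OF Sg m' Y.not_empty])
      also have "distr Y Y (S g) = Y" using pmpY g by (simp add: pmp_system_def)
      finally show ?thesis .
    qed
    show ?thesis
      unfolding joinings_def using setsH setsk fst snd inv prob_space_bind'[OF Ysp m] by simp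
  qed
  have prod: "AE p in C \<Otimes>\<^sub>M C. Y \<bind> (\<lambda>y. K (fst p, y) \<Otimes>\<^sub>M K (snd p, y)) = \<kappa> (fst p) \<Otimes>\<^sub>M \<kappa> (snd p)"
  proof -
    have 1: "AE p in C \<Otimes>\<^sub>M C. P (fst p)" "AE p in C \<Otimes>\<^sub>M C. P (snd p)" if "AE c in C. P c" for P
    proof -
      have "AE c in distr (C \<Otimes>\<^sub>M C) C fst. P c" unfolding C.distr_pair_fst by (rule that)
      then show "AE p in C \<Otimes>\<^sub>M C. P (fst p)" by (rule AE_distrD[rotated]) simp
      have "AE c in distr (C \<Otimes>\<^sub>M C) C snd. P c" unfolding distr_pair_snd[OF C.prob_space_axioms C.prob_space_axioms] by (rule that)
      then show "AE p in C \<Otimes>\<^sub>M C. P (snd p)" by (rule AE_distrD[rotated]) simp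
    qed
    from disj 1(1)[OF good] 1(2)[OF good] AE_space show ?thesis
    proof eventually_elim
      case (elim p)
      have "(Y \<bind> (\<lambda>y. K (fst p, y) \<Otimes>\<^sub>M K (snd p, y))) \<in> joinings G (\<kappa> (fst p)) T (\<kappa> (snd p)) T"
        using elim by (intro H) (auto simp: space_pair_measure)
      then show ?case using elim(1) by (simp add: disjoint_systems_def)
    qed
  qed
  have main: "emeasure J (B \<times> A) = emeasure M B * emeasure Y A"
    if B[measurable]: "B \<in> sets M" and A[measurable]: "A \<in> sets Y" for A B
  proof -
    \<comment> \<open>\<open>p y\<close> is the conditional probability of \<open>B\<close> given
      \<open>y\<close> under \<open>J\<close>; \<open>J\<close> is a product on \<open>B\<close>
      once \<open>p\<close> is almost everywhere constant.\<close>
    define p where "p y = (\<integral>\<^sup>+c. emeasure (K (c, y)) B \<partial>C)" for y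
    have [measurable]: "p \<in> borel_measurable Y" unfolding p_def by measurable
    have JB: "emeasure J (B \<times> A) = (\<integral>\<^sup>+y. indicator A y * p y \<partial>Y)" if A[measurable]: "A \<in> sets Y" for A
    proof -
      have "B \<times> A = {q\<in>space J. (\<pi> (fst q), snd q) \<in> space C \<times> A \<and> fst q \<in> B}"
        using sets.sets_into_space[OF A] sets.sets_into_space[OF B] measurable_space[OF \<pi>] by (auto simp: spJ)
      then have "emeasure J (B \<times> A) = (\<integral>\<^sup>+w. indicator (space C \<times> A) w * emeasure (K w) B \<partial>(C \<Otimes>\<^sub>M Y))"
        using KJ[of "space C \<times> A" B] by simp
      also have "\<dots> = (\<integral>\<^sup>+y. \<integral>\<^sup>+c. indicator (space C \<times> A) (c, y) * emeasure (K (c, y)) B \<partial>C \<partial>Y)"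
        by (subst CY.nn_integral_snd[symmetric]) auto
      also have "\<dots> = (\<integral>\<^sup>+y. \<integral>\<^sup>+c. indicator A y * emeasure (K (c, y)) B \<partial>C \<partial>Y)"
        by (intro nn_integral_cong) (auto simp: indicator_def)
      also have "\<dots> = (\<integral>\<^sup>+y. indicator A y * p y \<partial>Y)"
        unfolding p_def by (intro nn_integral_cong nn_integral_cmult) auto
      finally show ?thesis .
    qed
    have p1: "p y \<le> 1" if "y \<in> space Y" for y
    proof -
      have "p y \<le> (\<integral>\<^sup>+c. 1 \<partial>C)"
        unfolding p_def using KD(1)[OF _ that]
        by (intro nn_integral_mono) (simp add: subprob_space.subprob_emeasure_le_1[OF prob_space_imp_subprob_space])
      then show ?thesis by (simp add: C.emeasure_space_1)
    qed
    have ip: "(\<integral>\<^sup>+y. p y \<partial>Y) = emeasure M B"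
    proof -
      have "(\<integral>\<^sup>+y. p y \<partial>Y) = emeasure J (B \<times> space Y)"
        by (subst JB) (auto intro!: nn_integral_cong)
      also have "B \<times> space Y = {q\<in>space J. fst q \<in> B}" using sets.sets_into_space[OF B] by (auto simp: spJ)
      finally show ?thesis by (simp add: emeasure_J_fst)
    qed
    \<comment> \<open>The square is an integral over two independent components. Fubini brings the
      integral over \<open>y\<close> inside, where \<open>prod\<close> evaluates it for almost every
      pair.\<close>
    have ip2: "(\<integral>\<^sup>+y. p y * p y \<partial>Y) = emeasure M B * emeasure M B"
    proof -
      have "(\<integral>\<^sup>+y. p y * p y \<partial>Y) = (\<integral>\<^sup>+y. \<integral>\<^sup>+q. emeasure (K (fst q, y)) B * emeasure (K (snd q, y)) B \<partial>(C \<Otimes>\<^sub>M C) \<partial>Y)"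
      proof (intro nn_integral_cong)
        fix y assume y[measurable]: "y \<in> space Y"
        have "(\<integral>\<^sup>+q. emeasure (K (fst q, y)) B * emeasure (K (snd q, y)) B \<partial>(C \<Otimes>\<^sub>M C)) =
          (\<integral>\<^sup>+c. \<integral>\<^sup>+d. emeasure (K (c, y)) B * emeasure (K (d, y)) B \<partial>C \<partial>C)"
          by (subst C.nn_integral_fst[symmetric]) auto
        also have "\<dots> = (\<integral>\<^sup>+c. emeasure (K (c, y)) B * p y \<partial>C)"
          unfolding p_def by (intro nn_integral_cong nn_integral_cmult) measurable
        also have "\<dots> = p y * p y"
          unfolding p_def by (rule nn_integral_multc) measurable
        finally show "p y * p y = (\<integral>\<^sup>+q. emeasure (K (fst q, y)) B * emeasure (K (snd q, y)) B \<partial>(C \<Otimes>\<^sub>M C))" ..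
      qed
      also have "\<dots> = (\<integral>\<^sup>+q. \<integral>\<^sup>+y. emeasure (K (fst q, y)) B * emeasure (K (snd q, y)) B \<partial>Y \<partial>(C \<Otimes>\<^sub>M C))"
      proof -
        interpret P: pair_sigma_finite "C \<Otimes>\<^sub>M C" Y ..
        show ?thesis by (rule P.Fubini') measurable
      qed
      also have "\<dots> = (\<integral>\<^sup>+q. emeasure (\<kappa> (fst q)) B * emeasure (\<kappa> (snd q)) B \<partial>(C \<Otimes>\<^sub>M C))"
      proof (rule nn_integral_cong_AE)
        show "AE q in C \<Otimes>\<^sub>M C. (\<integral>\<^sup>+y. emeasure (K (fst q, y)) B * emeasure (K (snd q, y)) B \<partial>Y) =
            emeasure (\<kappa> (fst q)) B * emeasure (\<kappa> (snd q)) B"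
          using prod AE_space
        proof eventually_elim
          case (elim q)
          then have c: "fst q \<in> space C" and d: "snd q \<in> space C" by (auto simp: space_pair_measure)
          have m: "(\<lambda>y. K (fst q, y) \<Otimes>\<^sub>M K (snd q, y)) \<in> Y \<rightarrow>\<^sub>M prob_algebra (M \<Otimes>\<^sub>M M)"
            using c d by measurable
          have "emeasure (\<kappa> (fst q)) B * emeasure (\<kappa> (snd q)) B = emeasure (\<kappa> (fst q) \<Otimes>\<^sub>M \<kappa> (snd q)) (B \<times> B)"
            using \<kappa>D(2)[OF c] \<kappa>D(2)[OF d] B
            by (intro sigma_finite_measure.emeasure_pair_measure_Times[symmetric] prob_space_imp_sigma_finite \<kappa>D(1) d) auto
          also have "\<dots> = emeasure (Y \<bind> (\<lambda>y. K (fst q, y) \<Otimes>\<^sub>M K (snd q, y))) (B \<times> B)"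
            by (simp add: elim(1))
          also have "\<dots> = (\<integral>\<^sup>+y. emeasure (K (fst q, y) \<Otimes>\<^sub>M K (snd q, y)) (B \<times> B) \<partial>Y)"
            by (rule emeasure_bind[OF Y.not_empty measurable_prob_algebraD[OF m]]) simp
          also have "\<dots> = (\<integral>\<^sup>+y. emeasure (K (fst q, y)) B * emeasure (K (snd q, y)) B \<partial>Y)"
            using KD(1,2) c d B
            by (intro nn_integral_cong sigma_finite_measure.emeasure_pair_measure_Times prob_space_imp_sigma_finite) auto
          finally show ?case ..
        qed
      qed
      also have "\<dots> = (\<integral>\<^sup>+c. \<integral>\<^sup>+d. emeasure (\<kappa> c) B * emeasure (\<kappa> d) B \<partial>C \<partial>C)"
        by (subst C.nn_integral_fst[symmetric]) auto
      also have "\<dots> = (\<integral>\<^sup>+c. emeasure (\<kappa> c) B * emeasure M B \<partial>C)"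
        unfolding emeasure_M[OF B] by (intro nn_integral_cong nn_integral_cmult) measurable
      also have "\<dots> = emeasure M B * emeasure M B"
        unfolding emeasure_M[OF B] by (rule nn_integral_multc) measurable
      finally show ?thesis .
    qed
    define m where "m = measure M B"
    define r where "r y = enn2real (p y)" for y
    have [measurable]: "r \<in> borel_measurable Y" unfolding r_def by measurable
    have pr: "p y = ennreal (r y)" "0 \<le> r y" "r y \<le> 1" if "y \<in> space Y" for y
    proof -
      have "p y \<noteq> \<top>" using p1[OF that] by (auto simp: top_unique)
      then show "p y = ennreal (r y)" by (simp add: r_def less_top[symmetric])
    qed (use p1[OF that] in \<open>auto simp: r_def intro!: enn2real_leI\<close>)
    have mr: "emeasure M B = ennreal m" "0 \<le> m" by (auto simp: m_def M.emeasure_eq_measure)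
    have int: "integrable Y r" "integrable Y (\<lambda>y. r y * r y)"
      using pr by (auto intro!: Y.integrable_const_bound[of _ 1] AE_I2 simp: abs_mult mult_le_one)
    have "ennreal (\<integral>y. r y \<partial>Y) = ennreal m"
      using ip pr int by (subst nn_integral_eq_integral[symmetric]) (auto simp: mr cong: nn_integral_cong)
    then have e1: "(\<integral>y. r y \<partial>Y) = m"
      using mr pr by (subst (asm) ennreal_inj) (auto intro!: integral_nonneg_AE AE_I2)
    have "ennreal (\<integral>y. r y * r y \<partial>Y) = (\<integral>\<^sup>+y. p y * p y \<partial>Y)"
      using pr int by (subst nn_integral_eq_integral[symmetric]) (auto simp: ennreal_mult intro!: nn_integral_cong AE_I2)
    also have "\<dots> = ennreal (m * m)" by (simp add: ip2 mr ennreal_mult)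
    finally have e2: "(\<integral>y. r y * r y \<partial>Y) = m * m"
      using mr pr by (subst (asm) ennreal_inj) (auto intro!: integral_nonneg_AE AE_I2)
    have "(\<integral>y. (r y - m)\<^sup>2 \<partial>Y) = (\<integral>y. r y * r y - 2 * m * r y + m * m \<partial>Y)"
      by (intro Bochner_Integration.integral_cong) (auto simp: power2_eq_square algebra_simps)
    also have "\<dots> = 0" using int by (simp add: e1 e2 Y.prob_space)
    finally have "AE y in Y. (r y - m)\<^sup>2 = 0"
    proof (subst (asm) integral_nonneg_eq_0_iff_AE)
      have "integrable Y (\<lambda>y. r y * r y - 2 * m * r y + m * m)" using int by simp
      then show "integrable Y (\<lambda>y. (r y - m)\<^sup>2)"
        by (simp add: power2_eq_square algebra_simps)
    qed auto
    then have "AE y in Y. p y = emeasure M B"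
      using AE_space by eventually_elim (simp add: pr mr)
    then have "emeasure J (B \<times> A) = (\<integral>\<^sup>+y. indicator A y * emeasure M B \<partial>Y)"
      unfolding JB[OF A] by (intro nn_integral_cong_AE) (auto elim!: eventually_mono)
    also have "\<dots> = emeasure M B * emeasure Y A"
      by (subst nn_integral_multc) (auto simp: mult.commute)
    finally show ?thesis .
  qed
  show ?thesis
    by (rule pair_measure_eqI[symmetric])
      (use main joiningsD(2)[OF J] in \<open>auto simp: M.sigma_finite_measure_axioms Y.sigma_finite_measure_axioms\<close>)
qed

end

section \<open>Compactness of joinings\<close>

abbreviation bit_space :: "('i \<Rightarrow> bool) measure" where
  "bit_space \<equiv> Pi\<^sub>M UNIV (\<lambda>_. count_space UNIV)"

lemma space_bit_space: "space (bit_space :: ('i \<Rightarrow> bool) measure) = UNIV"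
  by (simp add: space_PiM)

text \<open>Events requiring finitely many bits to be true are closed under intersection, and they
  generate because the complement of a single-bit event prescribes a false bit.\<close>

lemma bit_space_eqI:
  fixes P Q :: "('i \<Rightarrow> bool) measure"
  assumes P: "prob_space P" and sets: "sets P = sets bit_space" "sets Q = sets bit_space"
    and eq: "\<And>I. finite I \<Longrightarrow> emeasure P {z. \<forall>i\<in>I. z i} = emeasure Q {z. \<forall>i\<in>I. z i}"
  shows "P = Q"
proof -
  interpret P: prob_space P by (rule P)
  define E :: "('i \<Rightarrow> bool) set set" where "E = (\<lambda>I. {z. \<forall>i\<in>I. z i}) ` {I. finite I}"
  have sing: "{z. z i} \<in> E" for i unfolding E_def by (rule image_eqI[of _ _ "{i}"]) auto
  have UN: "UNIV \<in> E" unfolding E_def by (rule image_eqI[of _ _ "{}"]) auto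
  interpret E: sigma_algebra UNIV "sigma_sets UNIV E" by (rule sigma_algebra_sigma_sets) simp
  have "sets (bit_space :: ('i \<Rightarrow> bool) measure) = sigma_sets UNIV E"
  proof
    show "sigma_sets UNIV E \<subseteq> sets (bit_space :: ('i \<Rightarrow> bool) measure)"
    proof (rule sets.sigma_sets_subset'[of _ "bit_space :: ('i \<Rightarrow> bool) measure", unfolded space_bit_space])
      show "E \<subseteq> sets bit_space"
      proof
        fix A assume "A \<in> E"
        then obtain I where I: "finite I" "A = {z. \<forall>i\<in>I. z i}" by (auto simp: E_def)
        have "{z\<in>space bit_space. \<forall>i\<in>I. z i} \<in> sets (bit_space :: ('i \<Rightarrow> bool) measure)"
          using I(1) by measurable
        then show "A \<in> sets bit_space" by (simp add: I space_bit_space)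
      qed
      show "UNIV \<in> sets (bit_space :: ('i \<Rightarrow> bool) measure)"
        using sets.top[of "bit_space :: ('i \<Rightarrow> bool) measure"] by (simp only: space_bit_space)
    qed
    have "{z. z i \<in> A} \<in> sigma_sets UNIV E" for i A
    proof -
      have s: "{z. z i} \<in> sigma_sets UNIV E" using sing by (rule sigma_sets.Basic)
      have "{z. z i \<in> A} = (if True \<in> A then {z. z i} else {}) \<union> (if False \<in> A then UNIV - {z. z i} else {})"
      proof (rule Set.set_eqI)
        fix z :: "'i \<Rightarrow> bool"
        show "z \<in> {z. z i \<in> A} \<longleftrightarrow> z \<in> (if True \<in> A then {z. z i} else {}) \<union> (if False \<in> A then UNIV - {z. z i} else {})"
          by (cases "z i") auto
      qed
      also have "\<dots> \<in> sigma_sets UNIV E" using s by auto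
      finally show ?thesis .
    qed
    then show "sets bit_space \<subseteq> sigma_sets UNIV E"
      by (simp add: sets_PiM_single PiE_UNIV_domain) (intro sigma_sets_mono, auto)
  qed
  note sE = this
  show ?thesis
  proof (rule measure_eqI_generator_eq[where E=E and \<Omega>=UNIV and A="\<lambda>_. UNIV"])
    show "Int_stable E"
    proof (rule Int_stableI)
      fix a b assume "a \<in> E" "b \<in> E"
      then obtain I I' where "finite I" "a = {z. \<forall>i\<in>I. z i}" "finite I'" "b = {z. \<forall>i\<in>I'. z i}"
        unfolding E_def by auto
      then show "a \<inter> b \<in> E"
        unfolding E_def by (intro image_eqI[of _ _ "I \<union> I'"]) auto
    qed
  qed (use sets sE UN eq in \<open>auto simp: E_def\<close>)
qed

section \<open>Symbolic coding of a system\<close>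

locale standard_system = standard_model M f f' X0
  for M :: "'a measure" and f f' X0 +
  fixes G :: "('g, 'k) monoid_scheme" and T :: "'g \<Rightarrow> 'a \<Rightarrow> 'a"
  assumes G: "group G" "countable (carrier G)" and pmp: "pmp_system G M T"
begin

lemma T[measurable]: "g \<in> carrier G \<Longrightarrow> T g \<in> M \<rightarrow>\<^sub>M M"
  using pmp by (simp add: pmp_system_def)

text \<open>Indexing bits through \<open>nat\<close> gives a countable index type whatever the type
  of group elements; the enumeration repeats elements when the group is finite.\<close>

definition \<gamma> :: "nat \<Rightarrow> 'g" where "\<gamma> = from_nat_into (carrier G)"

lemma carrier_ne: "carrier G \<noteq> {}"
  using monoid.one_closed[OF group.is_monoid[OF G(1)]] by auto

lemma \<gamma>[simp]: "\<gamma> n \<in> carrier G"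
  unfolding \<gamma>_def by (rule from_nat_into[OF carrier_ne])

lemma \<gamma>_surj: "g \<in> carrier G \<Longrightarrow> \<exists>n. \<gamma> n = g"
  unfolding \<gamma>_def by (rule from_nat_into_surj[OF G(2)])

text \<open>Each point is coded by the bits \<open>f (T g x) \<le> q\<close> with \<open>g\<close> in the group and \<open>q\<close> rational,
  so that the group acts on the codes by permuting the bits.\<close>

definition point_bit :: "nat \<times> rat \<Rightarrow> 'a \<Rightarrow> bool" where
  "point_bit i x \<longleftrightarrow> f (T (\<gamma> (fst i)) x) \<le> of_rat (snd i)"

lemma point_bit_measurable[measurable]: "Measurable.pred M (point_bit i)"
proof -
  have [measurable]: "T (\<gamma> (fst i)) \<in> M \<rightarrow>\<^sub>M M" by (rule T) simp
  show ?thesis unfolding point_bit_def by measurable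
qed

text \<open>Lists instead of finite sets, so that the cylinders are enumerated by
  \<open>from_nat\<close>.\<close>

definition cyl :: "(nat \<times> rat) list \<Rightarrow> 'a set" where
  "cyl l = {x\<in>space M. \<forall>i\<in>set l. point_bit i x}"

lemma cyl_measurable[measurable]: "cyl l \<in> sets M"
  unfolding cyl_def by measurable

lemma cyl_subset: "cyl l \<subseteq> space M" by (auto simp: cyl_def)

lemma cyl_Nil: "cyl [] = space M" by (simp add: cyl_def)

definition one_index :: nat where "one_index = (SOME n. \<gamma> n = \<one>\<^bsub>G\<^esub>)"

lemma \<gamma>_one_index: "\<gamma> one_index = \<one>\<^bsub>G\<^esub>"
  unfolding one_index_def by (rule someI_ex[OF \<gamma>_surj]) (simp add: G(1) group.is_monoid monoid.one_closed)

lemma point_bit_one_index: "x \<in> space M \<Longrightarrow> point_bit (one_index, q) x \<longleftrightarrow> f x \<le> of_rat q"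
  by (simp add: point_bit_def \<gamma>_one_index pmp_systemD(5)[OF pmp G(1)])

text \<open>Translation by \<open>g\<close> multiplies the group element in each index by
  \<open>g\<close> on the right, so cylinders pull back to cylinders and invariance of a measure can
  be checked on them.\<close>

lemma cyl_translate:
  assumes g: "g \<in> carrier G"
  obtains l' where "\<And>x. x \<in> space M \<Longrightarrow> T g x \<in> cyl l \<longleftrightarrow> x \<in> cyl l'"
proof -
  interpret group G by (rule G)
  have "\<forall>n. \<exists>m. \<gamma> m = \<gamma> n \<otimes>\<^bsub>G\<^esub> g" using \<gamma>_surj g by auto
  then obtain \<sigma> where \<sigma>: "\<And>n. \<gamma> (\<sigma> n) = \<gamma> n \<otimes>\<^bsub>G\<^esub> g" by metis
  show thesis
  proof (rule that[of "map (\<lambda>i. (\<sigma> (fst i), snd i)) l"])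
    fix x assume x: "x \<in> space M"
    have "point_bit i (T g x) \<longleftrightarrow> point_bit (\<sigma> (fst i), snd i) x" for i
      using pmp_systemD(4)[OF pmp G(1) \<gamma> g x] by (simp add: point_bit_def \<sigma>)
    then show "T g x \<in> cyl l \<longleftrightarrow> x \<in> cyl (map (\<lambda>i. (\<sigma> (fst i), snd i)) l)"
      using measurable_space[OF T[OF g] x] x by (auto simp: cyl_def)
  qed
qed

text \<open>The bits at the identity tell which rational half-lines contain \<open>f x\<close>, and
  the infimum of their endpoints is \<open>f x\<close>. The bounds 0 and 1 keep the infimum in the
  unit interval even for bits that code no point.\<close>

definition decode :: "(nat \<times> rat \<Rightarrow> bool) \<Rightarrow> 'a" where
  "decode z = f' (INF q\<in>(UNIV::rat set). if z (one_index, q) then max 0 (of_rat q) else 1)"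

lemma decode_measurable[measurable]: "decode \<in> bit_space \<rightarrow>\<^sub>M M"
proof -
  have "(\<lambda>z. INF q\<in>(UNIV::rat set). if z (one_index, q) then max 0 (of_rat q) else 1 :: real) \<in> borel_measurable bit_space"
  proof (rule borel_measurable_cINF)
    show "(\<lambda>z. if z (one_index, q) then max 0 (of_rat q) else 1 :: real) \<in> borel_measurable bit_space" for q
      by measurable
    show "bdd_below (range (\<lambda>q. if z (one_index, q) then max 0 (of_rat q) else 1 :: real))" for z :: "nat \<times> rat \<Rightarrow> bool"
      by (rule bdd_belowI[of _ 0]) auto
  qed simp
  then show ?thesis unfolding decode_def by measurable
qed

lemma X0_space: "x \<in> X0 \<Longrightarrow> x \<in> space M"
  using sets.sets_into_space[OF X0] by auto

lemma decode_point_bit: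
  assumes x: "x \<in> X0"
  shows "decode (\<lambda>i. point_bit i x) = x"
proof -
  note xs = X0_space[OF x]
  have "(INF q\<in>(UNIV::rat set). if point_bit (one_index, q) x then max 0 (of_rat q) else 1 :: real) = f x"
  proof (rule cInf_eq_non_empty)
    fix y assume "y \<in> range (\<lambda>q. if point_bit (one_index, q) x then max 0 (of_rat q) else 1 :: real)"
    then show "f x \<le> y" using f01[OF xs] by (auto simp: point_bit_one_index[OF xs] split: if_splits)
  next
    fix y assume y: "\<And>z. z \<in> range (\<lambda>q. if point_bit (one_index, q) x then max 0 (of_rat q) else 1 :: real) \<Longrightarrow> y \<le> z"
    show "y \<le> f x"
    proof (rule ccontr)
      assume "\<not> y \<le> f x"
      then obtain q where q: "f x < of_rat q" "of_rat q < y" by (meson of_rat_dense not_le)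
      then have "y \<le> max 0 (of_rat q)"
        using y[of "max 0 (of_rat q)"] point_bit_one_index[OF xs, of q] by (auto intro!: range_eqI[of _ _ q])
      with q f01[OF xs] show False by auto
    qed
  qed auto
  then show ?thesis by (simp add: decode_def f'f[OF x])
qed

lemma measurable_point_bits[measurable]: "(\<lambda>x i. point_bit i x) \<in> M \<rightarrow>\<^sub>M bit_space"
  by (rule measurable_PiM_single') (auto simp: space_PiM)

text \<open>Both points are coded together, a sum type separating their bits. The coding is inverted
  on \<open>X0 \<times> X0\<close>, and \<open>bit_space_eqI\<close> reduces equality of the laws of
  codes to cylinders.\<close>

lemma pair_measure_eqI_cyl:
  assumes J: "prob_space J" and sets: "sets J = sets (M \<Otimes>\<^sub>M M)" "sets J' = sets (M \<Otimes>\<^sub>M M)"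
    and X0: "AE p in J. fst p \<in> X0 \<and> snd p \<in> X0" "AE p in J'. fst p \<in> X0 \<and> snd p \<in> X0"
    and eq: "\<And>l l'. emeasure J (cyl l \<times> cyl l') = emeasure J' (cyl l \<times> cyl l')"
  shows "J = J'"
proof -
  define b :: "'a \<times> 'a \<Rightarrow> (nat \<times> rat) + (nat \<times> rat) \<Rightarrow> bool" where
    "b p = case_sum (\<lambda>i. point_bit i (fst p)) (\<lambda>i. point_bit i (snd p))" for p
  define r :: "((nat \<times> rat) + (nat \<times> rat) \<Rightarrow> bool) \<Rightarrow> 'a \<times> 'a" where
    "r z = (decode (\<lambda>i. z (Inl i)), decode (\<lambda>i. z (Inr i)))" for z
  have b[measurable]: "b \<in> M \<Otimes>\<^sub>M M \<rightarrow>\<^sub>M bit_space"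
    by (rule measurable_PiM_single') (auto simp: b_def space_PiM split: sum.split)
  have [measurable]: "(\<lambda>z i. z (Inl i)) \<in> bit_space \<rightarrow>\<^sub>M bit_space"
      "(\<lambda>z i. z (Inr i)) \<in> bit_space \<rightarrow>\<^sub>M bit_space"
    by (rule measurable_PiM_single'; simp add: space_PiM)+
  have r[measurable]: "r \<in> bit_space \<rightarrow>\<^sub>M M \<Otimes>\<^sub>M M"
    unfolding r_def by measurable
  have recover: "distr (distr L bit_space b) (M \<Otimes>\<^sub>M M) r = L"
    if s: "sets L = sets (M \<Otimes>\<^sub>M M)" and "AE p in L. fst p \<in> X0 \<and> snd p \<in> X0" for L
  proof -
    have b': "b \<in> L \<rightarrow>\<^sub>M bit_space" unfolding measurable_cong_sets[OF s refl] by (rule b)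
    have "distr (distr L bit_space b) (M \<Otimes>\<^sub>M M) r = distr L (M \<Otimes>\<^sub>M M) (\<lambda>p. r (b p))"
      using b' by (subst distr_distr) (auto simp: comp_def)
    also have "\<dots> = distr L (M \<Otimes>\<^sub>M M) (\<lambda>p. p)"
    proof (rule distr_cong_AE)
      show "AE p in L. r (b p) = p"
        using that(2) by eventually_elim (simp add: r_def b_def decode_point_bit)
      show "(\<lambda>p. r (b p)) \<in> L \<rightarrow>\<^sub>M M \<Otimes>\<^sub>M M" by (rule measurable_compose[OF b' r])
    qed (simp_all add: measurable_ident_sets s)
    finally show ?thesis using s by (simp add: distr_id2)
  qed
  have "distr J bit_space b = distr J' bit_space b"
  proof (rule bit_space_eqI)
    have bJ: "b \<in> J \<rightarrow>\<^sub>M bit_space" "b \<in> J' \<rightarrow>\<^sub>M bit_space"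
      unfolding measurable_cong_sets[OF sets(1) refl] measurable_cong_sets[OF sets(2) refl] by (rule b)+
    then show "prob_space (distr J bit_space b)" using J by (intro prob_space.prob_space_distr)
    fix I :: "((nat \<times> rat) + (nat \<times> rat)) set" assume I: "finite I"
    obtain l l' where l: "set l = Inl -` I" "set l' = Inr -` I"
      using finite_list[OF finite_vimageI[OF I, of Inl]] finite_list[OF finite_vimageI[OF I, of Inr]] by auto
    have sp: "space J = space M \<times> space M" "space J' = space M \<times> space M"
      using sets by (auto dest!: sets_eq_imp_space_eq simp: space_pair_measure)
    have "{z\<in>space bit_space. \<forall>i\<in>I. z i} \<in> sets (bit_space :: ((nat \<times> rat) + (nat \<times> rat) \<Rightarrow> bool) measure)"
      using I by measurable
    then have mI: "{z. \<forall>i\<in>I. z i} \<in> sets (bit_space :: ((nat \<times> rat) + (nat \<times> rat) \<Rightarrow> bool) measure)"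
      by (simp add: space_bit_space)
    have vim: "b -` {z. \<forall>i\<in>I. z i} \<inter> space M \<times> space M = cyl l \<times> cyl l'"
      unfolding cyl_def l b_def
      by (auto split: sum.splits)
    show "emeasure (distr J bit_space b) {z. \<forall>i\<in>I. z i} = emeasure (distr J' bit_space b) {z. \<forall>i\<in>I. z i}"
      unfolding emeasure_distr[OF bJ(1) mI] emeasure_distr[OF bJ(2) mI] sp vim by (rule eq)
  qed simp_all
  then show ?thesis
    using recover[OF sets(1) X0(1)] recover[OF sets(2) X0(2)] by metis
qed


text \<open>The \<open>J k\<close> need the right marginals only in the limit, which is what
  approximate joinings provide. A limit of codes need not code a pair of points, but convergence of
  the marginals gives each half of the limit code the law of codes of genuine points, so it can be
  decoded almost surely. Invariance is inherited because cylinders are translated to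
  cylinders.\<close>

lemma invariant_pairs_limit:
  assumes \<mu>: "pmp_system G \<mu> T" "sets \<mu> = sets M" "AE x in \<mu>. x \<in> X0"
    and \<nu>: "pmp_system G \<nu> T" "sets \<nu> = sets M" "AE x in \<nu>. x \<in> X0"
    and J: "\<And>k. prob_space (J k)" "\<And>k. sets (J k) = sets (M \<Otimes>\<^sub>M M)"
    and J_inv: "\<And>k g. g \<in> carrier G \<Longrightarrow> distr (J k) (J k) (map_prod (T g) (T g)) = J k"
    and lim1: "\<And>l. (\<lambda>k. measure (J k) (cyl l \<times> space M)) \<longlonglongrightarrow> measure \<mu> (cyl l)"
    and lim2: "\<And>l. (\<lambda>k. measure (J k) (space M \<times> cyl l)) \<longlonglongrightarrow> measure \<nu> (cyl l)"
  obtains s L where "strict_mono (s :: nat \<Rightarrow> nat)" "L \<in> joinings G \<mu> T \<nu> T"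
    "\<And>l l'. (\<lambda>k. measure (J (s k)) (cyl l \<times> cyl l')) \<longlonglongrightarrow> measure L (cyl l \<times> cyl l')"
proof -
  define b :: "(nat \<times> rat) + (nat \<times> rat) \<Rightarrow> 'a \<times> 'a \<Rightarrow> bool" where
    "b i p = case_sum (\<lambda>i. point_bit i (fst p)) (\<lambda>i. point_bit i (snd p)) i" for i p
  have spJ: "space (J k) = space M \<times> space M" for k
    using sets_eq_imp_space_eq[OF J(2)] by (simp add: space_pair_measure)
  have b: "Measurable.pred (J k) (b i)" for k i
    unfolding measurable_cong_sets[OF J(2) refl] by (cases i) (simp_all add: b_def[abs_def])
  obtain s \<rho> D where s: "strict_mono (s :: nat \<Rightarrow> nat)" and \<rho>: "prob_space \<rho>" and s\<rho>: "sets \<rho> = sets (borel :: real measure)"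
    and D: "\<And>i. Measurable.pred borel (D i)"
    and lim: "\<And>I. finite I \<Longrightarrow> (\<lambda>k. measure (J (s k)) {x \<in> space (J (s k)). \<forall>i\<in>I. b i x})
        \<longlonglongrightarrow> measure \<rho> {t. \<forall>i\<in>I. D i t}"
    by (rule bits_convergent_subsequence[of J b, OF J(1) b]) blast
  interpret \<rho>: prob_space \<rho> by (rule \<rho>)
  have sp\<rho>: "space \<rho> = UNIV" using sets_eq_imp_space_eq[OF s\<rho>] by simp
  have D\<rho>[measurable]: "Measurable.pred \<rho> (D i)" for i
    unfolding measurable_cong_sets[OF s\<rho> refl] by (rule D)
  define DL where "DL t i = D (Inl i) t" for t i
  define DR where "DR t i = D (Inr i) t" for t i
  have DLR[measurable]: "DL \<in> \<rho> \<rightarrow>\<^sub>M bit_space" "DR \<in> \<rho> \<rightarrow>\<^sub>M bit_space"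
    by (rule measurable_PiM_single'; simp add: space_PiM DL_def DR_def)+
  have lim_cyl: "(\<lambda>k. measure (J (s k)) (cyl l \<times> cyl l')) \<longlonglongrightarrow>
      measure \<rho> {t. (\<forall>i\<in>set l. DL t i) \<and> (\<forall>i\<in>set l'. DR t i)}" for l l'
  proof -
    have "{x \<in> space (J (s k)). \<forall>i\<in>Inl ` set l \<union> Inr ` set l'. b i x} = cyl l \<times> cyl l'" for k
      by (auto simp: spJ cyl_def b_def ball_Un)
    moreover have "{t. \<forall>i\<in>Inl ` set l \<union> Inr ` set l'. D i t} = {t. (\<forall>i\<in>set l. DL t i) \<and> (\<forall>i\<in>set l'. DR t i)}"
      by (auto simp: DL_def DR_def)
    ultimately show ?thesis
      using lim[of "Inl ` set l \<union> Inr ` set l'"] by simp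
  qed
  have law: "distr \<rho> bit_space d = distr \<xi> bit_space (\<lambda>x i. point_bit i x)"
    if \<xi>: "prob_space \<xi>" "sets \<xi> = sets M" and d: "d \<in> \<rho> \<rightarrow>\<^sub>M bit_space"
      and eq: "\<And>l. measure \<rho> {t. \<forall>i\<in>set l. d t i} = measure \<xi> (cyl l)" for \<xi> d
  proof (rule bit_space_eqI)
    have c: "(\<lambda>x i. point_bit i x) \<in> \<xi> \<rightarrow>\<^sub>M bit_space"
      unfolding measurable_cong_sets[OF \<xi>(2) refl] by simp
    interpret \<xi>: prob_space \<xi> by (rule \<xi>)
    show "prob_space (distr \<rho> bit_space d)" by (rule \<rho>.prob_space_distr[OF d])
    fix I :: "(nat \<times> rat) set" assume I: "finite I"
    then obtain l where l: "set l = I" using finite_list by auto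
    have "{z\<in>space bit_space. \<forall>i\<in>I. z i} \<in> sets (bit_space :: (nat \<times> rat \<Rightarrow> bool) measure)"
      using I by measurable
    then have mI: "{z. \<forall>i\<in>I. z i} \<in> sets (bit_space :: (nat \<times> rat \<Rightarrow> bool) measure)"
      by (simp add: space_bit_space)
    have "emeasure (distr \<rho> bit_space d) {z. \<forall>i\<in>I. z i} = emeasure \<rho> {t. \<forall>i\<in>set l. d t i}"
      using d mI by (simp add: emeasure_distr sp\<rho> l vimage_def)
    also have "\<dots> = emeasure \<xi> (cyl l)" using eq[of l] by (simp add: \<rho>.emeasure_eq_measure \<xi>.emeasure_eq_measure)
    also have "cyl l = (\<lambda>x i. point_bit i x) -` {z. \<forall>i\<in>I. z i} \<inter> space \<xi>"
      using sets_eq_imp_space_eq[OF \<xi>(2)] by (auto simp: cyl_def l)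
    also have "emeasure \<xi> \<dots> = emeasure (distr \<xi> bit_space (\<lambda>x i. point_bit i x)) {z. \<forall>i\<in>I. z i}"
      using c mI by (simp add: emeasure_distr)
    finally show "emeasure (distr \<rho> bit_space d) {z. \<forall>i\<in>I. z i} =
      emeasure (distr \<xi> bit_space (\<lambda>x i. point_bit i x)) {z. \<forall>i\<in>I. z i}" .
  qed simp_all
  have pmp_space: "prob_space \<xi>" if "pmp_system G \<xi> T" for \<xi> using that by (simp add: pmp_system_def)
  have law_L: "distr \<rho> bit_space DL = distr \<mu> bit_space (\<lambda>x i. point_bit i x)"
  proof (rule law[OF pmp_space[OF \<mu>(1)] \<mu>(2) DLR(1)])
    fix l
    have "(\<lambda>k. measure (J (s k)) (cyl l \<times> space M)) \<longlonglongrightarrow> measure \<rho> {t. \<forall>i\<in>set l. DL t i}"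
      using lim_cyl[of l "[]"] by (simp add: cyl_Nil)
    moreover have "(\<lambda>k. measure (J (s k)) (cyl l \<times> space M)) \<longlonglongrightarrow> measure \<mu> (cyl l)"
      using LIMSEQ_subseq_LIMSEQ[OF lim1[of l] s] by (simp add: comp_def)
    ultimately show "measure \<rho> {t. \<forall>i\<in>set l. DL t i} = measure \<mu> (cyl l)" by (rule LIMSEQ_unique)
  qed
  have law_R: "distr \<rho> bit_space DR = distr \<nu> bit_space (\<lambda>x i. point_bit i x)"
  proof (rule law[OF pmp_space[OF \<nu>(1)] \<nu>(2) DLR(2)])
    fix l
    have "(\<lambda>k. measure (J (s k)) (space M \<times> cyl l)) \<longlonglongrightarrow> measure \<rho> {t. \<forall>i\<in>set l. DR t i}"
      using lim_cyl[of "[]" l] by (simp add: cyl_Nil)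
    moreover have "(\<lambda>k. measure (J (s k)) (space M \<times> cyl l)) \<longlonglongrightarrow> measure \<nu> (cyl l)"
      using LIMSEQ_subseq_LIMSEQ[OF lim2[of l] s] by (simp add: comp_def)
    ultimately show "measure \<rho> {t. \<forall>i\<in>set l. DR t i} = measure \<nu> (cyl l)" by (rule LIMSEQ_unique)
  qed
  \<comment> \<open>Being the code of the point it decodes to, with that point in \<open>X0\<close>,
    is a measurable condition on bits. It holds almost surely for codes under \<open>\<xi>\<close>,
    hence for the limit, which has the same law.\<close>
  have code_AE: "AE t in \<rho>. (\<forall>i. d t i = point_bit i (decode (d t))) \<and> decode (d t) \<in> X0"
    and code_law: "distr \<rho> M (\<lambda>t. decode (d t)) = \<xi>"
    if \<xi>: "sets \<xi> = sets M" "AE x in \<xi>. x \<in> X0" and d: "d \<in> \<rho> \<rightarrow>\<^sub>M bit_space"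
      and l: "distr \<rho> bit_space d = distr \<xi> bit_space (\<lambda>x i. point_bit i x)" for \<xi> d
  proof -
    have c: "(\<lambda>x i. point_bit i x) \<in> \<xi> \<rightarrow>\<^sub>M bit_space"
      unfolding measurable_cong_sets[OF \<xi>(1) refl] by simp
    have z[measurable]: "Measurable.pred bit_space (\<lambda>z. z i)" for i :: "nat \<times> rat" by measurable
    have [measurable]: "Measurable.pred bit_space (\<lambda>z. point_bit i (decode z))" for i
      by (rule measurable_compose[OF decode_measurable point_bit_measurable])
    have "Measurable.pred bit_space (\<lambda>z. (\<forall>i. z i = point_bit i (decode z)) \<and> decode z \<in> X0)"
      by measurable
    then have "AE z in distr \<xi> bit_space (\<lambda>x i. point_bit i x). (\<forall>i. z i = point_bit i (decode z)) \<and> decode z \<in> X0"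
      using \<xi>(2) by (subst AE_distr_iff[OF c]) (auto simp: decode_point_bit elim!: eventually_mono)
    then show "AE t in \<rho>. (\<forall>i. d t i = point_bit i (decode (d t))) \<and> decode (d t) \<in> X0"
      unfolding l[symmetric] by (rule AE_distrD[OF d])
    have "distr \<rho> M (\<lambda>t. decode (d t)) = distr (distr \<rho> bit_space d) M decode"
      using d by (subst distr_distr) (auto simp: comp_def)
    also have "\<dots> = distr \<xi> M (\<lambda>x. decode (\<lambda>i. point_bit i x))"
      unfolding l using c by (subst distr_distr) (auto simp: comp_def)
    also have "\<dots> = distr \<xi> M (\<lambda>x. x)"
    proof (rule distr_cong_AE)
      show "AE x in \<xi>. decode (\<lambda>i. point_bit i x) = x"
        using \<xi>(2) by eventually_elim (simp add: decode_point_bit)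
      show "(\<lambda>x. decode (\<lambda>i. point_bit i x)) \<in> \<xi> \<rightarrow>\<^sub>M M" by (rule measurable_compose[OF c decode_measurable])
    qed (simp_all add: measurable_ident_sets \<xi>)
    finally show "distr \<rho> M (\<lambda>t. decode (d t)) = \<xi>" using \<xi>(1) by (simp add: distr_id2)
  qed
  note code_L = code_AE[OF \<mu>(2,3) DLR(1) law_L] code_law[OF \<mu>(2,3) DLR(1) law_L]
  note code_R = code_AE[OF \<nu>(2,3) DLR(2) law_R] code_law[OF \<nu>(2,3) DLR(2) law_R]
  define h where "h t = (decode (DL t), decode (DR t))" for t
  have h[measurable]: "h \<in> \<rho> \<rightarrow>\<^sub>M M \<Otimes>\<^sub>M M"
    unfolding h_def using measurable_compose[OF DLR(1) decode_measurable] measurable_compose[OF DLR(2) decode_measurable]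
    by (rule measurable_Pair)
  define L where "L = distr \<rho> (M \<Otimes>\<^sub>M M) h"
  have L: "prob_space L" unfolding L_def by (rule \<rho>.prob_space_distr[OF h])
  interpret L: prob_space L by (rule L)
  have sL: "sets L = sets (M \<Otimes>\<^sub>M M)" by (simp add: L_def)
  have spL: "space L = space M \<times> space M" by (simp add: L_def space_pair_measure)
  have fst: "distr L \<mu> fst = \<mu>"
  proof -
    have "distr L \<mu> fst = distr L M fst" using \<mu>(2) by (intro distr_cong) auto
    also have "\<dots> = distr \<rho> M (\<lambda>t. decode (DL t))"
      unfolding L_def by (subst distr_distr) (auto simp: comp_def h_def)
    finally show ?thesis using code_L(2) by simp
  qed
  have snd: "distr L \<nu> snd = \<nu>"
  proof -
    have "distr L \<nu> snd = distr L M snd" using \<nu>(2) by (intro distr_cong) auto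
    also have "\<dots> = distr \<rho> M (\<lambda>t. decode (DR t))"
      unfolding L_def by (subst distr_distr) (auto simp: comp_def h_def)
    finally show ?thesis using code_R(2) by simp
  qed
  have lim_L: "(\<lambda>k. measure (J (s k)) (cyl l \<times> cyl l')) \<longlonglongrightarrow> measure L (cyl l \<times> cyl l')" for l l'
  proof -
    have "measure L (cyl l \<times> cyl l') = measure \<rho> (h -` (cyl l \<times> cyl l') \<inter> space \<rho>)"
      unfolding L_def by (rule measure_distr[OF h]) simp
    also have "\<dots> = measure \<rho> {t. (\<forall>i\<in>set l. DL t i) \<and> (\<forall>i\<in>set l'. DR t i)}"
    proof (rule measure_eq_AE)
      show "AE t in \<rho>. t \<in> h -` (cyl l \<times> cyl l') \<inter> space \<rho> \<longleftrightarrow> t \<in> {t. (\<forall>i\<in>set l. DL t i) \<and> (\<forall>i\<in>set l'. DR t i)}"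
        using code_L(1) code_R(1)
        by eventually_elim (auto simp: h_def cyl_def sp\<rho> X0_space)
      have "{t\<in>space \<rho>. (\<forall>i\<in>set l. D (Inl i) t) \<and> (\<forall>i\<in>set l'. D (Inr i) t)} \<in> sets \<rho>" by measurable
      then show "{t. (\<forall>i\<in>set l. DL t i) \<and> (\<forall>i\<in>set l'. DR t i)} \<in> sets \<rho>"
        by (simp add: sp\<rho> DL_def DR_def)
    qed simp
    finally show ?thesis using lim_cyl[of l l'] by simp
  qed
  have inv: "distr L L (map_prod (T g) (T g)) = L" if g: "g \<in> carrier G" for g
  proof -
    have Tg[measurable]: "T g \<in> M \<rightarrow>\<^sub>M M" by (rule T[OF g])
    have mp: "map_prod (T g) (T g) \<in> M \<Otimes>\<^sub>M M \<rightarrow>\<^sub>M M \<Otimes>\<^sub>M M"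
      unfolding map_prod_def by measurable
    have mpL: "map_prod (T g) (T g) \<in> L \<rightarrow>\<^sub>M L" "map_prod (T g) (T g) \<in> J k \<rightarrow>\<^sub>M J k" for k
      unfolding measurable_cong_sets[OF sL sL] measurable_cong_sets[OF J(2) J(2)] by (rule mp)+
    have "AE t in \<rho>. h t \<in> X0 \<times> X0"
      using code_L(1) code_R(1) by eventually_elim (simp add: h_def)
    then have X0L: "AE p in L. fst p \<in> X0 \<and> snd p \<in> X0"
      unfolding L_def by (subst AE_distr_iff) (auto elim!: eventually_mono)
    \<comment> \<open>Cylinders separate only measures carried by \<open>X0 \<times> X0\<close>, so
      the translated measure must be seen to be carried there too.\<close>
    have TX: "AE x in \<xi>. T g x \<in> X0" if "pmp_system G \<xi> T" "AE x in \<xi>. x \<in> X0" for \<xi>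
      by (rule AE_distr_invariant[OF _ _ that(2)]) (use that(1) g in \<open>auto simp: pmp_system_def\<close>)
    have "AE x in distr L \<mu> fst. T g x \<in> X0" unfolding fst by (rule TX[OF \<mu>(1,3)])
    then have 1: "AE p in L. T g (fst p) \<in> X0"
      by (rule AE_distrD[rotated]) (simp add: measurable_cong_sets[OF sL \<mu>(2)])
    have "AE x in distr L \<nu> snd. T g x \<in> X0" unfolding snd by (rule TX[OF \<nu>(1,3)])
    then have 2: "AE p in L. T g (snd p) \<in> X0"
      by (rule AE_distrD[rotated]) (simp add: measurable_cong_sets[OF sL \<nu>(2)])
    show ?thesis
    proof (rule pair_measure_eqI_cyl)
      show "prob_space (distr L L (map_prod (T g) (T g)))" by (rule L.prob_space_distr[OF mpL(1)])
      have "Measurable.pred (M \<Otimes>\<^sub>M M) (\<lambda>p. fst p \<in> X0 \<and> snd p \<in> X0)" by measurable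
      then have "Measurable.pred L (\<lambda>p. fst p \<in> X0 \<and> snd p \<in> X0)" unfolding measurable_cong_sets[OF sL refl] .
      then have pX: "{x \<in> space L. fst x \<in> X0 \<and> snd x \<in> X0} \<in> sets L" by simp
      show "AE p in distr L L (map_prod (T g) (T g)). fst p \<in> X0 \<and> snd p \<in> X0"
        unfolding AE_distr_iff[OF mpL(1) pX] using 1 2 by eventually_elim simp
      fix l l'
      obtain m where m: "\<And>x. x \<in> space M \<Longrightarrow> T g x \<in> cyl l \<longleftrightarrow> x \<in> cyl m" by (rule cyl_translate[OF g]) blast
      obtain m' where m': "\<And>x. x \<in> space M \<Longrightarrow> T g x \<in> cyl l' \<longleftrightarrow> x \<in> cyl m'" by (rule cyl_translate[OF g]) blast
      have vim: "map_prod (T g) (T g) -` (cyl l \<times> cyl l') \<inter> space M \<times> space M = cyl m \<times> cyl m'"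
        using m m' cyl_subset[of m] cyl_subset[of m'] by (auto simp: subset_iff)
      have cc: "cyl l \<times> cyl l' \<in> sets (M \<Otimes>\<^sub>M M)" by simp
      have "measure (J k) (cyl m \<times> cyl m') = measure (J k) (cyl l \<times> cyl l')" for k
      proof -
        have "measure (J k) (cyl l \<times> cyl l') = measure (distr (J k) (J k) (map_prod (T g) (T g))) (cyl l \<times> cyl l')"
          by (simp add: J_inv[OF g])
        also have "\<dots> = measure (J k) (cyl m \<times> cyl m')"
          using cc by (subst measure_distr[OF mpL(2)]) (auto simp: J(2) spJ vim)
        finally show ?thesis ..
      qed
      then have "measure L (cyl m \<times> cyl m') = measure L (cyl l \<times> cyl l')"
        using lim_L[of m m'] lim_L[of l l'] by (simp add: LIMSEQ_unique)
      moreover have "emeasure (distr L L (map_prod (T g) (T g))) (cyl l \<times> cyl l') = emeasure L (cyl m \<times> cyl m')"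
        using cc by (subst emeasure_distr[OF mpL(1)]) (auto simp: sL spL vim)
      ultimately show "emeasure (distr L L (map_prod (T g) (T g))) (cyl l \<times> cyl l') = emeasure L (cyl l \<times> cyl l')"
        by (simp add: L.emeasure_eq_measure)
    qed (use sL X0L in simp_all)
  qed
  show thesis
  proof (rule that[OF s _ lim_L])
    show "L \<in> joinings G \<mu> T \<nu> T"
      unfolding joinings_def using L fst snd inv sL sets_pair_measure_cong[OF \<mu>(2) \<nu>(2)] by simp
  qed
qed

end

section \<open>Components that are not disjoint\<close>

lemma (in prob_space) integral_le_add:
  fixes a b :: "'a \<Rightarrow> real"
  assumes "integrable M a" "integrable M b" "\<And>x. x \<in> space M \<Longrightarrow> a x \<le> b x + e"
  shows "integral\<^sup>L M a \<le> integral\<^sup>L M b + e"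
proof -
  have "integral\<^sup>L M a \<le> integral\<^sup>L M (\<lambda>x. b x + e)"
    using assms by (intro integral_mono) auto
  also have "\<dots> = integral\<^sup>L M b + e" using assms by (simp add: prob_space)
  finally show ?thesis .
qed

locale standard_decomp = ergodic_decomp G M T C \<kappa> \<pi> + std: standard_system M f f' X0 G T
  for G :: "('g, 'k) monoid_scheme" and M :: "'a measure" and T
    and C :: "'c measure" and \<kappa> :: "'c \<Rightarrow> 'a measure" and \<pi> f f' X0 +
  assumes X0_AE: "AE x in M. x \<in> X0"
begin

text \<open>Being carried by \<open>X0\<close>, these are the components on which almost every point
  can be recovered from its code.\<close>

definition standard_components :: "'c set" where "standard_components = {c\<in>space C. measure (\<kappa> c) X0 = 1}"

lemma measure_\<kappa>[measurable]: "B \<in> sets M \<Longrightarrow> (\<lambda>c. measure (\<kappa> c) B) \<in> borel_measurable C"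
  by (rule measurable_compose[OF \<kappa> measurable_measure_prob_algebra])

lemma standard_components[measurable]: "standard_components \<in> sets C"
  unfolding standard_components_def by measurable

lemma standard_componentsD:
  assumes "c \<in> standard_components"
  shows "c \<in> space C" "AE x in \<kappa> c. x \<in> X0"
proof -
  show c: "c \<in> space C" using assms by (simp add: standard_components_def)
  interpret prob_space "\<kappa> c" by (rule \<kappa>D(1)[OF c])
  show "AE x in \<kappa> c. x \<in> X0"
    using assms prob_eq_1[of X0] \<kappa>D(2)[OF c] by (simp add: standard_components_def)
qed

lemma standard_components_AE: "AE c in C. c \<in> standard_components"
  using AE_component[OF X0_AE] AE_space
proof eventually_elim
  case (elim c)
  interpret prob_space "\<kappa> c" by (rule \<kappa>D(1)[OF elim(2)])
  show ?case
    using elim prob_eq_1[of X0] \<kappa>D(2)[OF elim(2)] by (simp add: standard_components_def)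
qed

definition cyl_prob :: "nat \<Rightarrow> 'c \<Rightarrow> real" where
  "cyl_prob j c = measure (\<kappa> c) (std.cyl (from_nat j))"

text \<open>The first \<open>n\<close> cylinder probabilities rounded to precision 1/n. Since
  \<open>int list\<close> is countable, any function of a key and any set of keys is
  measurable.\<close>

definition key :: "nat \<Rightarrow> 'c \<Rightarrow> int list" where
  "key n c = map (\<lambda>j. \<lfloor>real n * cyl_prob j c\<rfloor>) [0..<n]"

lemma cyl_prob_measurable[measurable]: "cyl_prob j \<in> borel_measurable C"
  unfolding cyl_prob_def by measurable

lemma key_measurable[measurable]: "key n \<in> C \<rightarrow>\<^sub>M count_space UNIV"
proof (subst measurable_count_space_eq_countable)
  have "key n -` {v} \<inter> space C \<in> sets C" for v
  proof -
    have "key n -` {v} \<inter> space C = (if length v = n then {c\<in>space C. \<forall>j\<in>{..<n}. \<lfloor>real n * cyl_prob j c\<rfloor> = v ! j} else {})"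
    proof -
      have "key n c = v \<longleftrightarrow> length v = n \<and> (\<forall>j\<in>{..<n}. \<lfloor>real n * cyl_prob j c\<rfloor> = v ! j)" for c
        unfolding key_def by (subst list_eq_iff_nth_eq) auto
      then show ?thesis by auto
    qed
    moreover have "{c\<in>space C. \<forall>j\<in>{..<n}. \<lfloor>real n * cyl_prob j c\<rfloor> = v ! j} \<in> sets C"
      by measurable
    ultimately show ?thesis by simp
  qed
  then show "key n \<in> space C \<rightarrow> UNIV \<and> (\<forall>a\<in>UNIV. key n -` {a} \<inter> space C \<in> sets C)" by auto
qed auto

lemma key_close:
  assumes "key n c = key n c'" "j < n"
  shows "\<bar>cyl_prob j c - cyl_prob j c'\<bar> \<le> 1 / real n"
proof -
  have "key n c ! j = key n c' ! j" using assms(1) by simp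
  then have "\<lfloor>real n * cyl_prob j c\<rfloor> = \<lfloor>real n * cyl_prob j c'\<rfloor>" using assms(2) by (simp add: key_def)
  then have "\<bar>real n * cyl_prob j c - real n * cyl_prob j c'\<bar> \<le> 1" by linarith
  then have "real n * \<bar>cyl_prob j c - cyl_prob j c'\<bar> \<le> 1"
    by (simp add: abs_mult right_diff_distrib[symmetric])
  then show ?thesis using assms(2) by (simp add: field_simps)
qed

lemma cyl_prob_to_nat: "cyl_prob (to_nat l) c = measure (\<kappa> c) (std.cyl l)"
  by (simp add: cyl_prob_def)

text \<open>A given cylinder enters the key from some \<open>n\<close> on, and from then on the two
  probabilities differ by at most 1/n.\<close>

lemma key_limit:
  assumes "\<And>n. key n (c n) = key n c0"
  shows "(\<lambda>n. measure (\<kappa> (c n)) (std.cyl l)) \<longlonglongrightarrow> measure (\<kappa> c0) (std.cyl l)"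
proof (rule LIM_zero_cancel, rule Lim_null_comparison)
  show "\<forall>\<^sub>F n in sequentially. norm (measure (\<kappa> (c n)) (std.cyl l) - measure (\<kappa> c0) (std.cyl l)) \<le> 1 / real n"
    using eventually_gt_at_top[of "to_nat l"]
    by eventually_elim (use key_close[OF assms] in \<open>simp add: cyl_prob_to_nat[symmetric]\<close>)
  show "(\<lambda>n. 1 / real n) \<longlonglongrightarrow> 0" by (rule lim_1_over_n)
qed

text \<open>The sign \<open>\<sigma>\<close>, taken to be 1 or -1, makes the deviation from the
  product one-sided, so that deviations of different components cannot cancel when they are
  averaged.\<close>

definition prod_dev :: "real \<Rightarrow> (nat \<times> rat) list \<Rightarrow> (nat \<times> rat) list \<Rightarrow> ('a \<times> 'a) measure \<Rightarrow> 'c \<Rightarrow> 'c \<Rightarrow> real" where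
  "prod_dev \<sigma> l l' J c d =
     \<sigma> * (measure J (std.cyl l \<times> std.cyl l') - measure (\<kappa> c) (std.cyl l) * measure (\<kappa> d) (std.cyl l'))"

definition nondisjoint :: "real \<Rightarrow> (nat \<times> rat) list \<Rightarrow> (nat \<times> rat) list \<Rightarrow> real \<Rightarrow> ('c \<times> 'c) set" where
  "nondisjoint \<sigma> l l' \<epsilon> = {(c, d). c \<in> standard_components \<and> d \<in> standard_components \<and> (\<exists>J\<in>joinings G (\<kappa> c) T (\<kappa> d) T. \<epsilon> \<le> prod_dev \<sigma> l l' J c d)}"

lemma sets_pair_\<kappa>: "c \<in> space C \<Longrightarrow> d \<in> space C \<Longrightarrow> sets (\<kappa> c \<Otimes>\<^sub>M \<kappa> d) = sets (M \<Otimes>\<^sub>M M)"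
  using \<kappa>D(2) by (intro sets_pair_measure_cong) auto

lemma joining_\<kappa>D:
  assumes J: "J \<in> joinings G (\<kappa> c) T (\<kappa> d) T" and c: "c \<in> space C" and d: "d \<in> space C"
  shows "prob_space J" "sets J = sets (M \<Otimes>\<^sub>M M)" "space J = space M \<times> space M"
    "\<And>A. A \<in> sets M \<Longrightarrow> measure J (A \<times> space M) = measure (\<kappa> c) A"
    "\<And>A. A \<in> sets M \<Longrightarrow> measure J (space M \<times> A) = measure (\<kappa> d) A"
    "\<And>g. g \<in> carrier G \<Longrightarrow> distr J J (map_prod (T g) (T g)) = J"
proof -
  note D = joiningsD[OF J]
  show "prob_space J" and s: "sets J = sets (M \<Otimes>\<^sub>M M)" and sp: "space J = space M \<times> space M"
    using D(1,2,3) sets_pair_\<kappa>[OF c d] \<kappa>D(3)[OF c] \<kappa>D(3)[OF d] by simp_all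
  show "\<And>g. g \<in> carrier G \<Longrightarrow> distr J J (map_prod (T g) (T g)) = J" by (rule D(6))
  fix A assume A: "A \<in> sets M"
  have m: "fst \<in> J \<rightarrow>\<^sub>M \<kappa> c" "snd \<in> J \<rightarrow>\<^sub>M \<kappa> d"
    unfolding measurable_cong_sets[OF s \<kappa>D(2)[OF c]] measurable_cong_sets[OF s \<kappa>D(2)[OF d]] by simp_all
  have "measure (\<kappa> c) A = measure (distr J (\<kappa> c) fst) A" by (simp add: D(4))
  also have "\<dots> = measure J (fst -` A \<inter> space J)" using A \<kappa>D(2)[OF c] by (intro measure_distr m) simp
  also have "fst -` A \<inter> space J = A \<times> space M" using sets.sets_into_space[OF A] by (auto simp: sp)
  finally show "measure J (A \<times> space M) = measure (\<kappa> c) A" ..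
  have "measure (\<kappa> d) A = measure (distr J (\<kappa> d) snd) A" by (simp add: D(5))
  also have "\<dots> = measure J (snd -` A \<inter> space J)" using A \<kappa>D(2)[OF d] by (intro measure_distr m) simp
  also have "snd -` A \<inter> space J = space M \<times> A" using sets.sets_into_space[OF A] by (auto simp: sp)
  finally show "measure J (space M \<times> A) = measure (\<kappa> d) A" ..
qed

text \<open>By compactness, being nondisjoint by a given amount is a closed condition on the cylinder
  probabilities of the two components.\<close>
lemma nondisjoint_measurable: "nondisjoint \<sigma> l l' \<epsilon> \<in> sets (C \<Otimes>\<^sub>M C)"
proof -
  define k where "k n p = (key n (fst p), key n (snd p))" for n :: nat and p :: "'c \<times> 'c"
  have [measurable]: "k n \<in> C \<Otimes>\<^sub>M C \<rightarrow>\<^sub>M count_space UNIV" for n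
  proof -
    have "k n \<in> C \<Otimes>\<^sub>M C \<rightarrow>\<^sub>M count_space UNIV \<Otimes>\<^sub>M count_space UNIV" unfolding k_def by measurable
    then show ?thesis by (simp add: pair_measure_countable)
  qed
  let ?E = "nondisjoint \<sigma> l l' \<epsilon>"
  \<comment> \<open>A pair of standard components lies in \<open>?E\<close> once all its rounded
    keys are attained there: cylinder probabilities of the attaining pairs converge to those of the
    given pair, and a subsequence of their joinings converges to a joining that still deviates by at
    least \<open>\<epsilon>\<close>.\<close>
  have "?E = {p\<in>space (C \<Otimes>\<^sub>M C). fst p \<in> standard_components \<and> snd p \<in> standard_components \<and> (\<forall>n. k n p \<in> k n ` ?E)}" (is "_ = ?R")
  proof (rule Set.set_eqI, rule iffI)
    fix p assume "p \<in> ?E"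
    then show "p \<in> ?R" using standard_componentsD(1) by (auto simp: nondisjoint_def space_pair_measure)
  next
    fix p assume p: "p \<in> ?R"
    obtain c d where cd: "p = (c, d)" by (cases p)
    have c1: "c \<in> standard_components" "d \<in> standard_components" using p cd by auto
    have "\<forall>n. \<exists>q J. fst q \<in> standard_components \<and> snd q \<in> standard_components \<and> J \<in> joinings G (\<kappa> (fst q)) T (\<kappa> (snd q)) T \<and>
        \<epsilon> \<le> prod_dev \<sigma> l l' J (fst q) (snd q) \<and> k n q = k n p"
    proof
      fix n
      have "k n p \<in> k n ` ?E" using p by auto
      then obtain q where "q \<in> ?E" "k n q = k n p" by auto
      then show "\<exists>q J. fst q \<in> standard_components \<and> snd q \<in> standard_components \<and> J \<in> joinings G (\<kappa> (fst q)) T (\<kappa> (snd q)) T \<and>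
        \<epsilon> \<le> prod_dev \<sigma> l l' J (fst q) (snd q) \<and> k n q = k n p"
        by (cases q) (auto simp: nondisjoint_def)
    qed
    then obtain q J where q: "\<And>n. fst (q n) \<in> standard_components" "\<And>n. snd (q n) \<in> standard_components"
      and J: "\<And>n. J n \<in> joinings G (\<kappa> (fst (q n))) T (\<kappa> (snd (q n))) T"
      and dev: "\<And>n. \<epsilon> \<le> prod_dev \<sigma> l l' (J n) (fst (q n)) (snd (q n))" and kq: "\<And>n. k n (q n) = k n p"
      by metis
    have key: "key n (fst (q n)) = key n c" "key n (snd (q n)) = key n d" for n
      using kq[of n] by (auto simp: k_def cd)
    note JD = joining_\<kappa>D[OF J standard_componentsD(1)[OF q(1)] standard_componentsD(1)[OF q(2)]]
    note cD = \<kappa>D[OF standard_componentsD(1)[OF c1(1)]] and dD = \<kappa>D[OF standard_componentsD(1)[OF c1(2)]]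
    obtain s L where s: "strict_mono (s :: nat \<Rightarrow> nat)" and L: "L \<in> joinings G (\<kappa> c) T (\<kappa> d) T"
      and lim: "\<And>l l'. (\<lambda>k. measure (J (s k)) (std.cyl l \<times> std.cyl l')) \<longlonglongrightarrow> measure L (std.cyl l \<times> std.cyl l')"
    proof (rule std.invariant_pairs_limit[OF cD(4,2) standard_componentsD(2)[OF c1(1)] dD(4,2) standard_componentsD(2)[OF c1(2)] JD(1,2,6)])
      show "(\<lambda>k. measure (J k) (std.cyl l \<times> space M)) \<longlonglongrightarrow> measure (\<kappa> c) (std.cyl l)" for l
        using key_limit[OF key(1), of l] by (simp add: JD(4))
      show "(\<lambda>k. measure (J k) (space M \<times> std.cyl l)) \<longlonglongrightarrow> measure (\<kappa> d) (std.cyl l)" for l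
        using key_limit[OF key(2), of l] by (simp add: JD(5))
    qed blast+
    have "(\<lambda>n. prod_dev \<sigma> l l' (J (s n)) (fst (q (s n))) (snd (q (s n)))) \<longlonglongrightarrow> prod_dev \<sigma> l l' L c d"
      unfolding prod_dev_def
      using LIMSEQ_subseq_LIMSEQ[OF key_limit[OF key(1)] s] LIMSEQ_subseq_LIMSEQ[OF key_limit[OF key(2)] s] lim
      by (intro tendsto_intros) (auto simp: comp_def)
    then have "\<epsilon> \<le> prod_dev \<sigma> l l' L c d"
      using dev by (intro LIMSEQ_le_const) auto
    then show "p \<in> ?E" using L c1 by (auto simp: nondisjoint_def cd)
  qed
  also have "?R \<in> sets (C \<Otimes>\<^sub>M C)"
  proof -
    \<comment> \<open>The image under \<open>k n\<close> is a subset of a discrete type, hence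
      measurable whatever \<open>?E\<close> is.\<close>
    have "Measurable.pred (C \<Otimes>\<^sub>M C) (\<lambda>p. k n p \<in> k n ` ?E)" for n
      by (rule pred_sets2[of _ "count_space UNIV"]) auto
    then show ?thesis by measurable
  qed
  finally show ?thesis .
qed

lemma joining_X0:
  assumes J: "J \<in> joinings G (\<kappa> c) T (\<kappa> d) T" and c: "c \<in> standard_components" and d: "d \<in> standard_components"
  shows "AE p in J. fst p \<in> X0 \<and> snd p \<in> X0"
proof -
  note D = joiningsD[OF J] and s = joining_\<kappa>D(2)[OF J standard_componentsD(1)[OF c] standard_componentsD(1)[OF d]]
  have m: "fst \<in> J \<rightarrow>\<^sub>M \<kappa> c" "snd \<in> J \<rightarrow>\<^sub>M \<kappa> d"
    unfolding measurable_cong_sets[OF s \<kappa>D(2)[OF standard_componentsD(1)[OF c]]] measurable_cong_sets[OF s \<kappa>D(2)[OF standard_componentsD(1)[OF d]]] by simp_all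
  have "AE x in distr J (\<kappa> c) fst. x \<in> X0" unfolding D(4) by (rule standard_componentsD(2)[OF c])
  then have 1: "AE p in J. fst p \<in> X0" by (rule AE_distrD[OF m(1)])
  have "AE x in distr J (\<kappa> d) snd. x \<in> X0" unfolding D(5) by (rule standard_componentsD(2)[OF d])
  then have 2: "AE p in J. snd p \<in> X0" by (rule AE_distrD[OF m(2)])
  from 1 2 show ?thesis by eventually_elim simp
qed

lemma measure_pair_\<kappa>:
  assumes "c \<in> space C" "d \<in> space C" "A \<in> sets M" "B \<in> sets M"
  shows "measure (\<kappa> c \<Otimes>\<^sub>M \<kappa> d) (A \<times> B) = measure (\<kappa> c) A * measure (\<kappa> d) B"
proof -
  have "emeasure (\<kappa> c \<Otimes>\<^sub>M \<kappa> d) (A \<times> B) = emeasure (\<kappa> c) A * emeasure (\<kappa> d) B"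
    using assms \<kappa>D by (intro sigma_finite_measure.emeasure_pair_measure_Times prob_space_imp_sigma_finite) auto
  then show ?thesis by (simp add: measure_def enn2real_mult)
qed

text \<open>A joining other than the product differs from it on some product of cylinders. Recording
  only the sign of the difference and a reciprocal below its size leaves countably many
  parameters.\<close>

lemma mem_nondisjoint:
  assumes c: "c \<in> standard_components" and d: "d \<in> standard_components" and nd: "\<not> disjoint_systems G (\<kappa> c) T (\<kappa> d) T"
  shows "\<exists>\<sigma>\<in>{1, -1}. \<exists>l l' m. (c, d) \<in> nondisjoint \<sigma> l l' (1 / real (Suc m))"
proof -
  note cs = standard_componentsD(1)[OF c] and ds = standard_componentsD(1)[OF d]
  have P: "\<kappa> c \<Otimes>\<^sub>M \<kappa> d \<in> joinings G (\<kappa> c) T (\<kappa> d) T"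
    by (rule pair_measure_mem_joinings[OF \<kappa>D(4)[OF cs] \<kappa>D(4)[OF ds]])
  obtain J where J: "J \<in> joinings G (\<kappa> c) T (\<kappa> d) T" "J \<noteq> \<kappa> c \<Otimes>\<^sub>M \<kappa> d"
    using disjoint_systemsI[OF \<kappa>D(4)[OF cs] \<kappa>D(4)[OF ds]] nd by blast
  note JD = joining_\<kappa>D[OF J(1) cs ds] and PD = joining_\<kappa>D[OF P cs ds]
  interpret J: prob_space J by (rule JD(1))
  interpret P: prob_space "\<kappa> c \<Otimes>\<^sub>M \<kappa> d" by (rule PD(1))
  obtain l l' where "emeasure J (std.cyl l \<times> std.cyl l') \<noteq> emeasure (\<kappa> c \<Otimes>\<^sub>M \<kappa> d) (std.cyl l \<times> std.cyl l')"
    using std.pair_measure_eqI_cyl[OF JD(1,2) PD(2) joining_X0[OF J(1) c d] joining_X0[OF P c d]] J(2) by blast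
  then have ne: "measure J (std.cyl l \<times> std.cyl l') \<noteq> measure (\<kappa> c) (std.cyl l) * measure (\<kappa> d) (std.cyl l')"
    by (simp add: J.emeasure_eq_measure P.emeasure_eq_measure measure_pair_\<kappa>[OF cs ds])
  define \<delta> where "\<delta> = measure J (std.cyl l \<times> std.cyl l') - measure (\<kappa> c) (std.cyl l) * measure (\<kappa> d) (std.cyl l')"
  obtain m where m: "1 / real (Suc m) < \<bar>\<delta>\<bar>"
    using nat_approx_posE[of "\<bar>\<delta>\<bar>"] ne by (auto simp: \<delta>_def)
  have "sgn \<delta> \<in> {1, -1}" using ne by (auto simp: \<delta>_def sgn_if)
  moreover have "1 / real (Suc m) \<le> prod_dev (sgn \<delta>) l l' J c d"
    using m by (simp add: prod_dev_def \<delta>_def[symmetric] abs_sgn mult.commute)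
  ultimately show ?thesis using J(1) c d by (intro bexI[of _ "sgn \<delta>"] exI[of _ l] exI[of _ l'] exI[of _ m]) (auto simp: nondisjoint_def)
qed


text \<open>Joinings of \<open>\<kappa> c\<close> and \<open>\<kappa> d\<close> are integrated over \<open>c\<close> without a measurable choice: one joining is
  picked for each of the countably many values of \<open>key n\<close>. The resulting marginal is off by at most
  \<open>1 / n\<close> on each cylinder, and a limit of these measures is an exact joining.\<close>
lemma nondisjoint_section:
  assumes d: "d \<in> standard_components" and \<sigma>: "\<sigma> \<in> {1, -1}" and \<epsilon>: "0 < \<epsilon>"
    and pos: "0 < measure C {c\<in>space C. (c, d) \<in> nondisjoint \<sigma> l l' \<epsilon>}"
  obtains L where "L \<in> joinings G M T (\<kappa> d) T" "L \<noteq> M \<Otimes>\<^sub>M \<kappa> d"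
proof -
  note ds = standard_componentsD(1)[OF d]
  note [measurable] = nondisjoint_measurable
  define F where "F = {c\<in>space C. (c, d) \<in> nondisjoint \<sigma> l l' \<epsilon>}"
  have F[measurable]: "F \<in> sets C" unfolding F_def using ds by measurable
  have FC1: "c \<in> standard_components" if "c \<in> F" for c using that by (auto simp: F_def nondisjoint_def)
  have "\<forall>c\<in>F. \<exists>J\<in>joinings G (\<kappa> c) T (\<kappa> d) T. \<epsilon> \<le> prod_dev \<sigma> l l' J c d"
    by (auto simp: F_def nondisjoint_def)
  then obtain Js where Js: "\<And>c. c \<in> F \<Longrightarrow> Js c \<in> joinings G (\<kappa> c) T (\<kappa> d) T"
    and Js_dev: "\<And>c. c \<in> F \<Longrightarrow> \<epsilon> \<le> prod_dev \<sigma> l l' (Js c) c d" by metis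
  \<comment> \<open>A component in \<open>F\<close> is given the joining chosen for the
    representative of its key, whose cylinder probabilities are close to its own.\<close>
  define rep where "rep n v = (SOME c. c \<in> F \<and> key n c = v)" for n v
  have rep: "rep n (key n c) \<in> F" "key n (rep n (key n c)) = key n c" if "c \<in> F" for n c
    using someI[of "\<lambda>c'. c' \<in> F \<and> key n c' = key n c" c] that by (auto simp: rep_def)
  define P where "P c = \<kappa> c \<Otimes>\<^sub>M \<kappa> d" for c
  have P_join: "P c \<in> joinings G (\<kappa> c) T (\<kappa> d) T" if "c \<in> space C" for c
    unfolding P_def by (rule pair_measure_mem_joinings[OF \<kappa>D(4)[OF that] \<kappa>D(4)[OF ds]])
  \<comment> \<open>\<open>P d\<close> is a filler for keys not attained in \<open>F\<close>; it
    makes all values of \<open>g n\<close> probability measures.\<close>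
  define g where "g n v = (if v \<in> key n ` F then Js (rep n v) else P d)" for n v
  \<comment> \<open>Outside \<open>F\<close> the product measure has exact marginals and contributes
    no deviation.\<close>
  define K where "K n c = (if c \<in> F then g n (key n c) else P c)" for n c
  have K_join: "\<exists>c'\<in>space C. key n c' = key n c \<and> K n c \<in> joinings G (\<kappa> c') T (\<kappa> d) T" if c: "c \<in> space C" for n c
  proof (cases "c \<in> F")
    case True
    then show ?thesis
      using rep[OF True, of n] Js[OF rep(1)[OF True]] standard_componentsD(1)[OF FC1] by (intro bexI[of _ "rep n (key n c)"]) (auto simp: K_def g_def)
  next
    case False
    then show ?thesis using P_join[OF c] c by (intro bexI[of _ c]) (auto simp: K_def)
  qed
  have space_J: "J \<in> space (prob_algebra (M \<Otimes>\<^sub>M M))" if "J \<in> joinings G (\<kappa> c) T (\<kappa> d) T" "c \<in> space C" for J c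
    using joining_\<kappa>D[OF that ds] by (simp add: space_prob_algebra)
  have g[measurable]: "g n \<in> count_space UNIV \<rightarrow>\<^sub>M prob_algebra (M \<Otimes>\<^sub>M M)" for n
  proof -
    have "g n v \<in> space (prob_algebra (M \<Otimes>\<^sub>M M))" for v
    proof (cases "v \<in> key n ` F")
      case True
      then obtain c where c: "c \<in> F" "v = key n c" by auto
      then show ?thesis
        using space_J[OF Js[OF rep(1)[OF c(1)]] standard_componentsD(1)[OF FC1[OF rep(1)[OF c(1)]]], of n] by (simp add: g_def)
    qed (use space_J[OF P_join[OF ds] ds] in \<open>simp add: g_def\<close>)
    then show ?thesis by simp
  qed
  have [measurable]: "P \<in> C \<rightarrow>\<^sub>M prob_algebra (M \<Otimes>\<^sub>M M)"
    unfolding P_def using \<kappa>D[OF ds] by (intro measurable_pair_prob) (auto simp: space_prob_algebra intro: measurable_const)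
  have K[measurable]: "K n \<in> C \<rightarrow>\<^sub>M prob_algebra (M \<Otimes>\<^sub>M M)" for n
    unfolding K_def by measurable
  note K'[measurable] = measurable_prob_algebraD[OF K]
  define J where "J n = C \<bind> K n" for n
  have Csp: "C \<in> space (prob_algebra C)" by (simp add: space_prob_algebra C.prob_space_axioms)
  have J: "prob_space (J n)" "sets (J n) = sets (M \<Otimes>\<^sub>M M)" for n
    unfolding J_def by (rule prob_space_bind'[OF Csp K], rule sets_bind'[OF Csp K])
  have J_meas: "measure (J n) Z = (\<integral>c. measure (K n c) Z \<partial>C)" if "Z \<in> sets (M \<Otimes>\<^sub>M M)" for n Z
    unfolding J_def by (rule C.measure_bind[OF K' that])
  have int: "integrable C (\<lambda>c. measure (K n c) Z)" if "Z \<in> sets (M \<Otimes>\<^sub>M M)" for n Z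
  proof (rule C.integrable_const_bound[of _ 1])
    show "AE c in C. norm (measure (K n c) Z) \<le> 1"
    proof (rule AE_I2)
      fix c assume "c \<in> space C"
      then have "prob_space (K n c)" using measurable_space[OF K] by (simp add: space_prob_algebra)
      then show "norm (measure (K n c) Z) \<le> 1" by (simp add: prob_space.prob_le_1)
    qed
    show "(\<lambda>c. measure (K n c) Z) \<in> borel_measurable C"
      by (rule measurable_compose[OF K measurable_measure_prob_algebra[OF that]])
  qed
  have int\<kappa>: "integrable C (\<lambda>c. measure (\<kappa> c) A)" if "A \<in> sets M" for A
    using \<kappa>D(1) that by (intro C.integrable_const_bound[of _ 1]) (auto simp: prob_space.prob_le_1)
  have M_meas: "measure M A = (\<integral>c. measure (\<kappa> c) A \<partial>C)" if "A \<in> sets M" for A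
    using C.measure_bind[OF \<kappa>_subprob that] by (simp add: M_eq[symmetric])
  have close: "\<bar>measure (\<kappa> c) (std.cyl l) - measure (\<kappa> c') (std.cyl l)\<bar> \<le> 1 / real n"
    if "key n c' = key n c" "to_nat l < n" for n c c' l
    using key_close[OF that] by (simp add: cyl_prob_to_nat abs_minus_commute)
  have J_inv: "distr (J n) (J n) (map_prod (T g) (T g)) = J n" if g: "g \<in> carrier G" for n g
  proof -
    have [measurable]: "T g \<in> M \<rightarrow>\<^sub>M M" by (rule T[OF g])
    have "distr (J n) (J n) (map_prod (T g) (T g)) = distr (J n) (M \<Otimes>\<^sub>M M) (map_prod (T g) (T g))"
      using J(2) by (intro distr_cong) auto
    also have "\<dots> = C \<bind> (\<lambda>c. distr (K n c) (M \<Otimes>\<^sub>M M) (map_prod (T g) (T g)))"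
      unfolding J_def by (rule distr_bind[OF K' C.not_empty]) (simp add: map_prod_def)
    also have "\<dots> = J n"
      unfolding J_def
    proof (rule bind_cong[OF refl])
      fix c assume "c \<in> space C"
      then obtain c' where c': "c' \<in> space C" "K n c \<in> joinings G (\<kappa> c') T (\<kappa> d) T" using K_join by blast
      note KD = joining_\<kappa>D[OF c'(2,1) ds]
      have "distr (K n c) (M \<Otimes>\<^sub>M M) (map_prod (T g) (T g)) = distr (K n c) (K n c) (map_prod (T g) (T g))"
        using KD(2) by (intro distr_cong) auto
      then show "distr (K n c) (M \<Otimes>\<^sub>M M) (map_prod (T g) (T g)) = K n c" using KD(6)[OF g] by simp
    qed
    finally show ?thesis .
  qed
  have K1: "\<bar>measure (K n c) (std.cyl l \<times> space M) - measure (\<kappa> c) (std.cyl l)\<bar> \<le> 1 / real n"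
    if c: "c \<in> space C" and n: "to_nat l < n" for n c l
  proof -
    obtain c' where c': "c' \<in> space C" "key n c' = key n c" "K n c \<in> joinings G (\<kappa> c') T (\<kappa> d) T"
      using K_join[OF c] by blast
    show ?thesis
      using close[OF c'(2) n] joining_\<kappa>D(4)[OF c'(3,1) ds, of "std.cyl l"] by (simp add: abs_minus_commute)
  qed
  have K2: "measure (K n c) (space M \<times> A) = measure (\<kappa> d) A"
    if c: "c \<in> space C" and A: "A \<in> sets M" for n c A
  proof -
    obtain c' where c': "c' \<in> space C" "K n c \<in> joinings G (\<kappa> c') T (\<kappa> d) T"
      using K_join[OF c] by blast
    show ?thesis by (rule joining_\<kappa>D(5)[OF c'(2,1) ds A])
  qed
  \<comment> \<open>The first marginal of \<open>K n c\<close> is a component with the same key as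
    \<open>c\<close>; integration over \<open>c\<close> preserves the error bound 1/n.\<close>
  have lim1: "(\<lambda>n. measure (J n) (std.cyl l \<times> space M)) \<longlonglongrightarrow> measure M (std.cyl l)" for l
  proof (rule LIM_zero_cancel, rule Lim_null_comparison)
    show "\<forall>\<^sub>F n in sequentially. norm (measure (J n) (std.cyl l \<times> space M) - measure M (std.cyl l)) \<le> 1 / real n"
      using eventually_gt_at_top[of "to_nat l"]
    proof eventually_elim
      case (elim n)
      have Z: "std.cyl l \<times> space M \<in> sets (M \<Otimes>\<^sub>M M)" by simp
      have "(\<integral>c. measure (K n c) (std.cyl l \<times> space M) \<partial>C) \<le> (\<integral>c. measure (\<kappa> c) (std.cyl l) \<partial>C) + 1 / real n"
        using K1[OF _ elim] by (intro C.integral_le_add int Z int\<kappa> std.cyl_measurable) (auto simp: abs_le_iff diff_le_eq add.commute)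
      moreover have "(\<integral>c. measure (\<kappa> c) (std.cyl l) \<partial>C) \<le> (\<integral>c. measure (K n c) (std.cyl l \<times> space M) \<partial>C) + 1 / real n"
        using K1[OF _ elim] by (intro C.integral_le_add int Z int\<kappa> std.cyl_measurable) (auto simp: abs_le_iff diff_le_eq add.commute)
      ultimately show ?case by (simp add: J_meas M_meas abs_le_iff)
    qed
    show "(\<lambda>n. 1 / real n) \<longlonglongrightarrow> 0" by (rule lim_1_over_n)
  qed
  have lim2: "(\<lambda>n. measure (J n) (space M \<times> std.cyl l)) \<longlonglongrightarrow> measure (\<kappa> d) (std.cyl l)" for l
  proof -
    have "measure (J n) (space M \<times> std.cyl l) = measure (\<kappa> d) (std.cyl l)" for n
    proof -
      have "measure (J n) (space M \<times> std.cyl l) = (\<integral>c. measure (K n c) (space M \<times> std.cyl l) \<partial>C)"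
        by (rule J_meas) simp
      also have "\<dots> = (\<integral>c. measure (\<kappa> d) (std.cyl l) \<partial>C)"
        by (rule Bochner_Integration.integral_cong[OF refl]) (simp add: K2)
      finally show ?thesis by (simp add: C.prob_space)
    qed
    then show ?thesis by simp
  qed
  obtain s L where s: "strict_mono (s :: nat \<Rightarrow> nat)" and L: "L \<in> joinings G M T (\<kappa> d) T"
    and lim: "\<And>l l'. (\<lambda>k. measure (J (s k)) (std.cyl l \<times> std.cyl l')) \<longlonglongrightarrow> measure L (std.cyl l \<times> std.cyl l')"
    by (rule std.invariant_pairs_limit[OF pmp refl X0_AE \<kappa>D(4,2)[OF ds] standard_componentsD(2)[OF d] J J_inv lim1 lim2]) blast+
  let ?Z = "std.cyl l \<times> std.cyl l'" and ?p = "measure M (std.cyl l) * measure (\<kappa> d) (std.cyl l')"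
  \<comment> \<open>On \<open>F\<close> the chosen joinings deviate by at least
    \<open>\<epsilon>\<close> from the product of their own marginals; replacing the representative
    by \<open>c\<close> in that product costs at most 1/n.\<close>
  have dev: "\<epsilon> * measure C F - 1 / real n \<le> \<sigma> * (measure (J n) ?Z - ?p)" if n: "to_nat l < n" for n
  proof -
    have Z: "?Z \<in> sets (M \<Otimes>\<^sub>M M)" by simp
    define a where "a c = \<sigma> * (measure (K n c) ?Z - measure (\<kappa> c) (std.cyl l) * measure (\<kappa> d) (std.cyl l'))" for c
    have ia: "integrable C a"
      unfolding a_def using int[OF Z] int\<kappa>[of "std.cyl l"] by auto
    have "(\<integral>c. \<epsilon> * indicator F c \<partial>C) \<le> (\<integral>c. a c \<partial>C) + 1 / real n"
    proof (rule C.integral_le_add[OF _ ia])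
      show "integrable C (\<lambda>c. \<epsilon> * indicator F c)"
        by (intro integrable_mult_right integrable_real_indicator) (auto simp: C.emeasure_eq_measure)
      fix c assume c: "c \<in> space C"
      show "\<epsilon> * indicator F c \<le> a c + 1 / real n"
      proof (cases "c \<in> F")
        case False
        then have "a c = 0" using measure_pair_\<kappa>[OF c ds] by (simp add: a_def K_def P_def)
        then show ?thesis using False by simp
      next
        case True
        define c' where "c' = rep n (key n c)"
        have c': "c' \<in> F" "key n c' = key n c" using rep[OF True] by (auto simp: c'_def)
        have "K n c = Js c'" using True by (simp add: K_def g_def c'_def)
        then have "\<epsilon> \<le> \<sigma> * (measure (K n c) ?Z - measure (\<kappa> c') (std.cyl l) * measure (\<kappa> d) (std.cyl l'))"
          using Js_dev[OF c'(1)] by (simp add: prod_dev_def)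
        also have "\<dots> = a c + \<sigma> * ((measure (\<kappa> c) (std.cyl l) - measure (\<kappa> c') (std.cyl l)) * measure (\<kappa> d) (std.cyl l'))"
          by (simp add: a_def algebra_simps)
        also have "\<sigma> * ((measure (\<kappa> c) (std.cyl l) - measure (\<kappa> c') (std.cyl l)) * measure (\<kappa> d) (std.cyl l')) \<le> 1 / real n"
        proof -
          have "\<bar>\<sigma> * ((measure (\<kappa> c) (std.cyl l) - measure (\<kappa> c') (std.cyl l)) * measure (\<kappa> d) (std.cyl l'))\<bar> =
            \<bar>measure (\<kappa> c) (std.cyl l) - measure (\<kappa> c') (std.cyl l)\<bar> * measure (\<kappa> d) (std.cyl l')"
            using \<sigma> by (auto simp: abs_mult)
          also have "\<dots> \<le> 1 / real n * 1"
            using close[OF c'(2) n] prob_space.prob_le_1[OF \<kappa>D(1)[OF ds]] by (intro mult_mono) auto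
          finally show ?thesis by simp
        qed
        finally show ?thesis using True by simp
      qed
    qed
    moreover have "(\<integral>c. \<epsilon> * indicator F c \<partial>C) = \<epsilon> * measure C F"
      using sets.sets_into_space[OF F] by (simp add: Int_absorb2)
    moreover have "(\<integral>c. a c \<partial>C) = \<sigma> * (measure (J n) ?Z - ?p)"
      unfolding a_def using int[OF Z] int\<kappa>[of "std.cyl l"] by (simp add: J_meas M_meas)
    ultimately show ?thesis by simp
  qed
  have "\<epsilon> * measure C F \<le> \<sigma> * (measure L ?Z - ?p)"
  proof (rule LIMSEQ_le)
    show "(\<lambda>k. \<sigma> * (measure (J (s k)) ?Z - ?p)) \<longlonglongrightarrow> \<sigma> * (measure L ?Z - ?p)"
      by (intro tendsto_intros lim)
    have "(\<lambda>n. \<epsilon> * measure C F - 1 / real n) \<longlonglongrightarrow> \<epsilon> * measure C F - 0"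
      by (intro tendsto_intros lim_1_over_n)
    from LIMSEQ_subseq_LIMSEQ[OF this s]
    show "(\<lambda>k. \<epsilon> * measure C F - 1 / real (s k)) \<longlonglongrightarrow> \<epsilon> * measure C F" by (simp add: comp_def)
    \<comment> \<open>From \<open>Suc (to_nat l)\<close> on, the cylinder \<open>l\<close> is among
      those recorded by the key, as \<open>s k \<ge> k\<close>.\<close>
    show "\<exists>N. \<forall>k\<ge>N. \<epsilon> * measure C F - 1 / real (s k) \<le> \<sigma> * (measure (J (s k)) ?Z - ?p)"
    proof (intro exI[of _ "Suc (to_nat l)"] allI impI dev)
      fix k assume "Suc (to_nat l) \<le> k"
      then show "to_nat l < s k" using seq_suble[OF s, of k] by simp
    qed
  qed
  moreover have "0 < \<epsilon> * measure C F" using \<epsilon> pos by (simp add: F_def)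
  ultimately have "measure L ?Z \<noteq> ?p" by auto
  moreover have "measure (M \<Otimes>\<^sub>M \<kappa> d) ?Z = ?p"
    using \<kappa>D[OF ds]
    by (simp add: measure_def sigma_finite_measure.emeasure_pair_measure_Times[OF prob_space_imp_sigma_finite] enn2real_mult)
  ultimately show thesis using that[OF L] by auto
qed

text \<open>Each section at a standard \<open>d\<close> is null by
  \<open>nondisjoint_section\<close>, so each \<open>nondisjoint\<close> set with positive threshold
  is null in the product. By \<open>mem_nondisjoint\<close> countably many of them cover the
  nondisjoint pairs of standard components.\<close>

lemma disjoint_component_pairs_full:
  assumes disj: "\<And>d. d \<in> standard_components \<Longrightarrow> disjoint_systems G M T (\<kappa> d) T"
  shows "emeasure (completion (C \<Otimes>\<^sub>M C)) (disjoint_component_pairs G T C \<kappa>) = 1"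
proof -
  interpret CC: pair_prob_space C C ..
  note [measurable] = nondisjoint_measurable
  have null: "AE p in C \<Otimes>\<^sub>M C. p \<notin> nondisjoint \<sigma> l l' (1 / real (Suc m))" if \<sigma>: "\<sigma> \<in> {1, -1}" for \<sigma> l l' m
  proof -
    let ?E = "nondisjoint \<sigma> l l' (1 / real (Suc m))"
    have "emeasure C ((\<lambda>c. (c, d)) -` ?E) = 0" for d
    proof (cases "d \<in> standard_components")
      case False
      then have "(\<lambda>c. (c, d)) -` ?E = {}" by (auto simp: nondisjoint_def)
      then show ?thesis by simp
    next
      case True
      have "measure C {c\<in>space C. (c, d) \<in> ?E} = 0"
      proof (rule ccontr)
        assume "measure C {c\<in>space C. (c, d) \<in> ?E} \<noteq> 0"
        then have "0 < measure C {c\<in>space C. (c, d) \<in> ?E}" by (simp add: zero_less_measure_iff)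
        from nondisjoint_section[OF True \<sigma> _ this]
        obtain L where "L \<in> joinings G M T (\<kappa> d) T" "L \<noteq> M \<Otimes>\<^sub>M \<kappa> d" by auto
        with disj[OF True] show False by (auto simp: disjoint_systems_def)
      qed
      moreover have "(\<lambda>c. (c, d)) -` ?E = {c\<in>space C. (c, d) \<in> ?E}" using standard_componentsD(1) by (auto simp: nondisjoint_def)
      ultimately show ?thesis by (simp add: C.emeasure_eq_measure)
    qed
    then have "emeasure (C \<Otimes>\<^sub>M C) ?E = 0"
      by (subst CC.emeasure_pair_measure_alt2) simp_all
    then show ?thesis by (intro AE_not_in) (simp add: null_sets_def)
  qed
  have "AE p in C \<Otimes>\<^sub>M C. p \<in> disjoint_component_pairs G T C \<kappa>"
  proof -
    have "AE p in C \<Otimes>\<^sub>M C. \<forall>l l' m. \<forall>\<sigma>\<in>{1, -1}. p \<notin> nondisjoint \<sigma> l l' (1 / real (Suc m))"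
      using null by (simp add: AE_all_countable AE_ball_countable del: of_nat_Suc)
    moreover have "AE p in C \<Otimes>\<^sub>M C. fst p \<in> standard_components"
    proof -
      have "AE c in distr (C \<Otimes>\<^sub>M C) C fst. c \<in> standard_components" unfolding C.distr_pair_fst by (rule standard_components_AE)
      then show ?thesis by (rule AE_distrD[rotated]) simp
    qed
    moreover have "AE p in C \<Otimes>\<^sub>M C. snd p \<in> standard_components"
    proof -
      have "AE c in distr (C \<Otimes>\<^sub>M C) C snd. c \<in> standard_components"
        unfolding distr_pair_snd[OF C.prob_space_axioms C.prob_space_axioms] by (rule standard_components_AE)
      then show ?thesis by (rule AE_distrD[rotated]) simp
    qed
    ultimately show ?thesis
    proof eventually_elim
      case (elim p)
      obtain c d where p: "p = (c, d)" by (cases p)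
      have "disjoint_systems G (\<kappa> c) T (\<kappa> d) T"
        using mem_nondisjoint[of c d] elim unfolding p by (metis fst_conv snd_conv)
      then show ?case using elim standard_componentsD(1) by (auto simp: disjoint_component_pairs_def p)
    qed
  qed
  then have ae: "AE p in completion (C \<Otimes>\<^sub>M C). p \<in> disjoint_component_pairs G T C \<kappa>"
    by (rule AE_completion)
  interpret comp: prob_space "completion (C \<Otimes>\<^sub>M C)" by (rule CC.prob_space_completion)
  \<comment> \<open>Measurability in the product itself is not claimed: the complement is contained
    in a null set, which is enough in the completion.\<close>
  have "disjoint_component_pairs G T C \<kappa> \<in> sets (completion (C \<Otimes>\<^sub>M C))"
  proof -
    obtain N where N: "{p\<in>space (C \<Otimes>\<^sub>M C). p \<notin> disjoint_component_pairs G T C \<kappa>} \<subseteq> N" "N \<in> null_sets (C \<Otimes>\<^sub>M C)"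
      using \<open>AE p in C \<Otimes>\<^sub>M C. p \<in> disjoint_component_pairs G T C \<kappa>\<close> by (auto simp: eventually_ae_filter)
    have "{p\<in>space (C \<Otimes>\<^sub>M C). p \<notin> disjoint_component_pairs G T C \<kappa>} \<in> null_sets (completion (C \<Otimes>\<^sub>M C))"
      using N by (auto simp: null_sets_completion_iff2)
    then have "space (completion (C \<Otimes>\<^sub>M C)) - {p\<in>space (C \<Otimes>\<^sub>M C). p \<notin> disjoint_component_pairs G T C \<kappa>} \<in> sets (completion (C \<Otimes>\<^sub>M C))"
      by (intro sets.compl_sets) auto
    also have "space (completion (C \<Otimes>\<^sub>M C)) - {p\<in>space (C \<Otimes>\<^sub>M C). p \<notin> disjoint_component_pairs G T C \<kappa>} = disjoint_component_pairs G T C \<kappa>"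
      by (auto simp: disjoint_component_pairs_def space_pair_measure)
    finally show ?thesis .
  qed
  then show ?thesis using ae comp.emeasure_space_1 by (intro comp.emeasure_eq_1_AE) auto
qed

end

section \<open>Nonatomic measures on the line\<close>

text \<open>Without atoms the distribution function \<open>F\<close> is continuous, so
  \<open>F (Q u) = u\<close> on (0, 1) for the quantile function \<open>Q\<close>, which in turn
  carries Lebesgue measure to \<open>\<rho>\<close>. The set \<open>R\<close> serves systems that
  live on part of the line.\<close>

lemma isomorphic_mod0_unit_lebesgue:
  fixes \<rho> :: "real measure"
  assumes \<rho>: "real_distribution \<rho>" and atomless: "\<And>t. measure \<rho> {t} = 0"
    and R[measurable]: "R \<in> sets borel" and R1: "measure \<rho> R = 1"
  shows "isomorphic_mod0 (restrict_space \<rho> R) unit_lebesgue"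
proof -
  interpret cdf_distribution \<rho> unfolding cdf_distribution_def by (rule \<rho>)
  let ?U = "restrict_space lborel {0<..<1::real}"
  define F where "F = cdf \<rho>"
  define Q where "Q u = (if u \<in> {0<..<1} then Inf {x. u \<le> F x} else 0)" for u
  have [measurable]: "F \<in> borel_measurable borel" unfolding F_def by (rule measurable_C)
  have "{x::real. 0 < x \<and> x < 1} = {0<..<1}" by auto
  then have Q[measurable]: "Q \<in> borel_measurable borel"
    unfolding Q_def F_def
    by (subst measurable_If_restrict_space_iff) (use measurable_CI in simp_all)
  have law: "distr ?U borel Q = \<rho>"
  proof -
    have "distr ?U borel Q = distr ?U borel (\<lambda>u. Inf {x. u \<le> cdf \<rho> x})"
      by (rule distr_cong) (auto simp: Q_def F_def space_restrict_space)
    then show ?thesis by (simp add: distr_I_eq_M)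
  qed
  have mU: "Q \<in> ?U \<rightarrow>\<^sub>M borel" by (rule measurable_restrict_space1) simp
  \<comment> \<open>One inequality is the defining property of a quantile; for the other,
    \<open>F\<close> is at most \<open>u\<close> to the left of \<open>Q u\<close>, and continuity
    extends this to \<open>Q u\<close> itself.\<close>
  have FQ: "F (Q u) = u" if u: "u \<in> {0<..<1}" for u
  proof (rule antisym)
    have ps: "u \<le> F x \<longleftrightarrow> Q u \<le> x" for x
      using pseudoinverse[of u x] u by (simp add: Q_def F_def)
    show "u \<le> F (Q u)" by (simp add: ps)
    have "isCont F (Q u)" unfolding F_def isCont_cdf by (rule atomless)
    then have lim: "(F \<longlongrightarrow> F (Q u)) (at_left (Q u))"
      by (auto simp: isCont_def intro: tendsto_within_subset)
    have "eventually (\<lambda>x. F x \<le> u) (at_left (Q u))"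
    proof (rule eventually_at_leftI[of "Q u - 1"])
      fix x assume "x \<in> {Q u - 1<..<Q u}"
      then show "F x \<le> u" using ps[of x] by auto
    qed simp
    then show "F (Q u) \<le> u"
      by (rule tendsto_upperbound[OF lim]) simp
  qed
  have F01: "F x \<in> {0..1}" for x
    using cdf_nonneg[of x] cdf_bounded_prob[of x] by (simp add: F_def)
  have R_AE: "AE t in \<rho>. t \<in> R" using prob_eq_1[of R] R1 by simp
  have R_ne: "R \<noteq> {}" using R1 by auto
  then obtain r0 where r0: "r0 \<in> R" by auto
  have spY: "space (restrict_space \<rho> R) = R" by (simp add: space_restrict_space)
  \<comment> \<open>The quantile function is used on (0, 1), whereas the model space is [0, 1]; the
    endpoints are null.\<close>
  have unit_AE: "(AE u in unit_lebesgue. P u) \<longleftrightarrow> (AE u in ?U. P u)" for P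
  proof -
    have "AE u in lborel. u \<noteq> (0::real)" "AE u in lborel. u \<noteq> (1::real)"
      by (rule AE_lborel_singleton)+
    then have "(AE u in lborel. u \<in> {0..1} \<longrightarrow> P u) \<longleftrightarrow> (AE u in lborel. u \<in> {0<..<1} \<longrightarrow> P u)"
      by (auto elim!: eventually_elim2 eventually_elim2[rotated] simp: order_le_less) 
    then show ?thesis
      unfolding unit_lebesgue_def by (simp add: AE_restrict_space_iff)
  qed
  \<comment> \<open>The inverse has to map into \<open>R\<close> everywhere, so the null set of bad
    arguments is sent to \<open>r0\<close>.\<close>
  define h where "h u = (if Q u \<in> R then Q u else r0)" for u
  have QR: "AE u in ?U. Q u \<in> R"
    using R_AE unfolding law[symmetric] by (rule AE_distrD[OF mU])
  have [measurable]: "Measurable.pred borel (\<lambda>t. Q (F t) = t)" by measurable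
  show ?thesis
    unfolding isomorphic_mod0_def
  proof (intro exI conjI)
    show F_meas: "F \<in> restrict_space \<rho> R \<rightarrow>\<^sub>M unit_lebesgue"
      unfolding measurable_cong_sets[OF refl sets_unit_lebesgue]
      by (rule measurable_restrict_space2) (use F01 in \<open>auto intro!: measurable_restrict_space1\<close>)
    have "h \<in> borel \<rightarrow>\<^sub>M borel" unfolding h_def by measurable
    then have hm: "h \<in> restrict_space borel {0..1} \<rightarrow>\<^sub>M borel" by (rule measurable_restrict_space1)
    show "h \<in> unit_lebesgue \<rightarrow>\<^sub>M restrict_space \<rho> R"
    proof (rule measurable_restrict_space2)
      show "h \<in> space unit_lebesgue \<rightarrow> R" using r0 by (auto simp: h_def)
      show "h \<in> unit_lebesgue \<rightarrow>\<^sub>M \<rho>"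
        unfolding measurable_cong_sets[OF sets_unit_lebesgue events_eq_borel] by (rule hm)
    qed
    show "distr (restrict_space \<rho> R) unit_lebesgue F = unit_lebesgue"
    proof (rule measure_eqI)
      fix A assume "A \<in> sets (distr (restrict_space \<rho> R) unit_lebesgue F)"
      then have A: "A \<in> sets unit_lebesgue" by simp
      then have Ab[measurable]: "A \<in> sets borel" and A01: "A \<subseteq> {0..1}"
        unfolding sets_unit_lebesgue by (auto simp: sets_restrict_space)
      have FA: "F -` A \<in> sets borel"
        using measurable_sets[of F borel borel A] by simp
      have "emeasure (distr (restrict_space \<rho> R) unit_lebesgue F) A = emeasure (restrict_space \<rho> R) (F -` A \<inter> R)"
        using emeasure_distr[OF F_meas A] by (simp add: spY)
      also have "\<dots> = emeasure \<rho> (F -` A \<inter> R)" using FA by (subst emeasure_restrict_space) auto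
      also have "\<dots> = emeasure \<rho> (F -` A)"
        using R_AE FA by (intro emeasure_eq_AE) (auto elim!: eventually_mono)
      also have "\<dots> = emeasure (distr ?U borel Q) (F -` A)" by (simp add: law)
      also have "\<dots> = emeasure ?U (Q -` (F -` A) \<inter> space ?U)" using FA by (intro emeasure_distr mU) simp
      also have "Q -` (F -` A) \<inter> space ?U = A \<inter> {0<..<1}"
        using FQ by (auto simp: space_restrict_space)
      also have "emeasure ?U \<dots> = emeasure lborel (A \<inter> {0<..<1})" by (subst emeasure_restrict_space) auto
      also have "\<dots> = emeasure lborel A"
      proof (rule emeasure_eq_AE)
        have "AE u in lborel. u \<noteq> (0::real)" "AE u in lborel. u \<noteq> (1::real)" by (rule AE_lborel_singleton)+
        then show "AE u in lborel. u \<in> A \<inter> {0<..<1} \<longleftrightarrow> u \<in> A"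
          by eventually_elim (use A01 in fastforce)
      qed auto
      also have "\<dots> = emeasure unit_lebesgue A"
        using A01 unfolding unit_lebesgue_def by (subst emeasure_restrict_space) auto
      finally show "emeasure (distr (restrict_space \<rho> R) unit_lebesgue F) A = emeasure unit_lebesgue A" .
    qed simp
    show "AE u in unit_lebesgue. F (h u) = u"
      unfolding unit_AE using QR AE_space by eventually_elim (simp add: h_def FQ space_restrict_space)
    have "AE u in ?U. Q (F (Q u)) = Q u" using AE_space by eventually_elim (simp add: FQ space_restrict_space)
    then have "AE t in distr ?U borel Q. Q (F t) = t"
      by (subst AE_distr_iff[OF mU]) auto
    then have "AE t in \<rho>. Q (F t) = t" by (simp only: law)
    then show "AE t in restrict_space \<rho> R. h (F t) = t"
      by (subst AE_restrict_space_iff) (auto simp: h_def elim!: eventually_mono)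
  qed
qed

section \<open>Bernoulli shifts\<close>

locale bernoulli =
  fixes G :: "('g, 'k) monoid_scheme" (structure)
  assumes G: "group G" "countable (carrier G)" and inf: "infinite (carrier G)"
begin

definition coin :: "bool measure" where "coin = measure_pmf (pmf_of_set UNIV)"

definition B :: "('g \<Rightarrow> bool) measure" where "B = Pi\<^sub>M (carrier G) (\<lambda>_. coin)"

text \<open>Right multiplication of the index yields a left action:
  \<open>shift (g \<otimes> h)\<close> is \<open>shift g\<close> after \<open>shift h\<close>.
  Points of \<open>B\<close> are extensional functions, hence the restriction.\<close>

definition shift :: "'g \<Rightarrow> ('g \<Rightarrow> bool) \<Rightarrow> 'g \<Rightarrow> bool" where
  "shift g \<omega> = (\<lambda>h\<in>carrier G. \<omega> (h \<otimes>\<^bsub>G\<^esub> g))"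

sublocale group G by (rule G)

lemma coin: "prob_space coin" unfolding coin_def by (rule prob_space_measure_pmf)

sublocale B: product_prob_space "\<lambda>_. coin" "carrier G"
  by (rule product_prob_spaceI) (rule coin)

lemma sets_coin[simp, measurable_cong]: "sets coin = sets (count_space UNIV)" by (simp add: coin_def)

lemma space_coin[simp]: "space coin = UNIV" by (simp add: coin_def)

lemma B: "prob_space B" unfolding B_def by (rule prob_space_PiM) (rule coin)

lemma space_B: "space B = carrier G \<rightarrow>\<^sub>E UNIV"
  by (simp add: B_def space_PiM)

lemma coord_measurable[measurable]: "h \<in> carrier G \<Longrightarrow> Measurable.pred B (\<lambda>\<omega>. \<omega> h)"
proof -
  assume "h \<in> carrier G"
  then have "(\<lambda>\<omega>. \<omega> h) \<in> B \<rightarrow>\<^sub>M coin" unfolding B_def by (rule measurable_component_singleton)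
  then show ?thesis unfolding measurable_cong_sets[OF refl sets_coin] .
qed

lemma measurable_into_B:
  assumes "\<And>h. h \<in> carrier G \<Longrightarrow> Measurable.pred N (\<lambda>x. F x h)" "\<And>x. x \<in> space N \<Longrightarrow> F x \<in> extensional (carrier G)"
  shows "F \<in> N \<rightarrow>\<^sub>M B"
  unfolding B_def
proof (rule measurable_PiM_single')
  show "(\<lambda>x. F x h) \<in> N \<rightarrow>\<^sub>M coin" if "h \<in> carrier G" for h
    unfolding measurable_cong_sets[OF refl sets_coin] by (rule assms(1)[OF that])
  show "F \<in> space N \<rightarrow> (\<Pi>\<^sub>E h\<in>carrier G. space coin)"
    using assms(2) by (auto simp: PiE_def)
qed

lemma shift_measurable[measurable]: "g \<in> carrier G \<Longrightarrow> shift g \<in> B \<rightarrow>\<^sub>M B"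
  by (rule measurable_into_B) (auto simp: shift_def)

lemma shift_invariant:
  assumes g: "g \<in> carrier G"
  shows "distr B B (shift g) = B"
proof -
  have "inj_on (\<lambda>h. h \<otimes> g) (carrier G)" using g by (auto intro!: inj_onI)
  moreover have "(\<lambda>h. h \<otimes> g) \<in> carrier G \<rightarrow> carrier G" using g by auto
  ultimately have "distr (Pi\<^sub>M (carrier G) (\<lambda>_. coin)) (Pi\<^sub>M (carrier G) (\<lambda>_. coin)) (\<lambda>\<omega>. \<lambda>h\<in>carrier G. \<omega> (h \<otimes> g)) = Pi\<^sub>M (carrier G) (\<lambda>_. coin)"
    using distr_PiM_reindex[of "carrier G" "\<lambda>_. coin" "\<lambda>h. h \<otimes> g" "carrier G"] coin by simp
  then show ?thesis by (simp add: B_def shift_def[abs_def])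
qed

lemma cylinder_eq_prod_emb:
  assumes "J \<subseteq> carrier G"
  shows "{\<omega>\<in>space B. \<forall>h\<in>J. \<omega> h \<in> F h} = prod_emb (carrier G) (\<lambda>_. coin) J (Pi\<^sub>E J F)"
  using assms by (auto simp: prod_emb_def space_B PiE_iff Pi_iff extensional_def)

lemma cylinder_sets:
  assumes "finite J" "J \<subseteq> carrier G"
  shows "{\<omega>\<in>space B. \<forall>h\<in>J. \<omega> h \<in> F h} \<in> sets B"
  using assms by (subst cylinder_eq_prod_emb[OF assms(2)]) (auto simp: B_def intro!: sets_PiM_I)

lemma emeasure_cylinder:
  assumes "finite J" "J \<subseteq> carrier G"
  shows "emeasure B {\<omega>\<in>space B. \<forall>h\<in>J. \<omega> h \<in> F h} = (\<Prod>h\<in>J. emeasure coin (F h))"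
  using assms B.emeasure_PiM_emb[of J F] by (subst cylinder_eq_prod_emb[OF assms(2)]) (simp add: B_def)

definition splice :: "'g set \<Rightarrow> ('g \<Rightarrow> bool) \<times> ('g \<Rightarrow> bool) \<Rightarrow> 'g \<Rightarrow> bool" where
  "splice K p = (\<lambda>h\<in>carrier G. if h \<in> K then fst p h else snd p h)"

lemma splice_measurable[measurable]: "splice K \<in> B \<Otimes>\<^sub>M B \<rightarrow>\<^sub>M B"
proof (rule measurable_into_B)
  fix h assume h[measurable]: "h \<in> carrier G"
  show "Measurable.pred (B \<Otimes>\<^sub>M B) (\<lambda>x. splice K x h)"
    using h by (cases "h \<in> K") (simp_all add: splice_def)
qed (simp add: splice_def)

text \<open>Resampling the coordinates outside \<open>K\<close> independently leaves the law of
  independent coins unchanged, as is seen on finite cylinders.\<close>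

lemma distr_splice: "distr (B \<Otimes>\<^sub>M B) B (splice K) = B"
proof -
  interpret BB: prob_space B by (rule B)
  have "distr (B \<Otimes>\<^sub>M B) B (splice K) = Pi\<^sub>M (carrier G) (\<lambda>_. coin)"
  proof (rule measure_eqI_PiM_infinite)
    show "sets (distr (B \<Otimes>\<^sub>M B) B (splice K)) = sets (Pi\<^sub>M (carrier G) (\<lambda>_. coin))" by (simp add: B_def)
    fix J F assume J: "finite J" "J \<subseteq> carrier G" and F: "\<And>j. j \<in> J \<Longrightarrow> F j \<in> sets coin"
    have m: "{\<omega>\<in>space B. \<forall>h\<in>J'. \<omega> h \<in> F h} \<in> sets B" if "J' \<subseteq> J" for J'
      using that J by (intro cylinder_sets) (auto intro: finite_subset)
    have "emeasure (distr (B \<Otimes>\<^sub>M B) B (splice K)) {\<omega>\<in>space B. \<forall>h\<in>J. \<omega> h \<in> F h} =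
      emeasure (B \<Otimes>\<^sub>M B) (splice K -` {\<omega>\<in>space B. \<forall>h\<in>J. \<omega> h \<in> F h} \<inter> space (B \<Otimes>\<^sub>M B))"
      by (intro emeasure_distr splice_measurable m) simp
    also have "splice K -` {\<omega>\<in>space B. \<forall>h\<in>J. \<omega> h \<in> F h} \<inter> space (B \<Otimes>\<^sub>M B) =
      {\<omega>\<in>space B. \<forall>h\<in>J \<inter> K. \<omega> h \<in> F h} \<times> {\<omega>\<in>space B. \<forall>h\<in>J - K. \<omega> h \<in> F h}"
    proof (rule Set.set_eqI)
      fix p
      show "p \<in> splice K -` {\<omega>\<in>space B. \<forall>h\<in>J. \<omega> h \<in> F h} \<inter> space (B \<Otimes>\<^sub>M B) \<longleftrightarrow>
        p \<in> {\<omega>\<in>space B. \<forall>h\<in>J \<inter> K. \<omega> h \<in> F h} \<times> {\<omega>\<in>space B. \<forall>h\<in>J - K. \<omega> h \<in> F h}"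
      proof (cases "p \<in> space (B \<Otimes>\<^sub>M B)")
        case True
        then have "splice K p \<in> space B" by (rule measurable_space[OF splice_measurable])
        moreover have "splice K p h = (if h \<in> K then fst p h else snd p h)" if "h \<in> J" for h
          using that J(2) by (auto simp: splice_def)
        ultimately show ?thesis using True by (auto simp: space_pair_measure split: if_splits)
      qed (auto simp: space_pair_measure)
    qed
    also have "emeasure (B \<Otimes>\<^sub>M B) \<dots> = emeasure B {\<omega>\<in>space B. \<forall>h\<in>J \<inter> K. \<omega> h \<in> F h} * emeasure B {\<omega>\<in>space B. \<forall>h\<in>J - K. \<omega> h \<in> F h}"
      by (intro BB.emeasure_pair_measure_Times m) auto
    also have "\<dots> = (\<Prod>h\<in>J \<inter> K. emeasure coin (F h)) * (\<Prod>h\<in>J - K. emeasure coin (F h))"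
      using J by (subst (1 2) emeasure_cylinder) auto
    also have "\<dots> = (\<Prod>h\<in>J. emeasure coin (F h))"
      using J(1) by (subst prod.union_disjoint[symmetric]) (auto simp: Int_Diff_Un)
    also have "\<dots> = emeasure B {\<omega>\<in>space B. \<forall>h\<in>J. \<omega> h \<in> F h}"
      by (rule emeasure_cylinder[OF J, symmetric])
    finally show "emeasure (distr (B \<Otimes>\<^sub>M B) B (splice K)) (prod_emb (carrier G) (\<lambda>_. coin) J (Pi\<^sub>E J F)) =
        emeasure (Pi\<^sub>M (carrier G) (\<lambda>_. coin)) (prod_emb (carrier G) (\<lambda>_. coin) J (Pi\<^sub>E J F))"
      unfolding cylinder_eq_prod_emb[OF J(2)] by (simp only: B_def)
  next
    show "finite_measure (distr (B \<Otimes>\<^sub>M B) B (splice K))"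
      by (intro finite_measure.finite_measure_distr prob_space.finite_measure prob_space_pair B splice_measurable)
  qed simp
  then show ?thesis by (simp add: B_def)
qed

definition depends_on :: "'g set \<Rightarrow> ('g \<Rightarrow> bool) set \<Rightarrow> bool" where
  "depends_on K A \<longleftrightarrow> (\<forall>\<omega>\<in>space B. \<forall>\<omega>'\<in>space B. (\<forall>h\<in>K. \<omega> h = \<omega>' h) \<longrightarrow> (\<omega> \<in> A \<longleftrightarrow> \<omega>' \<in> A))"

text \<open>After splicing two independent samples, \<open>A\<close> reads only the first and
  \<open>A'\<close> only the second, so their intersection pulls back to the rectangle
  \<open>A \<times> A'\<close>.\<close>

lemma indep_depends_on:
  assumes A: "A \<in> sets B" "depends_on K A" and A': "A' \<in> sets B" "depends_on K' A'"
    and K: "K \<subseteq> carrier G" "K' \<subseteq> carrier G" "K \<inter> K' = {}"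
  shows "measure B (A \<inter> A') = measure B A * measure B A'"
proof -
  interpret BB: prob_space B by (rule B)
  have "emeasure B (A \<inter> A') = emeasure (distr (B \<Otimes>\<^sub>M B) B (splice K)) (A \<inter> A')" by (simp add: distr_splice)
  also have "\<dots> = emeasure (B \<Otimes>\<^sub>M B) (splice K -` (A \<inter> A') \<inter> space (B \<Otimes>\<^sub>M B))"
    using A(1) A'(1) by (intro emeasure_distr) auto
  also have "splice K -` (A \<inter> A') \<inter> space (B \<Otimes>\<^sub>M B) = A \<times> A'"
  proof (rule Set.set_eqI)
    fix p
    show "p \<in> splice K -` (A \<inter> A') \<inter> space (B \<Otimes>\<^sub>M B) \<longleftrightarrow> p \<in> A \<times> A'"
    proof (cases "p \<in> space (B \<Otimes>\<^sub>M B)")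
      case True
      then have s: "splice K p \<in> space B" "fst p \<in> space B" "snd p \<in> space B"
        using measurable_space[OF splice_measurable[of K] True] by (auto simp: space_pair_measure)
      have "\<forall>h\<in>K. splice K p h = fst p h" using K(1) by (auto simp: splice_def)
      then have 1: "splice K p \<in> A \<longleftrightarrow> fst p \<in> A" using A(2) s unfolding depends_on_def by blast
      have "\<forall>h\<in>K'. splice K p h = snd p h" using K(2,3) by (auto simp: splice_def)
      then have 2: "splice K p \<in> A' \<longleftrightarrow> snd p \<in> A'" using A'(2) s unfolding depends_on_def by blast
      show ?thesis using True 1 2 by (simp add: mem_Times_iff)
    next
      case False
      then show ?thesis using sets.sets_into_space[OF A(1)] sets.sets_into_space[OF A'(1)] by (auto simp: space_pair_measure)
    qed
  qed
  also have "emeasure (B \<Otimes>\<^sub>M B) (A \<times> A') = emeasure B A * emeasure B A'"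
    using A(1) A'(1) by (rule BB.emeasure_pair_measure_Times)
  finally show ?thesis by (simp add: measure_def enn2real_mult)
qed

text \<open>Prescribing \<open>n\<close> coordinates has probability \<open>(1/2) ^ n\<close>, and
  an infinite group offers any number of them. The extension by the shift owes its nonatomicity to
  this.\<close>

lemma singleton_null: "emeasure B {\<omega>} = 0"
proof -
  interpret BB: prob_space B by (rule B)
  have "emeasure B {\<omega>} \<le> ennreal ((1/2) ^ n)" for n
  proof -
    obtain J where J: "J \<subseteq> carrier G" "finite J" "card J = n"
      using infinite_arbitrarily_large[OF inf] by blast
    have "emeasure B {\<omega>} \<le> emeasure B {\<omega>'\<in>space B. \<forall>h\<in>J. \<omega>' h \<in> {\<omega> h}}"
    proof (cases "\<omega> \<in> space B")
      case True
      then show ?thesis by (intro emeasure_mono cylinder_sets J) auto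
    next
      case False
      then have "{\<omega>} \<notin> sets B" using sets.sets_into_space by auto
      then show ?thesis by (simp add: emeasure_notin_sets)
    qed
    also have "\<dots> = (\<Prod>h\<in>J. emeasure coin {\<omega> h})" by (rule emeasure_cylinder[OF J(2,1)])
    also have "\<dots> = (\<Prod>h\<in>J. ennreal (1/2))"
      by (intro prod.cong) (auto simp: coin_def emeasure_pmf_single pmf_of_set)
    also have "\<dots> = ennreal (1/2) ^ n" using J by (simp only: prod_constant)
    also have "\<dots> = ennreal ((1/2) ^ n)" by (rule ennreal_power) simp
    finally show ?thesis .
  qed
  then have "measure B {\<omega>} \<le> (1/2) ^ n" for n by (simp add: BB.emeasure_eq_measure)
  moreover have "(\<lambda>n. (1/2::real) ^ n) \<longlonglongrightarrow> 0" by (rule LIMSEQ_power_zero) simp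
  ultimately have "measure B {\<omega>} \<le> 0" by (intro LIMSEQ_le_const) auto
  then have "measure B {\<omega>} = 0" using measure_nonneg[of B "{\<omega>}"] by linarith
  then show ?thesis by (simp add: BB.emeasure_eq_measure)
qed

text \<open>It suffices that \<open>g\<close> avoids the finitely many elements
  \<open>inv h \<otimes> k\<close> with \<open>h\<close> and \<open>k\<close> in
  \<open>K\<close>.\<close>

lemma exists_disjoint_translate:
  assumes K: "finite K" "K \<subseteq> carrier G"
  obtains g where "g \<in> carrier G" "K \<inter> (\<lambda>h. h \<otimes> g) ` K = {}"
proof -
  have "finite ((\<lambda>(h, k). inv h \<otimes> k) ` (K \<times> K))" using K by auto
  then obtain g where g: "g \<in> carrier G" "g \<notin> (\<lambda>(h, k). inv h \<otimes> k) ` (K \<times> K)"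
    using inf by (meson ex_new_if_finite finite_subset subsetI)
  have "K \<inter> (\<lambda>h. h \<otimes> g) ` K = {}"
  proof (rule ccontr)
    assume "K \<inter> (\<lambda>h. h \<otimes> g) ` K \<noteq> {}"
    then obtain h where h: "h \<in> K" "h \<otimes> g \<in> K" by auto
    then have "g = inv h \<otimes> (h \<otimes> g)" using K(2) g(1) by (auto simp: m_assoc[symmetric])
    then have "g \<in> (\<lambda>(h, k). inv h \<otimes> k) ` (K \<times> K)" using h by (intro image_eqI[of _ _ "(h, h \<otimes> g)"]) auto
    with g(2) show False by simp
  qed
  with g(1) show thesis by (rule that)
qed


section \<open>Approximation by finitely many coordinates and ergodicity of the product\<close>

definition cylindrical :: "'a measure \<Rightarrow> 'g set \<Rightarrow> ('a \<times> ('g \<Rightarrow> bool)) set \<Rightarrow> bool" where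
  "cylindrical M K A \<longleftrightarrow> finite K \<and> K \<subseteq> carrier G \<and> A \<in> sets (M \<Otimes>\<^sub>M B) \<and>
     (\<forall>x\<in>space M. depends_on K (Pair x -` A))"

lemma cylindrical_compl:
  "cylindrical M K A \<Longrightarrow> cylindrical M K (space (M \<Otimes>\<^sub>M B) - A)"
  unfolding cylindrical_def
proof (elim conjE, intro conjI ballI)
  fix x assume x: "x \<in> space M" and d: "\<forall>x\<in>space M. depends_on K (Pair x -` A)"
  have "(x, \<omega>) \<in> space (M \<Otimes>\<^sub>M B)" if "\<omega> \<in> space B" for \<omega> using x that by (simp add: space_pair_measure)
  moreover have "depends_on K (Pair x -` A)" using d x by blast
  ultimately show "depends_on K (Pair x -` (space (M \<Otimes>\<^sub>M B) - A))" unfolding depends_on_def by blast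
qed (auto intro: sets.compl_sets)

lemma cylindrical_UN:
  assumes "finite I" "\<And>i. i \<in> I \<Longrightarrow> cylindrical M (K i) (A i)"
  shows "cylindrical M (\<Union>i\<in>I. K i) (\<Union>i\<in>I. A i)"
  unfolding cylindrical_def
proof (intro conjI ballI)
  have c: "finite (K i)" "K i \<subseteq> carrier G" "A i \<in> sets (M \<Otimes>\<^sub>M B)" if "i \<in> I" for i
    using assms(2)[OF that] by (simp_all add: cylindrical_def)
  show "finite (\<Union>i\<in>I. K i)" using assms(1) c(1) by blast
  show "(\<Union>i\<in>I. K i) \<subseteq> carrier G" using c(2) by blast
  show "(\<Union>i\<in>I. A i) \<in> sets (M \<Otimes>\<^sub>M B)" using assms(1) c(3) by (rule sets.finite_UN)
  fix x assume x: "x \<in> space M"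
  show "depends_on (\<Union>i\<in>I. K i) (Pair x -` (\<Union>i\<in>I. A i))"
    unfolding depends_on_def
  proof (intro ballI impI)
    fix \<omega> \<omega>' assume \<omega>: "\<omega> \<in> space B" "\<omega>' \<in> space B" and eq: "\<forall>h\<in>\<Union>i\<in>I. K i. \<omega> h = \<omega>' h"
    have "(x, \<omega>) \<in> A i \<longleftrightarrow> (x, \<omega>') \<in> A i" if "i \<in> I" for i
    proof -
      have "depends_on (K i) (Pair x -` A i)" using assms(2)[OF that] x by (simp add: cylindrical_def)
      moreover have "\<forall>h\<in>K i. \<omega> h = \<omega>' h" using eq that by auto
      ultimately show ?thesis using \<omega> unfolding depends_on_def by blast
    qed
    then show "\<omega> \<in> Pair x -` (\<Union>i\<in>I. A i) \<longleftrightarrow> \<omega>' \<in> Pair x -` (\<Union>i\<in>I. A i)" by auto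
  qed
qed

definition approximable :: "'a measure \<Rightarrow> ('a \<times> ('g \<Rightarrow> bool)) set \<Rightarrow> bool" where
  "approximable M A \<longleftrightarrow> A \<in> sets (M \<Otimes>\<^sub>M B) \<and>
     (\<forall>\<epsilon>>0. \<exists>K A'. cylindrical M K A' \<and> measure (M \<Otimes>\<^sub>M B) ((A - A') \<union> (A' - A)) < \<epsilon>)"

lemma cylindrical_approximable: "cylindrical M K A \<Longrightarrow> approximable M A"
  unfolding approximable_def by (auto simp: cylindrical_def intro!: exI[of _ K] exI[of _ A])

lemma sigma_algebra_approximable:
  assumes M: "prob_space M"
  shows "sigma_algebra (space (M \<Otimes>\<^sub>M B)) {A. approximable M A}"
proof -
  let ?N = "M \<Otimes>\<^sub>M B"
  interpret N: prob_space ?N by (rule prob_space_pair[OF M B])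
  show ?thesis
    unfolding sigma_algebra_iff2
  proof (intro conjI ballI allI impI)
    show "{A. approximable M A} \<subseteq> Pow (space ?N)"
      using sets.sets_into_space by (auto simp: approximable_def)
    have "cylindrical M {} {}" by (simp add: cylindrical_def depends_on_def)
    then show "{} \<in> {A. approximable M A}" using cylindrical_approximable by blast
  next
    fix A assume "A \<in> {A. approximable M A}"
    then have A: "approximable M A" by simp
    have "approximable M (space ?N - A)"
      unfolding approximable_def
    proof (intro conjI allI impI)
      show "space ?N - A \<in> sets ?N" using A by (auto simp: approximable_def)
      fix \<epsilon> :: real assume "0 < \<epsilon>"
      then obtain K A' where A': "cylindrical M K A'" "measure ?N ((A - A') \<union> (A' - A)) < \<epsilon>"
        using A unfolding approximable_def by blast
      have "A \<subseteq> space ?N" "A' \<subseteq> space ?N"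
        using A A'(1) sets.sets_into_space by (auto simp: approximable_def cylindrical_def)
      then have "((space ?N - A) - (space ?N - A')) \<union> ((space ?N - A') - (space ?N - A)) = (A - A') \<union> (A' - A)" by auto
      then show "\<exists>K A'. cylindrical M K A' \<and> measure ?N (((space ?N - A) - A') \<union> (A' - (space ?N - A))) < \<epsilon>"
        using A'(2) cylindrical_compl[OF A'(1)] by (intro exI[of _ K] exI[of _ "space ?N - A'"]) simp
    qed
    then show "space ?N - A \<in> {A. approximable M A}" by simp
  next
    fix A :: "nat \<Rightarrow> _" assume "range A \<subseteq> {A. approximable M A}"
    then have A: "approximable M (A i)" for i by auto
    have As[measurable]: "A i \<in> sets ?N" for i using A by (simp add: approximable_def)
    have "approximable M (\<Union>i. A i)"
      unfolding approximable_def
    proof (intro conjI allI impI)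
      show "(\<Union>i. A i) \<in> sets ?N" by measurable
      fix \<epsilon> :: real assume \<epsilon>: "0 < \<epsilon>"
      have "(\<lambda>n. measure ?N (\<Union>i<n. A i)) \<longlonglongrightarrow> measure ?N (\<Union>n. \<Union>i<n. A i)"
      proof (rule N.finite_Lim_measure_incseq)
        show "incseq (\<lambda>n. \<Union>i<n. A i)" by (rule monoI, rule UN_mono) auto
      qed auto
      also have "(\<Union>n. \<Union>i<n. A i) = (\<Union>i. A i)" by (auto intro: lessI)
      finally have "\<forall>\<^sub>F n in sequentially. measure ?N (\<Union>i. A i) - \<epsilon>/2 < measure ?N (\<Union>i<n. A i)"
        using \<epsilon> by (intro order_tendstoD(1)) auto
      then obtain n where n: "measure ?N (\<Union>i. A i) - \<epsilon>/2 < measure ?N (\<Union>i<n. A i)"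
        by (auto dest: eventually_happens)
      \<comment> \<open>Cutting the union off after \<open>n\<close> terms has cost less than
        \<open>\<epsilon>/2\<close>; the \<open>n\<close> approximations share the other half.
        \<open>Suc n\<close> avoids a division by zero.\<close>
      define \<delta> where "\<delta> = \<epsilon> / (2 * real (Suc n))"
      have \<delta>: "0 < \<delta>" "real n * \<delta> \<le> \<epsilon>/2" using \<epsilon> by (auto simp: \<delta>_def field_simps)
      have "\<forall>i. \<exists>K A'. cylindrical M K A' \<and> measure ?N ((A i - A') \<union> (A' - A i)) < \<delta>"
        using A \<delta>(1) unfolding approximable_def by blast
      then obtain K A' where A': "\<And>i. cylindrical M (K i) (A' i)" and d: "\<And>i. measure ?N ((A i - A' i) \<union> (A' i - A i)) < \<delta>"
        by metis
      have [measurable]: "A' i \<in> sets ?N" for i using A' by (simp add: cylindrical_def)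
      let ?A' = "\<Union>i<n. A' i"
      have "measure ?N (((\<Union>i. A i) - ?A') \<union> (?A' - (\<Union>i. A i))) \<le>
        measure ?N (((\<Union>i. A i) - (\<Union>i<n. A i)) \<union> (\<Union>i<n. (A i - A' i) \<union> (A' i - A i)))"
        by (rule N.finite_measure_mono) auto
      also have "\<dots> \<le> measure ?N ((\<Union>i. A i) - (\<Union>i<n. A i)) + measure ?N (\<Union>i<n. (A i - A' i) \<union> (A' i - A i))"
        by (rule measure_Un_le) auto
      also have "measure ?N ((\<Union>i. A i) - (\<Union>i<n. A i)) = measure ?N (\<Union>i. A i) - measure ?N (\<Union>i<n. A i)"
        by (rule N.finite_measure_Diff) auto
      also have "measure ?N (\<Union>i<n. (A i - A' i) \<union> (A' i - A i)) \<le> (\<Sum>i<n. measure ?N ((A i - A' i) \<union> (A' i - A i)))"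
        by (rule N.finite_measure_subadditive_finite) auto
      also have "\<dots> \<le> (\<Sum>i<n. \<delta>)" by (intro sum_mono less_imp_le d)
      also have "\<dots> \<le> \<epsilon>/2" using \<delta>(2) by simp
      finally have "measure ?N (((\<Union>i. A i) - ?A') \<union> (?A' - (\<Union>i. A i))) < \<epsilon>" using n by simp
      moreover have "cylindrical M (\<Union>i<n. K i) ?A'" by (rule cylindrical_UN) (auto simp: A')
      ultimately show "\<exists>K A'. cylindrical M K A' \<and> measure ?N (((\<Union>i. A i) - A') \<union> (A' - (\<Union>i. A i))) < \<epsilon>" by blast
    qed
    then show "(\<Union>i. A i) \<in> {A. approximable M A}" by simp
  qed
qed

text \<open>The approximable sets form a sigma-algebra for which both projections are measurable, so
  it contains the whole product sigma-algebra.\<close>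

lemma approximable_sets:
  assumes M: "prob_space M" and A: "A \<in> sets (M \<Otimes>\<^sub>M B)"
  shows "approximable M A"
proof -
  let ?N = "M \<Otimes>\<^sub>M B"
  interpret sigma_algebra "space ?N" "{A. approximable M A}" by (rule sigma_algebra_approximable[OF M])
  define D where "D = sigma (space ?N) {A. approximable M A}"
  have sD: "sets D = {A. approximable M A}" "space D = space ?N"
    unfolding D_def by (simp_all add: sets_measure_of_eq space_measure_of_conv)
  have "fst \<in> D \<rightarrow>\<^sub>M M"
  proof (rule measurableI)
    show "fst x \<in> space M" if "x \<in> space D" for x using that by (auto simp: sD space_pair_measure)
    fix X assume X[measurable]: "X \<in> sets M"
    have "cylindrical M {} (X \<times> space B)"
      by (auto simp: cylindrical_def depends_on_def)
    moreover have "fst -` X \<inter> space D = X \<times> space B"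
      using sets.sets_into_space[OF X] by (auto simp: sD space_pair_measure)
    ultimately show "fst -` X \<inter> space D \<in> sets D" using cylindrical_approximable by (auto simp: sD)
  qed
  moreover have "snd \<in> D \<rightarrow>\<^sub>M B"
  proof (rule measurable_into_B)
    fix h assume h[measurable]: "h \<in> carrier G"
    have "{p\<in>space ?N. snd p h} \<in> sets ?N" by measurable
    then have "cylindrical M {h} {p\<in>space ?N. snd p h}"
      using h by (auto simp: cylindrical_def depends_on_def space_pair_measure)
    then have "{p\<in>space D. snd p h} \<in> sets D" using cylindrical_approximable by (auto simp: sD)
    then show "Measurable.pred D (\<lambda>p. snd p h)" by (simp add: pred_def)
  next
    fix p assume "p \<in> space D"
    then show "snd p \<in> extensional (carrier G)" by (auto simp: sD space_pair_measure space_B PiE_def)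
  qed
  ultimately have "(\<lambda>p. (fst p, snd p)) \<in> D \<rightarrow>\<^sub>M ?N" by (rule measurable_Pair)
  from measurable_sets[OF this A] have "A \<inter> space D \<in> sets D" by simp
  then show ?thesis using sets.sets_into_space[OF A] by (simp add: sD Int_absorb2)
qed

text \<open>An invariant set is approximated by one that depends on finitely many coordinates, and
  a translate of the latter is conditionally independent of it.\<close>
lemma product_ergodic:
  assumes erg: "ergodic_system G M T" and A: "A \<in> sets (M \<Otimes>\<^sub>M B)"
    and inv: "\<And>g x \<omega>. \<lbrakk>g \<in> carrier G; x \<in> space M; \<omega> \<in> space B\<rbrakk> \<Longrightarrow> (T g x, shift g \<omega>) \<in> A \<longleftrightarrow> (x, \<omega>) \<in> A"
  shows "measure (M \<Otimes>\<^sub>M B) A = 0 \<or> measure (M \<Otimes>\<^sub>M B) A = 1"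
proof -
  have pmp: "pmp_system G M T" using erg by (simp add: ergodic_system_def)
  note D = pmp_systemD[OF pmp G(1)]
  let ?N = "M \<Otimes>\<^sub>M B"
  interpret M: prob_space M by (rule D(1))
  interpret BB: prob_space B by (rule B)
  interpret N: prob_space ?N by (rule prob_space_pair[OF D(1) B])
  note [measurable] = A
  define p where "p A x = measure B (Pair x -` A)" for A :: "('a \<times> ('g \<Rightarrow> bool)) set" and x
  have p_meas[measurable]: "p A \<in> borel_measurable M" if "A \<in> sets ?N" for A
    unfolding p_def measure_def using BB.measurable_emeasure_Pair[OF that] by measurable
  have p01: "0 \<le> p A x" "p A x \<le> 1" for A x by (auto simp: p_def)
  have p_int: "integrable M (p A)" if "A \<in> sets ?N" for A
    using p01 p_meas[OF that] by (intro M.integrable_const_bound[of _ 1]) auto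
  have p_total: "measure ?N A = (\<integral>x. p A x \<partial>M)" if "A \<in> sets ?N" for A
  proof -
    have "ennreal (measure ?N A) = (\<integral>\<^sup>+x. emeasure B (Pair x -` A) \<partial>M)"
      using BB.emeasure_pair_measure_alt[OF that] by (simp add: N.emeasure_eq_measure)
    also have "\<dots> = (\<integral>\<^sup>+x. ennreal (p A x) \<partial>M)" by (simp add: p_def BB.emeasure_eq_measure)
    also have "\<dots> = ennreal (\<integral>x. p A x \<partial>M)" using p_int[OF that] p01 by (intro nn_integral_eq_integral) auto
    finally show ?thesis using p01 by (subst (asm) ennreal_inj) (auto intro!: integral_nonneg_AE)
  qed
  have sec: "Pair x -` A \<in> sets B" if "A \<in> sets ?N" for A x by (rule sets_Pair1[OF that])
  have p_shift: "measure B {\<omega>\<in>space B. (T g x, shift g \<omega>) \<in> A} = p A (T g x)"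
    if g: "g \<in> carrier G" and A: "A \<in> sets ?N" for g x A
  proof -
    have "p A (T g x) = measure (distr B B (shift g)) (Pair (T g x) -` A)"
      by (simp add: p_def shift_invariant[OF g])
    also have "\<dots> = measure B (shift g -` (Pair (T g x) -` A) \<inter> space B)"
      using sec[OF A] g by (intro measure_distr) auto
    also have "shift g -` (Pair (T g x) -` A) \<inter> space B = {\<omega>\<in>space B. (T g x, shift g \<omega>) \<in> A}" by auto
    finally show ?thesis ..
  qed
  have p_inv: "p A (T g x) = p A x" if g: "g \<in> carrier G" and x: "x \<in> space M" for g x
  proof -
    have "{\<omega>\<in>space B. (T g x, shift g \<omega>) \<in> A} = Pair x -` A"
      using inv[OF g x] sets.sets_into_space[OF A] by (auto simp: space_pair_measure)
    then show ?thesis using p_shift[OF g A, of x] by (simp add: p_def)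
  qed
  define a where "a = measure ?N A"
  \<comment> \<open>The measure of the section over \<open>x\<close> is an invariant function of
    \<open>x\<close>, hence constant by ergodicity of \<open>M\<close>.\<close>
  have pa: "AE x in M. p A x = a"
    unfolding a_def p_total[OF A]
    by (rule ergodic_ae_invariant_function[OF erg G]) (use p01 p_inv A in \<open>auto intro!: AE_I2\<close>)
  have a01: "0 \<le> a" "a \<le> 1" by (auto simp: a_def)
  \<comment> \<open>Two errors of \<open>2 * \<epsilon>\<close> add up: one from replacing
    \<open>A\<close> by the intersection of \<open>A'\<close> with its translate, one from replacing
    the product of section measures by \<open>a * a\<close>.\<close>
  have key: "\<bar>a - a * a\<bar> \<le> 4 * \<epsilon>" if \<epsilon>: "0 < \<epsilon>" for \<epsilon>
  proof -
    obtain K A' where A': "cylindrical M K A'" and close: "measure ?N ((A - A') \<union> (A' - A)) < \<epsilon>"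
      using approximable_sets[OF D(1) A] \<epsilon> unfolding approximable_def by blast
    have A's[measurable]: "A' \<in> sets ?N" and K: "finite K" "K \<subseteq> carrier G"
      and dep: "\<And>x. x \<in> space M \<Longrightarrow> depends_on K (Pair x -` A')" using A' by (auto simp: cylindrical_def)
    obtain g where g: "g \<in> carrier G" and disj: "K \<inter> (\<lambda>h. h \<otimes> g) ` K = {}"
      by (rule exists_disjoint_translate[OF K])
    have [measurable]: "T g \<in> M \<rightarrow>\<^sub>M M" "shift g \<in> B \<rightarrow>\<^sub>M B" using D(2) g by auto
    define u where "u q = (T g (fst q), shift g (snd q))" for q
    have u[measurable]: "u \<in> ?N \<rightarrow>\<^sub>M ?N" unfolding u_def by measurable
    have u_law: "distr ?N ?N u = ?N"
      using distr_pair_measure_map_prod[OF D(1) B D(2)[OF g] shift_measurable[OF g] D(3)[OF g] shift_invariant[OF g]]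
      by (simp add: u_def[abs_def] map_prod_def split_beta')
    have uA: "u -` A \<inter> space ?N = A"
      using inv[OF g] sets.sets_into_space[OF A] by (auto simp: u_def space_pair_measure)
    define A2 where "A2 = u -` A' \<inter> space ?N"
    have A2[measurable]: "A2 \<in> sets ?N" unfolding A2_def using u A's by (rule measurable_sets)
    let ?S = "(A - A') \<union> (A' - A)"
    have S: "?S \<in> sets ?N" by simp
    have S2: "measure ?N (u -` ?S \<inter> space ?N) = measure ?N ?S"
      using measure_distr[OF u S] by (simp add: u_law)
    \<comment> \<open>\<open>A\<close> is its own preimage under \<open>u\<close>, which preserves
      the measure, so \<open>A\<close> is as close to \<open>A2\<close> as to
      \<open>A'\<close>.\<close>
    have diff: "\<bar>measure ?N A - measure ?N (A' \<inter> A2)\<bar> \<le> 2 * \<epsilon>"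
    proof -
      have sub: "(A - (A' \<inter> A2)) \<union> ((A' \<inter> A2) - A) \<subseteq> ?S \<union> (u -` ?S \<inter> space ?N)"
        using uA sets.sets_into_space[OF A] unfolding A2_def by blast
      have "measure ?N ((A - (A' \<inter> A2)) \<union> ((A' \<inter> A2) - A)) \<le> measure ?N (?S \<union> (u -` ?S \<inter> space ?N))"
        using sub measurable_sets[OF u S] by (intro N.finite_measure_mono) auto
      also have "\<dots> \<le> measure ?N ?S + measure ?N (u -` ?S \<inter> space ?N)"
        using measurable_sets[OF u S] by (intro measure_Un_le) auto
      also have "\<dots> \<le> 2 * \<epsilon>" using close S2 by simp
      finally have s: "measure ?N ((A - (A' \<inter> A2)) \<union> ((A' \<inter> A2) - A)) \<le> 2 * \<epsilon>" .
      have "measure ?N A \<le> measure ?N ((A' \<inter> A2) \<union> ((A - (A' \<inter> A2)) \<union> ((A' \<inter> A2) - A)))"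
        by (rule N.finite_measure_mono) auto
      also have "\<dots> \<le> measure ?N (A' \<inter> A2) + measure ?N ((A - (A' \<inter> A2)) \<union> ((A' \<inter> A2) - A))"
        by (rule measure_Un_le) auto
      finally have 1: "measure ?N A \<le> measure ?N (A' \<inter> A2) + 2 * \<epsilon>" using s by simp
      have "measure ?N (A' \<inter> A2) \<le> measure ?N (A \<union> ((A - (A' \<inter> A2)) \<union> ((A' \<inter> A2) - A)))"
        by (rule N.finite_measure_mono) auto
      also have "\<dots> \<le> measure ?N A + measure ?N ((A - (A' \<inter> A2)) \<union> ((A' \<inter> A2) - A))"
        by (rule measure_Un_le) auto
      finally have 2: "measure ?N (A' \<inter> A2) \<le> measure ?N A + 2 * \<epsilon>" using s by simp
      from 1 2 show ?thesis by (simp add: abs_le_iff)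
    qed
    \<comment> \<open>Over \<open>x\<close> the two sections depend on \<open>K\<close> and on its
      translate by \<open>g\<close>, which are disjoint.\<close>
    have prod: "p (A' \<inter> A2) x = p A' x * p A' (T g x)" if x: "x \<in> space M" for x
    proof -
      have Tx: "T g x \<in> space M" using measurable_space[OF D(2)[OF g] x] .
      have sec2: "Pair x -` A2 = {\<omega>\<in>space B. (T g x, shift g \<omega>) \<in> A'}"
        using x by (auto simp: A2_def u_def space_pair_measure)
      have "depends_on ((\<lambda>h. h \<otimes> g) ` K) (Pair x -` A2)"
        unfolding depends_on_def
      proof (intro ballI impI)
        fix \<omega> \<omega>' assume \<omega>: "\<omega> \<in> space B" "\<omega>' \<in> space B" and eq: "\<forall>h\<in>(\<lambda>h. h \<otimes> g) ` K. \<omega> h = \<omega>' h"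
        have "\<forall>h\<in>K. shift g \<omega> h = shift g \<omega>' h" using eq K(2) by (auto simp: shift_def)
        then have "shift g \<omega> \<in> Pair (T g x) -` A' \<longleftrightarrow> shift g \<omega>' \<in> Pair (T g x) -` A'"
          using dep[OF Tx] measurable_space[OF shift_measurable[OF g]] \<omega> unfolding depends_on_def by blast
        then show "\<omega> \<in> Pair x -` A2 \<longleftrightarrow> \<omega>' \<in> Pair x -` A2" using \<omega> by (simp add: sec2)
      qed
      then have "measure B (Pair x -` A' \<inter> Pair x -` A2) = measure B (Pair x -` A') * measure B (Pair x -` A2)"
        using K g disj sec[OF A's] sec[OF A2] dep[OF x] by (intro indep_depends_on) auto
      also have "measure B (Pair x -` A2) = p A' (T g x)" unfolding sec2 by (rule p_shift[OF g A's])
      finally show ?thesis by (simp add: p_def)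
    qed
    \<comment> \<open>The approximation error in the fibre over each point; it integrates to the
      total error.\<close>
    define \<delta> where "\<delta> = p ?S"
    have \<delta>_int: "integrable M \<delta>" unfolding \<delta>_def by (rule p_int[OF S])
    have \<delta>_total: "(\<integral>x. \<delta> x \<partial>M) < \<epsilon>" using close by (simp add: \<delta>_def p_total[OF S, symmetric])
    have \<delta>: "\<bar>p A' x - p A x\<bar> \<le> \<delta> x" for x
    proof -
      have Sx: "Pair x -` ?S = (Pair x -` A - Pair x -` A') \<union> (Pair x -` A' - Pair x -` A)" by auto
      have "measure B (Pair x -` A') \<le> measure B (Pair x -` A \<union> Pair x -` ?S)"
        using sec[OF A] sec[OF S] by (intro BB.finite_measure_mono) auto
      also have "\<dots> \<le> measure B (Pair x -` A) + measure B (Pair x -` ?S)"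
        using sec[OF A] sec[OF S] by (intro measure_Un_le) auto
      finally have 1: "p A' x \<le> p A x + \<delta> x" by (simp add: p_def \<delta>_def)
      have "measure B (Pair x -` A) \<le> measure B (Pair x -` A' \<union> Pair x -` ?S)"
        using sec[OF A's] sec[OF S] by (intro BB.finite_measure_mono) auto
      also have "\<dots> \<le> measure B (Pair x -` A') + measure B (Pair x -` ?S)"
        using sec[OF A's] sec[OF S] by (intro measure_Un_le) auto
      finally have 2: "p A x \<le> p A' x + \<delta> x" by (simp add: p_def \<delta>_def)
      from 1 2 show ?thesis by (simp add: abs_le_iff)
    qed
    have \<delta>T_int: "integrable M (\<lambda>x. \<delta> (T g x))" and \<delta>T_total: "(\<integral>x. \<delta> (T g x) \<partial>M) = (\<integral>x. \<delta> x \<partial>M)"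
      using integrable_distr_eq[of "T g" M M \<delta>] integral_distr[of "T g" M M \<delta>] D(3)[OF g] \<delta>_int S
      by (auto simp: \<delta>_def)
    have paT: "AE x in M. p A (T g x) = a"
      using pa AE_space by eventually_elim (simp add: p_inv[OF g])
    have m2: "measure ?N (A' \<inter> A2) = (\<integral>x. p A' x * p A' (T g x) \<partial>M)"
      unfolding p_total[OF sets.Int[OF A's A2]] by (rule Bochner_Integration.integral_cong[OF refl prod])
    have int2: "integrable M (\<lambda>x. p A' x * p A' (T g x))"
      using p01 A's by (intro M.integrable_const_bound[of _ 1]) (auto intro!: mult_le_one)
    have bound: "AE x in M. \<bar>p A' x * p A' (T g x) - a * a\<bar> \<le> \<delta> x + \<delta> (T g x)"
      using pa paT
    proof eventually_elim
      case (elim x)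
      have "p A' x * p A' (T g x) - a * a = (p A' x - a) * p A' (T g x) + a * (p A' (T g x) - a)"
        by (simp add: algebra_simps)
      then have "\<bar>p A' x * p A' (T g x) - a * a\<bar> \<le> \<bar>(p A' x - a) * p A' (T g x)\<bar> + \<bar>a * (p A' (T g x) - a)\<bar>" by simp
      also have "\<dots> = \<bar>p A' x - a\<bar> * p A' (T g x) + a * \<bar>p A' (T g x) - a\<bar>"
        using p01 a01 by (simp add: abs_mult)
      also have "\<dots> \<le> \<bar>p A' x - a\<bar> * 1 + 1 * \<bar>p A' (T g x) - a\<bar>"
        using p01 a01 by (intro add_mono mult_left_mono mult_right_mono) auto
      also have "\<dots> \<le> \<delta> x + \<delta> (T g x)" using \<delta>[of x] \<delta>[of "T g x"] elim by simp
      finally show ?case .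
    qed
    have "\<bar>measure ?N (A' \<inter> A2) - a * a\<bar> = \<bar>\<integral>x. p A' x * p A' (T g x) - a * a \<partial>M\<bar>"
      using int2 by (simp add: m2 M.prob_space)
    also have "\<dots> \<le> (\<integral>x. \<bar>p A' x * p A' (T g x) - a * a\<bar> \<partial>M)" by (rule integral_abs_bound)
    also have "\<dots> \<le> (\<integral>x. \<delta> x + \<delta> (T g x) \<partial>M)"
      using bound int2 \<delta>_int \<delta>T_int by (intro integral_mono_AE) auto
    also have "\<dots> \<le> 2 * \<epsilon>" using \<delta>_int \<delta>T_int \<delta>_total by (simp add: \<delta>T_total)
    finally show ?thesis using diff by (simp add: a_def)
  qed
  have "a - a * a = 0"
  proof (rule ccontr)
    assume "a - a * a \<noteq> 0"
    \<comment> \<open>The factor 1/8 turns the bound \<open>4 * \<epsilon>\<close> into half of the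
      quantity being bounded.\<close>
    then show False using key[of "\<bar>a - a * a\<bar> / 8"] by simp
  qed
  then have "a * (1 - a) = 0" by (simp add: algebra_simps)
  then show ?thesis by (simp add: a_def)
qed

end

section \<open>Bernoulli extensions as systems on the line\<close>

text \<open>\<open>M\<close> stands here for a single ergodic component, which may have
  atoms.\<close>

locale bernoulli_extension = standard_system M f f' X0 G T + bern: bernoulli G
  for M :: "'a measure" and f f' X0 and G :: "('g, 'k) monoid_scheme" and T +
  assumes erg: "ergodic_system G M T" and X0_AE: "AE x in M. x \<in> X0"
begin

abbreviation "B \<equiv> bern.B"
abbreviation shift_B :: "'g \<Rightarrow> ('g \<Rightarrow> bool) \<Rightarrow> 'g \<Rightarrow> bool" where "shift_B \<equiv> bern.shift"

sublocale M: prob_space M using pmp by (simp add: pmp_system_def)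
sublocale B: prob_space B by (rule bern.B)
sublocale N: prob_space "M \<Otimes>\<^sub>M B" by (rule prob_space_pair[OF M.prob_space_axioms B.prob_space_axioms])

lemmas act = pmp_systemD(4-7)[OF pmp G(1)]

text \<open>\<open>X0\<close> need not be invariant. The points whose whole orbit lies in it form an
  invariant set of full measure on which codes can be decoded; this makes an honest action on codes
  possible.\<close>

definition X1 :: "'a set" where "X1 = {x\<in>space M. \<forall>g\<in>carrier G. T g x \<in> X0}"

lemma X1[measurable]: "X1 \<in> sets M"
  unfolding X1_def using G(2) by measurable

lemma X1_AE: "AE x in M. x \<in> X1"
proof -
  have "AE x in M. \<forall>g\<in>carrier G. T g x \<in> X0"
  proof (rule AE_ball_countable'[OF _ G(2)])
    fix g assume g: "g \<in> carrier G"
    show "AE x in M. T g x \<in> X0"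
      by (rule AE_distr_invariant[OF _ T[OF g] X0_AE]) (use pmp g in \<open>simp add: pmp_system_def\<close>)
  qed
  with AE_space show ?thesis by eventually_elim (simp add: X1_def)
qed

lemma X1D:
  assumes "x \<in> X1" shows "x \<in> space M" "x \<in> X0"
proof -
  show sp: "x \<in> space M" using assms by (simp add: X1_def)
  have "T \<one>\<^bsub>G\<^esub> x \<in> X0" using assms bern.one_closed by (simp add: X1_def)
  then show "x \<in> X0" by (simp add: act(2)[OF sp])
qed

lemma T_X1:
  assumes g: "g \<in> carrier G" and x: "x \<in> space M"
  shows "T g x \<in> X1 \<longleftrightarrow> x \<in> X1"
proof -
  have *: "T h y \<in> X1" if y: "y \<in> X1" and h: "h \<in> carrier G" for h y
  proof -
    have "T k (T h y) \<in> X0" if k: "k \<in> carrier G" for k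
    proof -
      have "T (k \<otimes>\<^bsub>G\<^esub> h) y \<in> X0" using y bern.m_closed[OF k h] by (simp add: X1_def)
      then show ?thesis by (simp add: act(1)[OF k h X1D(1)[OF y]])
    qed
    then show ?thesis using measurable_space[OF T[OF h] X1D(1)[OF y]] by (simp add: X1_def)
  qed
  show ?thesis
    using *[of x g] *[of "T g x" "inv\<^bsub>G\<^esub> g"] g act(3)[OF g x] by auto
qed

definition x1 :: 'a where "x1 = (SOME x. x \<in> X1)"

lemma x1: "x1 \<in> X1"
proof -
  have "X1 \<noteq> {}"
  proof
    assume "X1 = {}"
    then have "AE x in M. False" using X1_AE by simp
    then show False by simp
  qed
  then show ?thesis unfolding x1_def by (simp add: some_in_eq)
qed

text \<open>A null set is moved to one chosen point of \<open>X1\<close>, so that every pair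
  receives a code that can be decoded.\<close>

definition ret :: "'a \<Rightarrow> 'a" where "ret x = (if x \<in> X1 then x else x1)"

lemma ret_X1: "ret x \<in> X1" using x1 by (simp add: ret_def)

lemma ret_measurable[measurable]: "ret \<in> M \<rightarrow>\<^sub>M M"
  unfolding ret_def using X1D(1)[OF x1] by measurable

text \<open>A single Cantor code: even bits describe the point, odd bits the coin sequence.\<close>

definition enc :: "'a \<times> ('g \<Rightarrow> bool) \<Rightarrow> real" where
  "enc p = cantor_code (\<lambda>n. if even n then point_bit (from_nat (n div 2)) (fst p) else snd p (\<gamma> (n div 2)))"

definition dig :: "nat \<Rightarrow> real \<Rightarrow> bool" where "dig n t \<longleftrightarrow> cantor_digit n t = 1"

definition dec :: "real \<Rightarrow> 'a \<times> ('g \<Rightarrow> bool)" where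
  "dec t = (decode (\<lambda>i. dig (2 * to_nat i) t), \<lambda>h\<in>carrier G. dig (2 * to_nat_on (carrier G) h + 1) t)"

lemma enc_measurable[measurable]: "enc \<in> borel_measurable (M \<Otimes>\<^sub>M B)"
  unfolding enc_def
proof (rule measurable_cantor_code)
  fix n
  have "Measurable.pred B (\<lambda>\<omega>. \<omega> (\<gamma> (n div 2)))" by (rule bern.coord_measurable) simp
  then have "Measurable.pred (M \<Otimes>\<^sub>M B) (\<lambda>p. snd p (\<gamma> (n div 2)))" by (rule measurable_compose[OF measurable_snd])
  moreover have "Measurable.pred (M \<Otimes>\<^sub>M B) (\<lambda>p. point_bit (from_nat (n div 2)) (fst p))" by measurable
  ultimately show "Measurable.pred (M \<Otimes>\<^sub>M B) (\<lambda>p. if even n then point_bit (from_nat (n div 2)) (fst p) else snd p (\<gamma> (n div 2)))"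
    by (cases "even n") simp_all
qed

lemma dig_measurable[measurable]: "Measurable.pred borel (dig n)"
  unfolding dig_def by measurable

lemma dec_measurable[measurable]: "dec \<in> borel \<rightarrow>\<^sub>M M \<Otimes>\<^sub>M B"
  unfolding dec_def
proof (rule measurable_Pair)
  have "(\<lambda>t i. dig (2 * to_nat i) t) \<in> borel \<rightarrow>\<^sub>M (bit_space :: (nat \<times> rat \<Rightarrow> bool) measure)"
    by (rule measurable_PiM_single') (auto simp: space_PiM)
  then show "(\<lambda>t. decode (\<lambda>i. dig (2 * to_nat i) t)) \<in> borel \<rightarrow>\<^sub>M M"
    by (rule measurable_compose[OF _ decode_measurable])
  show "(\<lambda>t. \<lambda>h\<in>carrier G. dig (2 * to_nat_on (carrier G) h + 1) t) \<in> borel \<rightarrow>\<^sub>M B"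
    by (rule bern.measurable_into_B) auto
qed

lemma dig_enc:
  "dig (2 * n) (enc p) \<longleftrightarrow> point_bit (from_nat n) (fst p)"
  "dig (2 * n + 1) (enc p) \<longleftrightarrow> snd p (\<gamma> n)"
  unfolding dig_def enc_def by (simp_all add: cantor_digit_cantor_code)

lemma dec_enc:
  assumes "x \<in> X0" "\<omega> \<in> space B"
  shows "dec (enc (x, \<omega>)) = (x, \<omega>)"
proof -
  \<comment> \<open>\<open>to_nat_on\<close> finds an index at which \<open>\<gamma>\<close> lists
    \<open>h\<close>.\<close>
  have "(\<lambda>h\<in>carrier G. dig (2 * to_nat_on (carrier G) h + 1) (enc (x, \<omega>))) = \<omega>"
  proof
    fix h
    show "(\<lambda>h\<in>carrier G. dig (2 * to_nat_on (carrier G) h + 1) (enc (x, \<omega>))) h = \<omega> h"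
      using assms(2) from_nat_into_to_nat_on[OF G(2)]
      by (cases "h \<in> carrier G") (auto simp: dig_enc \<gamma>_def bern.space_B PiE_def extensional_def simp del: One_nat_def add_Suc_right)
  qed
  moreover have "decode (\<lambda>i. dig (2 * to_nat i) (enc (x, \<omega>))) = x"
    using decode_point_bit[OF assms(1)] by (simp add: dig_enc)
  ultimately show ?thesis by (simp add: dec_def)
qed

definition U :: "'g \<Rightarrow> 'a \<times> ('g \<Rightarrow> bool) \<Rightarrow> 'a \<times> ('g \<Rightarrow> bool)" where
  "U g p = (T g (fst p), shift_B g (snd p))"

lemma U_measurable: "g \<in> carrier G \<Longrightarrow> U g \<in> M \<Otimes>\<^sub>M B \<rightarrow>\<^sub>M M \<Otimes>\<^sub>M B"
  unfolding U_def using T[of g] bern.shift_measurable[of g] by measurable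

lemma U_invariant:
  assumes g: "g \<in> carrier G"
  shows "distr (M \<Otimes>\<^sub>M B) (M \<Otimes>\<^sub>M B) (U g) = M \<Otimes>\<^sub>M B"
proof -
  have "U g = map_prod (T g) (shift_B g)" by (auto simp: U_def)
  then show ?thesis
    using distr_pair_measure_map_prod[OF M.prob_space_axioms B.prob_space_axioms T[OF g] bern.shift_measurable[OF g]]
      pmp bern.shift_invariant[OF g] g by (simp add: pmp_system_def)
qed

lemma U_space: "g \<in> carrier G \<Longrightarrow> x \<in> X1 \<Longrightarrow> \<omega> \<in> space B \<Longrightarrow> U g (x, \<omega>) \<in> X1 \<times> space B"
  using T_X1 X1D(1) measurable_space[OF bern.shift_measurable] by (auto simp: U_def)

lemma U_mult:
  assumes "g \<in> carrier G" "h \<in> carrier G" "x \<in> X1"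
  shows "U (g \<otimes>\<^bsub>G\<^esub> h) (x, \<omega>) = U g (U h (x, \<omega>))"
  using assms act(1)[OF assms(1,2) X1D(1)[OF assms(3)]]
  by (auto simp: U_def bern.shift_def bern.m_assoc intro!: restrict_ext)

lemma U_one: "x \<in> X1 \<Longrightarrow> \<omega> \<in> space B \<Longrightarrow> U \<one>\<^bsub>G\<^esub> (x, \<omega>) = (x, \<omega>)"
  using act(2) X1D(1) by (auto simp: U_def bern.shift_def bern.space_B PiE_def extensional_def restrict_def)

text \<open>On \<open>X1\<close> the coding is injective, and the extension is realised on the set \<open>R\<close> of codes.\<close>
definition R :: "real set" where "R = {t. dec t \<in> X1 \<times> space B \<and> enc (dec t) = t}"

lemma R[measurable]: "R \<in> sets borel"
proof -
  have "X1 \<times> space B \<in> sets (M \<Otimes>\<^sub>M B)" by simp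
  then have 1: "Measurable.pred borel (\<lambda>t. dec t \<in> X1 \<times> space B)"
    by (rule pred_sets2[OF _ dec_measurable])
  have "(\<lambda>t. enc (dec t)) \<in> borel_measurable borel" by measurable
  then have "{t\<in>space borel. dec t \<in> X1 \<times> space B \<and> enc (dec t) = t} \<in> sets borel"
    using 1 by measurable
  then show ?thesis by (simp add: R_def)
qed

lemma enc_R: "x \<in> X1 \<Longrightarrow> \<omega> \<in> space B \<Longrightarrow> enc (x, \<omega>) \<in> R"
  using dec_enc[OF X1D(2)] by (simp add: R_def)

lemma R_E: assumes "t \<in> R" obtains x \<omega> where "x \<in> X1" "\<omega> \<in> space B" "t = enc (x, \<omega>)"
  using assms by (cases "dec t") (auto simp: R_def intro: that)

definition embed :: "'a \<times> ('g \<Rightarrow> bool) \<Rightarrow> real" where "embed p = enc (ret (fst p), snd p)"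

lemma embed_measurable_borel: "embed \<in> M \<Otimes>\<^sub>M B \<rightarrow>\<^sub>M borel"
  unfolding embed_def by measurable

lemma embed_R: "p \<in> space (M \<Otimes>\<^sub>M B) \<Longrightarrow> embed p \<in> R"
  using enc_R[OF ret_X1] by (auto simp: embed_def space_pair_measure)

lemma dec_embed: "p \<in> space (M \<Otimes>\<^sub>M B) \<Longrightarrow> dec (embed p) = (ret (fst p), snd p)"
  using dec_enc[OF X1D(2)[OF ret_X1]] by (auto simp: embed_def space_pair_measure)

definition \<rho> :: "real measure" where "\<rho> = distr (M \<Otimes>\<^sub>M B) borel embed"

definition Y :: "real measure" where "Y = restrict_space \<rho> R"

text \<open>The value outside \<open>R\<close> is \<open>undefined\<close>, as
  \<open>group_action\<close> demands of its bijections.\<close>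

definition S :: "'g \<Rightarrow> real \<Rightarrow> real" where "S g = (\<lambda>t\<in>R. enc (U g (dec t)))"

lemma \<rho>: "prob_space \<rho>" unfolding \<rho>_def by (rule N.prob_space_distr[OF embed_measurable_borel])

lemma space_Y: "space Y = R" by (simp add: Y_def \<rho>_def space_restrict_space)

lemma sets_Y: "sets Y = sets (restrict_space borel R)"
  unfolding Y_def \<rho>_def by (intro sets_restrict_space_cong) simp

lemma embed_measurable[measurable]: "embed \<in> M \<Otimes>\<^sub>M B \<rightarrow>\<^sub>M Y"
  unfolding measurable_cong_sets[OF refl sets_Y]
  by (rule measurable_restrict_space2) (use embed_R embed_measurable_borel in auto)

lemma Y_law: "distr (M \<Otimes>\<^sub>M B) Y embed = Y"
proof (rule measure_eqI)
  fix A assume "A \<in> sets (distr (M \<Otimes>\<^sub>M B) Y embed)"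
  then have A: "A \<in> sets Y" by simp
  then have Ab: "A \<in> sets borel" "A \<subseteq> R" unfolding sets_Y by (auto simp: sets_restrict_space)
  have "emeasure Y A = emeasure \<rho> A" unfolding Y_def using Ab by (intro emeasure_restrict_space) (auto simp: \<rho>_def)
  also have "\<dots> = emeasure (M \<Otimes>\<^sub>M B) (embed -` A \<inter> space (M \<Otimes>\<^sub>M B))"
    unfolding \<rho>_def using Ab(1) by (intro emeasure_distr embed_measurable_borel) simp
  also have "\<dots> = emeasure (distr (M \<Otimes>\<^sub>M B) Y embed) A" using A by (simp add: emeasure_distr)
  finally show "emeasure (distr (M \<Otimes>\<^sub>M B) Y embed) A = emeasure Y A" ..
qed simp

lemma dec_measurable_Y[measurable]: "dec \<in> Y \<rightarrow>\<^sub>M M \<Otimes>\<^sub>M B"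
  unfolding measurable_cong_sets[OF sets_Y refl] by (rule measurable_restrict_space1) simp

lemma S_enc:
  "g \<in> carrier G \<Longrightarrow> x \<in> X1 \<Longrightarrow> \<omega> \<in> space B \<Longrightarrow> S g (enc (x, \<omega>)) = enc (U g (x, \<omega>))"
  using enc_R[of x \<omega>] dec_enc[OF X1D(2), of x \<omega>] by (simp add: S_def)

lemma S_measurable[measurable]:
  assumes g: "g \<in> carrier G" shows "S g \<in> Y \<rightarrow>\<^sub>M Y"
proof -
  have "(\<lambda>t. enc (U g (dec t))) \<in> Y \<rightarrow>\<^sub>M borel"
    by (rule measurable_compose[OF measurable_compose[OF dec_measurable_Y U_measurable[OF g]] enc_measurable])
  then have "S g \<in> Y \<rightarrow>\<^sub>M borel"
    by (subst measurable_cong[of _ _ "\<lambda>t. enc (U g (dec t))"]) (auto simp: S_def space_Y)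
  then show ?thesis
    unfolding measurable_cong_sets[OF refl sets_Y]
  proof (rule measurable_restrict_space2[rotated])
    show "S g \<in> space Y \<rightarrow> R"
    proof
      fix t assume "t \<in> space Y"
      then obtain x \<omega> where x: "x \<in> X1" "\<omega> \<in> space B" "t = enc (x, \<omega>)" by (auto simp: space_Y elim: R_E)
      have "enc (U g (x, \<omega>)) \<in> R"
        using U_space[OF g x(1,2)] enc_R by (cases "U g (x, \<omega>)") auto
      then show "S g t \<in> R" by (simp add: x(3) S_enc[OF g x(1,2)])
    qed
  qed
qed

text \<open>Off \<open>X1\<close> the map \<open>ret\<close> need not commute with the action, so
  equivariance is claimed for points of \<open>X1\<close>, which is enough almost
  everywhere.\<close>

lemma S_embed:
  assumes g: "g \<in> carrier G" and p: "p \<in> space (M \<Otimes>\<^sub>M B)" "fst p \<in> X1"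
  shows "S g (embed p) = embed (U g p)"
proof -
  have "S g (embed p) = enc (U g p)"
    using S_enc[OF g p(2), of "snd p"] p by (auto simp: embed_def ret_def space_pair_measure)
  moreover have "fst (U g p) \<in> X1" using T_X1[OF g X1D(1)[OF p(2)]] p(2) by (simp add: U_def)
  ultimately show ?thesis by (simp add: embed_def ret_def)
qed

lemma fst_X1_AE: "AE p in M \<Otimes>\<^sub>M B. fst p \<in> X1"
proof -
  have "AE x in distr (M \<Otimes>\<^sub>M B) M fst. x \<in> X1" unfolding B.distr_pair_fst by (rule X1_AE)
  then show ?thesis by (rule AE_distrD[rotated]) simp
qed

lemma S_invariant:
  assumes g: "g \<in> carrier G" shows "distr Y Y (S g) = Y"
proof -
  have "distr Y Y (S g) = distr (distr (M \<Otimes>\<^sub>M B) Y embed) Y (S g)" by (simp add: Y_law)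
  also have "\<dots> = distr (M \<Otimes>\<^sub>M B) Y (\<lambda>p. S g (embed p))"
    using S_measurable[OF g] by (subst distr_distr) (auto simp: comp_def)
  also have "\<dots> = distr (M \<Otimes>\<^sub>M B) Y (\<lambda>p. embed (U g p))"
  proof (rule distr_cong_AE)
    show "AE p in M \<Otimes>\<^sub>M B. S g (embed p) = embed (U g p)"
      using fst_X1_AE AE_space by eventually_elim (rule S_embed[OF g])
    show "(\<lambda>p. S g (embed p)) \<in> M \<Otimes>\<^sub>M B \<rightarrow>\<^sub>M Y" by (rule measurable_compose[OF embed_measurable S_measurable[OF g]])
    show "(\<lambda>p. embed (U g p)) \<in> M \<Otimes>\<^sub>M B \<rightarrow>\<^sub>M Y" by (rule measurable_compose[OF U_measurable[OF g] embed_measurable])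
  qed simp_all
  also have "\<dots> = distr (distr (M \<Otimes>\<^sub>M B) (M \<Otimes>\<^sub>M B) (U g)) Y embed"
    using U_measurable[OF g] by (subst distr_distr) (auto simp: comp_def)
  also have "\<dots> = Y" by (simp add: U_invariant[OF g] Y_law)
  finally show ?thesis .
qed

text \<open>Every element of \<open>R\<close> is the code of a pair over \<open>X1\<close>, so the
  group laws hold at every point and not only almost everywhere.\<close>

lemma S_action: "group_action G (space Y) S"
proof -
  have S_R: "S g t \<in> R" if "g \<in> carrier G" "t \<in> R" for g t
    using measurable_space[OF S_measurable[OF that(1)]] that(2) by (simp add: space_Y)
  have mult: "S (g \<otimes>\<^bsub>G\<^esub> h) t = S g (S h t)" if g: "g \<in> carrier G" and h: "h \<in> carrier G" and t: "t \<in> R" for g h t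
  proof -
    obtain x \<omega> where x: "x \<in> X1" "\<omega> \<in> space B" "t = enc (x, \<omega>)" using t by (rule R_E)
    have "S g (enc (U h (x, \<omega>))) = enc (U g (U h (x, \<omega>)))"
      using U_space[OF h x(1,2)] S_enc[OF g] by (cases "U h (x, \<omega>)") auto
    then show ?thesis using S_enc[OF h x(1,2)] S_enc[OF bern.m_closed[OF g h] x(1,2)] U_mult[OF g h x(1)] by (simp add: x(3))
  qed
  have one: "S \<one>\<^bsub>G\<^esub> t = t" if t: "t \<in> R" for t
  proof -
    obtain x \<omega> where x: "x \<in> X1" "\<omega> \<in> space B" "t = enc (x, \<omega>)" using t by (rule R_E)
    then show ?thesis using S_enc[OF bern.one_closed x(1,2)] U_one[OF x(1,2)] by simp
  qed
  have bij: "S g \<in> Bij R" if g: "g \<in> carrier G" for g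
  proof -
    have "bij_betw (S g) R R"
    proof (rule bij_betw_byWitness[where f'="S (inv\<^bsub>G\<^esub> g)"])
      show "\<forall>t\<in>R. S (inv\<^bsub>G\<^esub> g) (S g t) = t" "\<forall>t\<in>R. S g (S (inv\<^bsub>G\<^esub> g) t) = t"
        using g by (simp_all add: mult[symmetric] one)
    qed (use g S_R in auto)
    then show ?thesis by (simp add: Bij_def S_def)
  qed
  have "S \<in> hom G (BijGroup R)"
  proof (rule homI)
    show "S g \<in> carrier (BijGroup R)" if "g \<in> carrier G" for g using bij[OF that] by (simp add: BijGroup_def)
    fix g h assume g: "g \<in> carrier G" and h: "h \<in> carrier G"
    have "S (g \<otimes>\<^bsub>G\<^esub> h) = compose R (S g) (S h)"
    proof
      fix t show "S (g \<otimes>\<^bsub>G\<^esub> h) t = compose R (S g) (S h) t"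
        using mult[OF g h] by (cases "t \<in> R") (simp_all add: compose_def S_def)
    qed
    then show "S (g \<otimes>\<^bsub>G\<^esub> h) = S g \<otimes>\<^bsub>BijGroup R\<^esub> S h" using bij g h by (simp add: BijGroup_def)
  qed
  then show ?thesis
    unfolding space_Y group_action_def group_hom_def group_hom_axioms_def using G(1) group_BijGroup by auto
qed

lemma Y_prob: "prob_space Y"
  using N.prob_space_distr[OF embed_measurable] by (simp add: Y_law)

lemma Y_ergodic: "ergodic_system G Y S"
  unfolding ergodic_system_def pmp_system_def
proof (intro conjI ballI impI)
  show "prob_space Y" by (rule Y_prob)
  show "group_action G (space Y) S" by (rule S_action)
  show "S g \<in> Y \<rightarrow>\<^sub>M Y" "distr Y Y (S g) = Y" if "g \<in> carrier G" for g
    using S_measurable[OF that] S_invariant[OF that] by auto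
  fix A assume A: "A \<in> sets Y" and inv: "\<forall>g\<in>carrier G. S g -` A \<inter> space Y = A"
  \<comment> \<open>Intersecting with \<open>X1\<close> makes the pulled back set strictly
    invariant, as \<open>product_ergodic\<close> requires.\<close>
  define A' where "A' = {p\<in>space (M \<Otimes>\<^sub>M B). fst p \<in> X1 \<and> embed p \<in> A}"
  have A': "A' \<in> sets (M \<Otimes>\<^sub>M B)"
  proof -
    have "Measurable.pred (M \<Otimes>\<^sub>M B) (\<lambda>p. embed p \<in> A)" by (rule pred_sets2[OF A embed_measurable])
    then show ?thesis unfolding A'_def by measurable
  qed
  have "measure (M \<Otimes>\<^sub>M B) A' = 0 \<or> measure (M \<Otimes>\<^sub>M B) A' = 1"
  proof (rule bern.product_ergodic[OF erg A'])
    fix g x \<omega> assume g: "g \<in> carrier G" and x: "x \<in> space M" and \<omega>: "\<omega> \<in> space B"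
    have sp: "(x, \<omega>) \<in> space (M \<Otimes>\<^sub>M B)" using x \<omega> by (simp add: space_pair_measure)
    have Usp: "U g (x, \<omega>) \<in> space (M \<Otimes>\<^sub>M B)" by (rule measurable_space[OF U_measurable[OF g] sp])
    have "embed (U g (x, \<omega>)) \<in> A \<longleftrightarrow> embed (x, \<omega>) \<in> A" if "x \<in> X1"
    proof -
      have "embed (U g (x, \<omega>)) = S g (embed (x, \<omega>))" using S_embed[OF g sp] that by simp
      moreover have "S g (embed (x, \<omega>)) \<in> A \<longleftrightarrow> embed (x, \<omega>) \<in> A"
        using inv g embed_R[OF sp] by (auto simp: space_Y)
      ultimately show ?thesis by simp
    qed
    then show "(T g x, shift_B g \<omega>) \<in> A' \<longleftrightarrow> (x, \<omega>) \<in> A'"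
      using sp Usp T_X1[OF g x] by (auto simp: A'_def U_def)
  qed
  moreover have "measure Y A = measure (M \<Otimes>\<^sub>M B) A'"
  proof -
    have "measure Y A = measure (distr (M \<Otimes>\<^sub>M B) Y embed) A" by (simp add: Y_law)
    also have "\<dots> = measure (M \<Otimes>\<^sub>M B) (embed -` A \<inter> space (M \<Otimes>\<^sub>M B))" by (rule measure_distr[OF embed_measurable A])
    also have "\<dots> = measure (M \<Otimes>\<^sub>M B) A'"
      using fst_X1_AE A' measurable_sets[OF embed_measurable A]
      by (intro measure_eq_AE) (auto simp: A'_def elim!: eventually_mono)
    finally show ?thesis .
  qed
  ultimately show "measure Y A = 0 \<or> measure Y A = 1" by simp
qed

text \<open>A code determines the coin sequence, so an atom of \<open>\<rho>\<close> would give an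
  atom of the Bernoulli measure.\<close>

lemma Y_isomorphic: "isomorphic_mod0 Y unit_lebesgue"
  unfolding Y_def
proof (rule isomorphic_mod0_unit_lebesgue[OF _ _ R])
  interpret \<rho>: prob_space \<rho> by (rule \<rho>)
  show "real_distribution \<rho>"
    using \<rho> by (simp add: real_distribution_def real_distribution_axioms_def \<rho>_def)
  have "emeasure Y R = 1" using prob_space.emeasure_space_1[OF Y_prob] by (simp add: space_Y)
  then have "emeasure \<rho> R = 1" unfolding Y_def by (subst (asm) emeasure_restrict_space) (auto simp: \<rho>_def)
  then show "measure \<rho> R = 1" by (simp add: measure_def)
  show "measure \<rho> {t} = 0" for t
  proof -
    obtain x \<omega> where d: "dec t = (x, \<omega>)" by (cases "dec t")
    have \<omega>: "\<omega> \<in> space B"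
      using measurable_space[OF dec_measurable, of t] d by (simp add: space_pair_measure)
    have "{\<omega>'\<in>space B. \<forall>h\<in>carrier G. \<omega>' h = \<omega> h} \<in> sets B" using G(2) by measurable
    also have "{\<omega>'\<in>space B. \<forall>h\<in>carrier G. \<omega>' h = \<omega> h} = {\<omega>}"
      using \<omega> by (auto simp: bern.space_B intro: PiE_ext)
    finally have s: "{\<omega>} \<in> sets B" .
    have "emeasure \<rho> {t} = emeasure (M \<Otimes>\<^sub>M B) (embed -` {t} \<inter> space (M \<Otimes>\<^sub>M B))"
      unfolding \<rho>_def by (rule emeasure_distr[OF embed_measurable_borel]) simp
    also have "\<dots> \<le> emeasure (M \<Otimes>\<^sub>M B) (space M \<times> {\<omega>})"
    proof (rule emeasure_mono)
      show "embed -` {t} \<inter> space (M \<Otimes>\<^sub>M B) \<subseteq> space M \<times> {\<omega>}"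
      proof
        fix p assume p: "p \<in> embed -` {t} \<inter> space (M \<Otimes>\<^sub>M B)"
        then have "dec t = (ret (fst p), snd p)" using dec_embed[of p] by auto
        then show "p \<in> space M \<times> {\<omega>}" using p d by (auto simp: space_pair_measure mem_Times_iff)
      qed
    qed (use s in simp)
    also have "\<dots> = 0" using s by (simp add: B.emeasure_pair_measure_Times bern.singleton_null)
    finally show ?thesis by (simp add: measure_def)
  qed
qed

lemma Y_ergodic_actions: "(Y, S) \<in> ergodic_actions G"
  using Y_ergodic Y_isomorphic by (simp add: ergodic_actions_def pmp_actions_def ergodic_system_def)

text \<open>A joining with the factor \<open>M\<close> lifts to the extension by adjoining an
  independent coin sequence. The lift is a product by assumption, and forgetting the coins gives
  back the original joining.\<close>

lemma disjoint_from_extension: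
  assumes W: "pmp_system G W V" and disj: "disjoint_systems G W V Y S"
  shows "disjoint_systems G W V M T"
proof (rule disjoint_systemsI[OF W pmp])
  fix L assume L: "L \<in> joinings G W V M T"
  note LD = joiningsD[OF L]
  interpret W: prob_space W using W by (simp add: pmp_system_def)
  interpret L: prob_space L by (rule LD(1))
  interpret LB: prob_space "L \<Otimes>\<^sub>M B" by (rule prob_space_pair[OF LD(1) B.prob_space_axioms])
  note [measurable_cong] = LD(2)
  have V: "V g \<in> W \<rightarrow>\<^sub>M W" if "g \<in> carrier G" for g using W that by (simp add: pmp_system_def)
  have spLB: "space (L \<Otimes>\<^sub>M B) = (space W \<times> space M) \<times> space B" by (simp add: space_pair_measure LD(3))
  define xo where "xo q = (snd (fst q), snd q)" for q :: "('b \<times> 'a) \<times> ('g \<Rightarrow> bool)"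
  have xo[measurable]: "xo \<in> L \<Otimes>\<^sub>M B \<rightarrow>\<^sub>M M \<Otimes>\<^sub>M B" unfolding xo_def by measurable
  have xo_law: "distr (L \<Otimes>\<^sub>M B) (M \<Otimes>\<^sub>M B) xo = M \<Otimes>\<^sub>M B"
  proof -
    have "distr L M snd \<Otimes>\<^sub>M distr B B (\<lambda>\<omega>. \<omega>) = distr (L \<Otimes>\<^sub>M B) (M \<Otimes>\<^sub>M B) (\<lambda>(q, \<omega>). (snd q, \<omega>))"
      by (rule pair_measure_distr) (simp_all add: distr_id2 B.sigma_finite_measure_axioms)
    then show ?thesis by (simp add: LD(5) distr_id2 xo_def[abs_def] split_beta')
  qed
  define \<psi> where "\<psi> q = (fst (fst q), embed (xo q))" for q
  have \<psi>[measurable]: "\<psi> \<in> L \<Otimes>\<^sub>M B \<rightarrow>\<^sub>M W \<Otimes>\<^sub>M Y" unfolding \<psi>_def by measurable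
  define J where "J = distr (L \<Otimes>\<^sub>M B) (W \<Otimes>\<^sub>M Y) \<psi>"
  have sJ: "sets J = sets (W \<Otimes>\<^sub>M Y)" by (simp add: J_def)
  have xo_X1: "AE q in L \<Otimes>\<^sub>M B. fst (xo q) \<in> X1"
  proof -
    have "AE p in distr (L \<Otimes>\<^sub>M B) (M \<Otimes>\<^sub>M B) xo. fst p \<in> X1" unfolding xo_law by (rule fst_X1_AE)
    then show ?thesis by (rule AE_distrD[OF xo])
  qed
  have "J \<in> joinings G W V Y S"
    unfolding joinings_def
  proof (intro CollectI conjI ballI sJ)
    show "prob_space J" unfolding J_def by (rule LB.prob_space_distr[OF \<psi>])
    have "distr J W fst = distr (distr (L \<Otimes>\<^sub>M B) L fst) W fst"
      unfolding J_def by (subst (1 2) distr_distr) (auto simp: comp_def \<psi>_def)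
    then show "distr J W fst = W" by (simp add: B.distr_pair_fst LD(4))
    have "distr J Y snd = distr (distr (L \<Otimes>\<^sub>M B) (M \<Otimes>\<^sub>M B) xo) Y embed"
      unfolding J_def by (subst (1 2) distr_distr) (auto simp: comp_def \<psi>_def)
    then show "distr J Y snd = Y" by (simp add: xo_law Y_law)
    fix g assume g: "g \<in> carrier G"
    have [measurable]: "V g \<in> W \<rightarrow>\<^sub>M W" "S g \<in> Y \<rightarrow>\<^sub>M Y" "T g \<in> M \<rightarrow>\<^sub>M M" "shift_B g \<in> B \<rightarrow>\<^sub>M B"
      using V S_measurable T bern.shift_measurable g by auto
    have mL: "map_prod (V g) (T g) \<in> L \<rightarrow>\<^sub>M L"
      unfolding measurable_cong_sets[OF LD(2) LD(2)] map_prod_def by measurable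
    have LB_inv: "distr (L \<Otimes>\<^sub>M B) (L \<Otimes>\<^sub>M B) (map_prod (map_prod (V g) (T g)) (shift_B g)) = L \<Otimes>\<^sub>M B"
      by (rule distr_pair_measure_map_prod[OF LD(1) B.prob_space_axioms mL _ LD(6)[OF g] bern.shift_invariant[OF g]]) simp
    have mLB: "map_prod (map_prod (V g) (T g)) (shift_B g) \<in> L \<Otimes>\<^sub>M B \<rightarrow>\<^sub>M L \<Otimes>\<^sub>M B"
    proof -
      have "(\<lambda>q. (map_prod (V g) (T g) (fst q), shift_B g (snd q))) \<in> L \<Otimes>\<^sub>M B \<rightarrow>\<^sub>M L \<Otimes>\<^sub>M B"
        using mL by measurable
      then show ?thesis by (simp add: map_prod_def[of "map_prod (V g) (T g)"] split_beta')
    qed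
    have mS: "map_prod (V g) (S g) \<in> W \<Otimes>\<^sub>M Y \<rightarrow>\<^sub>M W \<Otimes>\<^sub>M Y" unfolding map_prod_def by measurable
    have "distr J J (map_prod (V g) (S g)) = distr J (W \<Otimes>\<^sub>M Y) (map_prod (V g) (S g))"
      by (rule distr_cong) (simp_all add: sJ)
    also have "\<dots> = distr (L \<Otimes>\<^sub>M B) (W \<Otimes>\<^sub>M Y) (\<lambda>q. map_prod (V g) (S g) (\<psi> q))"
      unfolding J_def by (subst distr_distr[OF mS \<psi>]) (simp add: comp_def)
    also have "\<dots> = distr (L \<Otimes>\<^sub>M B) (W \<Otimes>\<^sub>M Y) (\<lambda>q. \<psi> (map_prod (map_prod (V g) (T g)) (shift_B g) q))"
    proof (rule distr_cong_AE)
      show "AE q in L \<Otimes>\<^sub>M B. map_prod (V g) (S g) (\<psi> q) = \<psi> (map_prod (map_prod (V g) (T g)) (shift_B g) q)"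
        using xo_X1 AE_space
      proof eventually_elim
        case (elim q)
        have "S g (embed (xo q)) = embed (U g (xo q))"
          by (rule S_embed[OF g measurable_space[OF xo elim(2)] elim(1)])
        then show ?case by (cases q) (auto simp: \<psi>_def U_def xo_def)
      qed
    qed (use measurable_compose[OF \<psi> mS] measurable_compose[OF mLB \<psi>] in simp_all)
    also have "\<dots> = distr (distr (L \<Otimes>\<^sub>M B) (L \<Otimes>\<^sub>M B) (map_prod (map_prod (V g) (T g)) (shift_B g))) (W \<Otimes>\<^sub>M Y) \<psi>"
      by (subst distr_distr[OF \<psi> mLB]) (simp add: comp_def)
    also have "\<dots> = J" unfolding LB_inv J_def ..
    finally show "distr J J (map_prod (V g) (S g)) = J" .
  qed
  then have J: "J = W \<Otimes>\<^sub>M Y" using disj by (simp add: disjoint_systems_def)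
  define r where "r p = (fst p, fst (dec (snd p)))" for p :: "'b \<times> real"
  have d1[measurable]: "(\<lambda>t. fst (dec t)) \<in> Y \<rightarrow>\<^sub>M M" by measurable
  have r[measurable]: "r \<in> W \<Otimes>\<^sub>M Y \<rightarrow>\<^sub>M W \<Otimes>\<^sub>M M"
    unfolding r_def by (rule measurable_Pair[OF measurable_fst measurable_compose[OF measurable_snd d1]])
  have Y_M: "distr Y M (\<lambda>t. fst (dec t)) = M"
  proof -
    have "distr Y M (\<lambda>t. fst (dec t)) = distr (distr (M \<Otimes>\<^sub>M B) Y embed) M (\<lambda>t. fst (dec t))" by (simp add: Y_law)
    also have "\<dots> = distr (M \<Otimes>\<^sub>M B) M (\<lambda>p. fst (dec (embed p)))"
      by (subst distr_distr[OF d1 embed_measurable]) (simp add: comp_def)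
    also have "\<dots> = distr (M \<Otimes>\<^sub>M B) M fst"
    proof (rule distr_cong_AE)
      show "AE p in M \<Otimes>\<^sub>M B. fst (dec (embed p)) = fst p"
        using fst_X1_AE AE_space by eventually_elim (simp add: dec_embed ret_def)
    qed (use measurable_compose[OF embed_measurable d1] in simp_all)
    also have "\<dots> = M" by (rule B.distr_pair_fst)
    finally show ?thesis .
  qed
  have "distr J (W \<Otimes>\<^sub>M M) r = L"
  proof -
    have "distr J (W \<Otimes>\<^sub>M M) r = distr (L \<Otimes>\<^sub>M B) (W \<Otimes>\<^sub>M M) (\<lambda>q. r (\<psi> q))"
      unfolding J_def by (subst distr_distr[OF r \<psi>]) (simp add: comp_def)
    also have "\<dots> = distr (L \<Otimes>\<^sub>M B) (W \<Otimes>\<^sub>M M) fst"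
    proof (rule distr_cong_AE)
      show "AE q in L \<Otimes>\<^sub>M B. r (\<psi> q) = fst q"
        using xo_X1 AE_space
      proof eventually_elim
        case (elim q)
        show ?case using elim(1) dec_embed[OF measurable_space[OF xo elim(2)]] by (cases q) (auto simp: r_def \<psi>_def ret_def xo_def)
      qed
      show "fst \<in> L \<Otimes>\<^sub>M B \<rightarrow>\<^sub>M W \<Otimes>\<^sub>M M"
        using measurable_fst[of L B] unfolding measurable_cong_sets[OF refl LD(2)] .
    qed (use measurable_compose[OF \<psi> r] in simp_all)
    also have "\<dots> = distr (L \<Otimes>\<^sub>M B) L fst" by (rule distr_cong) (simp_all add: LD(2))
    also have "\<dots> = L" by (rule B.distr_pair_fst)
    finally show ?thesis .
  qed
  moreover have "distr (W \<Otimes>\<^sub>M Y) (W \<Otimes>\<^sub>M M) r = W \<Otimes>\<^sub>M M"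
  proof -
    have "distr W W (\<lambda>w. w) \<Otimes>\<^sub>M distr Y M (\<lambda>t. fst (dec t)) = distr (W \<Otimes>\<^sub>M Y) (W \<Otimes>\<^sub>M M) (\<lambda>(w, t). (w, fst (dec t)))"
      by (rule pair_measure_distr) (simp_all add: Y_M M.sigma_finite_measure_axioms)
    then show ?thesis by (simp add: Y_M distr_id2 r_def[abs_def] split_beta')
  qed
  ultimately show "L = W \<Otimes>\<^sub>M M" by (simp add: J)
qed

end

theorem theorem3p3:
  fixes G :: "('g, 'k) monoid_scheme"
    and M :: "'a measure" and T :: "'g \<Rightarrow> 'a \<Rightarrow> 'a"
    and C :: "'c measure" and \<kappa> :: "'c \<Rightarrow> 'a measure"
  assumes "group G" and "countable (carrier G)"
    and "(M, T) \<in> pmp_actions G"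
    and "ergodic_decomposition G M T C \<kappa>"
  shows "(infinite (carrier G) \<longrightarrow>
      (\<forall>(Y :: real measure, S) \<in> ergodic_actions G. disjoint_systems G M T Y S) \<longrightarrow>
      emeasure (completion (C \<Otimes>\<^sub>M C)) (disjoint_component_pairs G T C \<kappa>) = 1) \<and>
     (emeasure (completion (C \<Otimes>\<^sub>M C)) (disjoint_component_pairs G T C \<kappa>) = 1 \<longrightarrow>
      (\<forall>(Y :: 'b measure, S) \<in> ergodic_actions G. disjoint_systems G M T Y S))"
proof -
  have pmp: "pmp_system G M T" and iso: "isomorphic_mod0 M unit_lebesgue"
    using assms(3) by (auto simp: pmp_actions_def)
  obtain f f' X0 where std: "standard_model M f f' X0" and X0: "AE x in M. x \<in> X0"
    using standard_model_exists[OF iso] .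
  obtain \<pi> where dec: "ergodic_decomp G M T C \<kappa> \<pi>"
    using assms(4) pmp assms(1,2) unfolding ergodic_decomposition_def ergodic_decomp_def by blast
  interpret D: ergodic_decomp G M T C \<kappa> \<pi> by (rule dec)
  have sys: "standard_system M f f' X0 G T"
    unfolding standard_system_def standard_system_axioms_def using std assms(1,2) pmp by simp
  show ?thesis
  proof (intro conjI impI)
    assume inf: "infinite (carrier G)"
      and disj: "\<forall>(Y :: real measure, S) \<in> ergodic_actions G. disjoint_systems G M T Y S"
    interpret SD: standard_decomp G M T C \<kappa> \<pi> f f' X0
      unfolding standard_decomp_def standard_decomp_axioms_def using dec sys X0 by simp
    show "emeasure (completion (C \<Otimes>\<^sub>M C)) (disjoint_component_pairs G T C \<kappa>) = 1"
    proof (rule SD.disjoint_component_pairs_full)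
      fix d assume d: "d \<in> SD.standard_components"
      note \<kappa>d = D.\<kappa>D[OF SD.standard_componentsD(1)[OF d]]
      \<comment> \<open>\<open>\<kappa> d\<close> has the same measurable sets as \<open>M\<close>,
        so the coding maps carry over unchanged.\<close>
      have "standard_model (\<kappa> d) f f' X0"
        using std \<kappa>d(3) unfolding standard_model_def
        by (simp add: measurable_cong_sets[OF \<kappa>d(2) refl] measurable_cong_sets[OF refl \<kappa>d(2)] \<kappa>d(2))
      then interpret X: bernoulli_extension "\<kappa> d" f f' X0 G T
        unfolding bernoulli_extension_def bernoulli_extension_axioms_def standard_system_def
          standard_system_axioms_def bernoulli_def
        using assms(1,2) \<kappa>d(4) inf D.comp[OF SD.standard_componentsD(1)[OF d]] SD.standard_componentsD(2)[OF d] by simp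
      \<comment> \<open>The extension is a measure on \<open>real\<close>, the carrier type over
        which the hypothesis ranges.\<close>
      have "disjoint_systems G M T X.Y X.S" using disj X.Y_ergodic_actions by blast
      then show "disjoint_systems G M T (\<kappa> d) T" by (rule X.disjoint_from_extension[OF pmp])
    qed
  next
    assume full: "emeasure (completion (C \<Otimes>\<^sub>M C)) (disjoint_component_pairs G T C \<kappa>) = 1"
    interpret CC: pair_prob_space C C ..
    interpret comp: prob_space "completion (C \<Otimes>\<^sub>M C)" by (rule CC.prob_space_completion)
    have "AE p in completion (C \<Otimes>\<^sub>M C). p \<in> disjoint_component_pairs G T C \<kappa>"
    proof -
      \<comment> \<open>A set outside the sigma-algebra has \<open>emeasure\<close> 0, so the value
        1 already yields measurability in the completion.\<close>
      have "disjoint_component_pairs G T C \<kappa> \<in> sets (completion (C \<Otimes>\<^sub>M C))"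
        using full emeasure_notin_sets[of "disjoint_component_pairs G T C \<kappa>" "completion (C \<Otimes>\<^sub>M C)"] by fastforce
      moreover have "comp.prob (disjoint_component_pairs G T C \<kappa>) = 1"
        by (simp only: measure_def full enn2real_1)
      ultimately show ?thesis using comp.prob_eq_1 by blast
    qed
    then have "AE p in C \<Otimes>\<^sub>M C. p \<in> disjoint_component_pairs G T C \<kappa>"
      by (simp add: AE_completion_iff)
    then have ae: "AE p in C \<Otimes>\<^sub>M C. disjoint_systems G (\<kappa> (fst p)) T (\<kappa> (snd p)) T"
      by eventually_elim (auto simp: disjoint_component_pairs_def)
    show "\<forall>(Y :: 'b measure, S) \<in> ergodic_actions G. disjoint_systems G M T Y S"
    proof (intro ballI, clarify)
      fix Y :: "'b measure" and S assume "(Y, S) \<in> ergodic_actions G"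
      then have Y: "ergodic_system G Y S" by (simp add: ergodic_actions_def)
      show "disjoint_systems G M T Y S"
      proof (rule disjoint_systemsI[OF pmp])
        show "pmp_system G Y S" using Y by (simp add: ergodic_system_def)
        fix J assume J: "J \<in> joinings G M T Y S"
        interpret EJ: ergodic_joining G M T C \<kappa> \<pi> f f' X0 Y S J
          unfolding ergodic_joining_def ergodic_joining_axioms_def using dec std Y J X0 by simp
        show "J = M \<Otimes>\<^sub>M Y" by (rule EJ.joining_eq_pair[OF ae])
      qed
    qed
  qed
qed

end
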